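(* Let $M=\mathrm{T}^\ast S^6$ with the Stenzel Calabi-Yau structure $(I,\omega_{\mathrm{Stz}},\Omega_{\mathrm{Stz}})$. Let $$H=\{\mathrm{diag}(h_1,h_2,h_3)\in GL(7,\mathbb{R})\mid h_1,h_2\in SO(2),\ h_3\in SO(3)\}\cong SO(2)\times SO(2)\times SO(3)$$ (block-diagonal), acting on $\mathrm{T}^\ast S^6$ by $h\cdot(x,\xi)=(hx,h\xi)$, with Lie algebra $\mathfrak{h}=\mathrm{span}\{\xi_{12},\xi_{34},\xi_{56},\xi_{57},\xi_{67}\}$ and moment map $\mu:M\to\mathfrak{h}^\ast$ as given in the context; put $\mu_{ij}(p)=\langle\mu(p),\xi_{ij}\rangle$. Let $$L=\{({}^t(x_1,0,x_3,0,x_5,0,0),\,{}^t(0,\xi_2,0,\xi_4,0,\xi_6,\xi_7))\mid x_1^2+x_3^2+x_5^2=1,\ \xi_2,\xi_4,\xi_6,\xi_7\in\mathbb{R}\}$$ and define its rank two subbundle (over the same base $S^2$) $$\hat L=\{({}^t(x_1,0,x_3,0,x_5,0,0),\,{}^t(0,\xi_2,0,\xi_4,0,0,0))\mid x_1^2+x_3^2+x_5^2=1,\ \xi_2,\xi_4\in\mathbb{R}\}\subset L.$$ Let $\hat L^{\mathrm{pr}}$ be the set of all $p\in\hat L$ such that the isotropy subgroup $H_p$ satisfies $H_p\subset H_q$ for all $q\in\hat L$. For $(c_1,c_2)\in\mathbb{R}^2$ put $$V_{(c_1,c_2)}=\hat L^{\mathrm{pr}}\cap\{p\in M\mid \mu_{12}(p)=c_1,\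 \mu_{34}(p)=c_2,\ \mu_{56}(p)=\mu_{57}(p)=\mu_{67}(p)=0\},$$ $$\hat V_{(c_1,c_2)}=\hat L\cap\{p\in M\mid \mu_{12}(p)=c_1,\ \mu_{34}(p)=c_2,\ \mu_{56}(p)=\mu_{57}(p)=\mu_{67}(p)=0\}.$$ Then for every $(c_1,c_2)\neq(0,0)$ in $\mathbb{R}^2$ such that $V_{(c_1,c_2)}\neq\emptyset$, $H\cdot V_{(c_1,c_2)}$ is a special Lagrangian submanifold of $M$; and $H\cdot\hat V_{(0,0)}$ is a union of five connected special Lagrangian submanifolds of $M$.
   Context: Write $\mathrm{T}^\ast S^n=\{(x,\xi)\in\mathbb{R}^{n+1}\times\mathbb{R}^{n+1}\mid \|x\|=1,\ x\cdot\xi=0\}$ (tangent and cotangent bundles identified), on which $SO(n+1)$ acts by $h\cdot(x,\xi)=(hx,h\xi)$. Let $Q^n=\{z\in\mathbb{C}^{n+1}\mid\sum_{i=1}^{n+1}z_i^2=1\}$. The map $\Phi:\mathrm{T}^\ast S^n\to Q^n$, $\Phi(x,\xi)=\cosh(\|\xi\|)x+\sqrt{-1}\,\frac{\sinh(\|\xi\|)}{\|\xi\|}\xi$ (with $\Phi(x,0)=x$), is an $SO(n+1)$-equivariant diffeomorphism, and $\mathrm{T}^\ast S^n$ is identified with $Q^n$ through $\Phi$. The complex structure $I$ is the one of $Q^n\subset\mathbb{C}^{n+1}$. The Stenzel Kähler form is $\omega_{\mathrm{Stz}}=\sqrt{-1}\,\partial\bar\partial u(r^2)$ restricted to $Q^n$,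 where $r^2=\sum_i z_i\bar z_i$ and $u$ is a smooth real function such that $U(t)=u(\cosh t)$ satisfies $\frac{d}{dt}(U'(t))^n=\kappa n(\sinh t)^{n-1}$ with a constant $\kappa>0$, the constant of integration being chosen so that $\omega_{\mathrm{Stz}}$ is a Kähler form on all of $Q^n$ (i.e. $U'(0)=0$); then $U'(t)>0$, $U''(t)>0$ and $u'(t)>0$ for $t>0$ in the relevant range. $\Omega_{\mathrm{Stz}}$ is a holomorphic volume form on $Q^n$ satisfying $\frac{\omega_{\mathrm{Stz}}^n}{n!}=(-1)^{\frac{n(n-1)}{2}}\left(\frac{\sqrt{-1}}{2}\right)^n\Omega_{\mathrm{Stz}}\wedge\overline{\Omega_{\mathrm{Stz}}}$; it is determined up to a constant phase and is a constant multiple of the form $\Omega_0$ on $Q^n$ characterized by $\frac12 d(\sum z_i^2)\wedge\Omega_0=dz_1\wedge\cdots\wedge dz_{n+1}$ along $Q^n$. It is $SO(n+1)$-invariant. The moment map used is, under the identification by $\Phi$, $\langle\mu(z),X\rangle=u'(r^2)\,(Iz)\cdot(Xz)$ for $z\in Q^n$ and $X\in\mathfrak{h}\subset\mathfrak{so}(n+1)$, where $Iz=\sqrt{-1}z$ and $\cdot$ is the canonical real inner product on $\mathbb{C}^{n+1}\cong\mathbb{R}^{2n+2}$. Here $n=6$ and $\xi_{ij}=E_{ji}-E_{ij}$, where $E_{ij}$ is the $7\times 7$ matrix whose $(i,j)$-entry is $1$ and whose other entries are $0$. A Lagrangian submanifold of $M$ ($\dim_{\mathbb R} M=2n$) is an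 $n$-dimensional submanifold on which $\omega_{\mathrm{Stz}}$ vanishes. It is special Lagrangian if its (local) Lagrangian angle $\theta$, defined by $\iota^\ast\Omega_{\mathrm{Stz}}=e^{\sqrt{-1}\theta}\mathrm{vol}_{\iota^\ast g}$ for (local) orientations, with $\iota$ the inclusion and $g$ the Kähler metric, is constant. *)

theory Defs
  imports "HOL-Analysis.Analysis" "HOL-Combinatorics.Permutations"
begin

section \<open>Smooth and holomorphic maps\<close>

text \<open>Both notions are meant for open \<^term>\<open>S\<close>. Requiring that all directional derivatives of
  a differentiable map are \<open>C\<^sup>k\<close> is the usual \<open>C\<^sup>k\<^sup>+\<^sup>1\<close> condition, as the domain is finite-dimensional.\<close>

primrec Ck_on :: "nat \<Rightarrow> 'a::euclidean_space set \<Rightarrow> ('a \<Rightarrow> 'b::real_normed_vector) \<Rightarrow> bool" where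
  "Ck_on 0 S f \<longleftrightarrow> continuous_on S f"
| "Ck_on (Suc k) S f \<longleftrightarrow>
     (\<exists>f'. (\<forall>x\<in>S. (f has_derivative f' x) (at x)) \<and> (\<forall>v. Ck_on k S (\<lambda>x. f' x v)))"

definition smooth_on :: "'a::euclidean_space set \<Rightarrow> ('a \<Rightarrow> 'b::real_normed_vector) \<Rightarrow> bool" where
  "smooth_on S f \<longleftrightarrow> (\<forall>k. Ck_on k S f)"

definition holomorphic_several :: "(complex^'m) set \<Rightarrow> (complex^'m \<Rightarrow> complex) \<Rightarrow> bool" where
  "holomorphic_several S f \<longleftrightarrow>
     (\<forall>z\<in>S. \<exists>D. (f has_derivative D) (at z) \<and> (\<forall>a v. D (a *s v) = a * D v))"


section \<open>Exterior forms at a point\<close>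

text \<open>A \<open>k\<close>-form takes a sequence of vectors and depends on the entries \<open>0, \<dots>, k - 1\<close> only.
  The wedge product has \<open>(\<alpha> \<and> \<beta>)(v, w) = \<alpha>(v) \<beta>(w) - \<alpha>(w) \<beta>(v)\<close> for 1-forms.\<close>

type_synonym 'v form = "(nat \<Rightarrow> 'v) \<Rightarrow> complex"

definition wedge :: "nat \<Rightarrow> nat \<Rightarrow> 'v form \<Rightarrow> 'v form \<Rightarrow> 'v form" where
  "wedge k l \<alpha> \<beta> = (\<lambda>v. (\<Sum>\<sigma> | \<sigma> permutes {..<k + l}.
     of_int (sign \<sigma>) * \<alpha> (\<lambda>i. v (\<sigma> i)) * \<beta> (\<lambda>i. v (\<sigma> (k + i)))) / (fact k * fact l))"

primrec wedge_power :: "nat \<Rightarrow> 'v form \<Rightarrow> 'v form" where  \<comment> \<open>powers of a 2-form\<close>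
  "wedge_power 0 \<omega> = (\<lambda>v. 1)"
| "wedge_power (Suc m) \<omega> = wedge 2 (2 * m) \<omega> (wedge_power m \<omega>)"

definition complex_alternating :: "nat \<Rightarrow> (complex^'m) form \<Rightarrow> bool" where
  "complex_alternating k \<alpha> \<longleftrightarrow>
     (\<forall>v w. (\<forall>i<k. v i = w i) \<longrightarrow> \<alpha> v = \<alpha> w) \<and>
     (\<forall>v. \<forall>i<k. \<forall>a b x y. \<alpha> (v(i := a *s x + b *s y)) = a * \<alpha> (v(i := x)) + b * \<alpha> (v(i := y))) \<and>
     (\<forall>v. \<forall>i<k. \<forall>j<k. i \<noteq> j \<and> v i = v j \<longrightarrow> \<alpha> v = 0)"


section \<open>The cotangent bundle of the sphere and the affine quadric\<close>

definition TS :: "((real^'m) \<times> (real^'m)) set" where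
  "TS = {(x, \<xi>). norm x = 1 \<and> x \<bullet> \<xi> = 0}"

definition quadric :: "(complex^'m) set" where
  "quadric = {z. (\<Sum>i\<in>UNIV. (z $ i)\<^sup>2) = 1}"

definition quadric_tangent :: "complex^'m \<Rightarrow> (complex^'m) set" where
  "quadric_tangent z = {v. (\<Sum>i\<in>UNIV. z $ i * v $ i) = 0}"

text \<open>For \<open>\<xi> = 0\<close> the second summand vanishes, so the value is \<open>x\<close>.\<close>

definition Phi :: "(real^'m) \<times> (real^'m) \<Rightarrow> complex^'m" where
  "Phi = (\<lambda>(x, \<xi>). \<chi> i. of_real (cosh (norm \<xi>) * x $ i) +
                          \<i> * of_real (sinh (norm \<xi>) / norm \<xi> * \<xi> $ i))"

definition rsq :: "complex^'m \<Rightarrow> real" where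
  "rsq z = Re (\<Sum>i\<in>UNIV. z $ i * cnj (z $ i))"


section \<open>The Stenzel structure\<close>

definition d_z :: "'m \<Rightarrow> (complex^'m \<Rightarrow> complex) \<Rightarrow> complex^'m \<Rightarrow> complex" where
  "d_z j f z = (frechet_derivative f (at z) (axis j 1) - \<i> * frechet_derivative f (at z) (axis j \<i>)) / 2"

definition d_zbar :: "'m \<Rightarrow> (complex^'m \<Rightarrow> complex) \<Rightarrow> complex^'m \<Rightarrow> complex" where
  "d_zbar j f z = (frechet_derivative f (at z) (axis j 1) + \<i> * frechet_derivative f (at z) (axis j \<i>)) / 2"

definition i_ddbar :: "(complex^'m \<Rightarrow> complex) \<Rightarrow> complex^'m \<Rightarrow> complex^'m \<Rightarrow> complex^'m \<Rightarrow> complex" where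
  "i_ddbar f z v w = \<i> * (\<Sum>j\<in>UNIV. \<Sum>k\<in>UNIV.
     d_z j (d_zbar k f) z * (v $ j * cnj (w $ k) - w $ j * cnj (v $ k)))"

text \<open>The forms on the quadric are given by ambient expressions, to be evaluated at points of the
  quadric on vectors tangent to it. The metric is \<open>g(v, w) = \<omega>(v, I w)\<close>.\<close>

definition stenzel_form :: "(real \<Rightarrow> real) \<Rightarrow> complex^'m \<Rightarrow> complex^'m \<Rightarrow> complex^'m \<Rightarrow> complex" where
  "stenzel_form u = i_ddbar (\<lambda>z. of_real (u (rsq z)))"

definition stenzel_metric :: "(real \<Rightarrow> real) \<Rightarrow> complex^'m \<Rightarrow> complex^'m \<Rightarrow> complex^'m \<Rightarrow> real" where
  "stenzel_metric u z v w = Re (stenzel_form u z v (\<i> *s w))"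

text \<open>The ambient coordinate space has dimension \<open>n + 1\<close>. Being \<open>\<i>\<partial>\<partial>\<close>-exact, the Stenzel form is
  automatically a closed real (1,1)-form, so that it is Kaehler iff it is positive.\<close>

definition stenzel_potential :: "'m::finite itself \<Rightarrow> real \<Rightarrow> (real \<Rightarrow> real) \<Rightarrow> bool" where
  "stenzel_potential TYPE('m) \<kappa> u \<longleftrightarrow>
     (let n = CARD('m) - 1; U = (\<lambda>t. u (cosh t)) in
       \<kappa> > 0 \<and>
       (\<exists>S. open S \<and> {1..} \<subseteq> S \<and> smooth_on S u) \<and>
       (\<forall>t. ((\<lambda>s. deriv U s ^ n) has_real_derivative \<kappa> * real n * sinh t ^ (n - 1)) (at t)) \<and>
       deriv U 0 = 0 \<and>
       (\<forall>z\<in>quadric :: (complex^'m) set. \<forall>v\<in>quadric_tangent z. v \<noteq> 0 \<longrightarrow> stenzel_metric u z v v > 0))"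

text \<open>A holomorphic volume form on the quadric: locally the restriction of a holomorphic \<open>n\<close>-form on
  an open subset of the ambient space, and nowhere zero.\<close>

definition holomorphic_volume_form :: "(complex^'m \<Rightarrow> (complex^'m) form) \<Rightarrow> bool" where
  "holomorphic_volume_form \<Omega> \<longleftrightarrow>
     (\<forall>z0\<in>quadric. \<exists>G \<Omega>'. open G \<and> z0 \<in> G \<and>
        (\<forall>z\<in>G. complex_alternating (CARD('m) - 1) (\<Omega>' z)) \<and>
        (\<forall>v. holomorphic_several G (\<lambda>z. \<Omega>' z v)) \<and>
        (\<forall>z\<in>G \<inter> quadric. \<forall>v. (\<forall>i<CARD('m) - 1. v i \<in> quadric_tangent z) \<longrightarrow> \<Omega> z v = \<Omega>' z v)) \<and>
     (\<forall>z\<in>quadric. \<exists>v. (\<forall>i<CARD('m) - 1. v i \<in> quadric_tangent z) \<and> \<Omega> z v \<noteq> 0)"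

definition stenzel_calabi_yau ::
  "real \<Rightarrow> (real \<Rightarrow> real) \<Rightarrow> (complex^'m::finite \<Rightarrow> (complex^'m) form) \<Rightarrow> bool" where
  "stenzel_calabi_yau \<kappa> u \<Omega> \<longleftrightarrow>
     stenzel_potential TYPE('m) \<kappa> u \<and> holomorphic_volume_form \<Omega> \<and>
     (let n = CARD('m) - 1 in
       \<forall>z\<in>quadric. \<forall>v. (\<forall>i<2 * n. v i \<in> quadric_tangent z) \<longrightarrow>
         wedge_power n (\<lambda>w. stenzel_form u z (w 0) (w 1)) v / fact n =
         (- 1) ^ (n * (n - 1) div 2) * (\<i> / 2) ^ n * wedge n n (\<Omega> z) (\<lambda>w. cnj (\<Omega> z w)) v)"


section \<open>Special Lagrangian submanifolds\<close>

definition local_parametrization :: "(real^'n) set \<Rightarrow> (real^'n \<Rightarrow> 'b::real_normed_vector) \<Rightarrow> 'b set \<Rightarrow> bool" where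
  "local_parametrization W \<phi> N \<longleftrightarrow>
     open W \<and> smooth_on W \<phi> \<and>
     (\<forall>x\<in>W. inj (frechet_derivative \<phi> (at x))) \<and>
     (\<exists>G. open G \<and> \<phi> ` W = N \<inter> G) \<and>
     (\<exists>\<psi>. homeomorphism W (\<phi> ` W) \<phi> \<psi>)"

text \<open>A Lagrangian submanifold is an embedded submanifold of dimension 6, not necessarily closed,
  on which the Stenzel form vanishes.\<close>

definition lagrangian :: "(real \<Rightarrow> real) \<Rightarrow> (complex^7) set \<Rightarrow> bool" where
  "lagrangian u N \<longleftrightarrow> N \<subseteq> quadric \<and>
     (\<forall>p\<in>N. \<exists>(W :: (real^6) set) \<phi>. local_parametrization W \<phi> N \<and> p \<in> \<phi> ` W \<and>
        (\<forall>x\<in>W. \<forall>v w. stenzel_form u (\<phi> x)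
           (frechet_derivative \<phi> (at x) v) (frechet_derivative \<phi> (at x) w) = 0))"

definition coord_frame :: "(real^6 \<Rightarrow> 'b::real_normed_vector) \<Rightarrow> real^6 \<Rightarrow> nat \<Rightarrow> 'b" where
  "coord_frame \<phi> x i = frechet_derivative \<phi> (at x) (axis (of_nat i) 1)"

text \<open>The volume of the coordinate frame is the square root of its Gram determinant.\<close>

definition frame_volume :: "(real \<Rightarrow> real) \<Rightarrow> (real^6 \<Rightarrow> complex^7) \<Rightarrow> real^6 \<Rightarrow> real" where
  "frame_volume u \<phi> x = sqrt (det (\<chi> i j :: 6. stenzel_metric u (\<phi> x)
     (frechet_derivative \<phi> (at x) (axis i 1)) (frechet_derivative \<phi> (at x) (axis j 1))))"

text \<open>\<^term>\<open>\<theta>\<close> is the Lagrangian angle on the patch \<open>\<phi>(W)\<close> for the orientation in which the coordinate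
  frame of \<open>\<phi>\<close> is positive, the equation being \<open>\<Omega> = e\<^sup>i\<^sup>\<theta> vol\<close> evaluated on that frame.\<close>

definition lagrangian_angle ::
  "(real \<Rightarrow> real) \<Rightarrow> (complex^7 \<Rightarrow> (complex^7) form) \<Rightarrow> (real^6) set \<Rightarrow> (real^6 \<Rightarrow> complex^7) \<Rightarrow>
   (real^6 \<Rightarrow> real) \<Rightarrow> bool" where
  "lagrangian_angle u \<Omega> W \<phi> \<theta> \<longleftrightarrow>
     (\<forall>x\<in>W. \<Omega> (\<phi> x) (coord_frame \<phi> x) = cis (\<theta> x) * of_real (frame_volume u \<phi> x))"

definition special_lagrangian ::
  "(real \<Rightarrow> real) \<Rightarrow> (complex^7 \<Rightarrow> (complex^7) form) \<Rightarrow> (complex^7) set \<Rightarrow> bool" where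
  "special_lagrangian u \<Omega> N \<longleftrightarrow> lagrangian u N \<and>
     (\<exists>\<theta>. \<forall>p\<in>N. \<exists>W \<phi>. local_parametrization W \<phi> N \<and> p \<in> \<phi> ` W \<and>
        lagrangian_angle u \<Omega> W \<phi> (\<lambda>x. \<theta>))"

text \<open>The cotangent bundle carries the structure of the quadric through \<^const>\<open>Phi\<close>.\<close>

definition special_lagrangian_TS ::
  "(real \<Rightarrow> real) \<Rightarrow> (complex^7 \<Rightarrow> (complex^7) form) \<Rightarrow> ((real^7) \<times> (real^7)) set \<Rightarrow> bool" where
  "special_lagrangian_TS u \<Omega> N \<longleftrightarrow> N \<subseteq> TS \<and> special_lagrangian u \<Omega> (Phi ` N)"


section \<open>The group action and its moment map\<close>

definition act :: "real^'m^'m \<Rightarrow> (real^'m) \<times> (real^'m) \<Rightarrow> (real^'m) \<times> (real^'m)" where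
  "act h p = (h *v fst p, h *v snd p)"

definition block_diag :: "real^2^2 \<Rightarrow> real^2^2 \<Rightarrow> real^3^3 \<Rightarrow> real^7^7" where
  "block_diag a b c = vector
    [vector [a$1$1, a$1$2, 0, 0, 0, 0, 0],
     vector [a$2$1, a$2$2, 0, 0, 0, 0, 0],
     vector [0, 0, b$1$1, b$1$2, 0, 0, 0],
     vector [0, 0, b$2$1, b$2$2, 0, 0, 0],
     vector [0, 0, 0, 0, c$1$1, c$1$2, c$1$3],
     vector [0, 0, 0, 0, c$2$1, c$2$2, c$2$3],
     vector [0, 0, 0, 0, c$3$1, c$3$2, c$3$3]]"

definition H :: "(real^7^7) set" where
  "H = {block_diag h1 h2 h3 | h1 h2 h3. rotation_matrix h1 \<and> rotation_matrix h2 \<and> rotation_matrix h3}"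

definition isotropy :: "(real^7) \<times> (real^7) \<Rightarrow> (real^7^7) set" where
  "isotropy p = {h \<in> H. act h p = p}"

definition saturation :: "((real^7) \<times> (real^7)) set \<Rightarrow> ((real^7) \<times> (real^7)) set" where
  "saturation A = {act h p | h p. h \<in> H \<and> p \<in> A}"  \<comment> \<open>\<open>H \<cdot> A\<close>\<close>

definition matrix_unit :: "'m \<Rightarrow> 'm \<Rightarrow> real^'m^'m" where
  "matrix_unit i j = (\<chi> k l. if k = i \<and> l = j then 1 else 0)"

definition xi :: "'m \<Rightarrow> 'm \<Rightarrow> real^'m^'m" where
  "xi i j = matrix_unit j i - matrix_unit i j"

text \<open>The pairing of the moment map at \<open>z\<close> with \<open>X\<close>; on \<^typ>\<open>complex^'m\<close> the operation \<open>\<bullet>\<close> is the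
  canonical real inner product.\<close>

definition moment_pairing :: "(real \<Rightarrow> real) \<Rightarrow> complex^'m \<Rightarrow> real^'m^'m \<Rightarrow> real" where
  "moment_pairing u z X = deriv u (rsq z) * ((\<i> *s z) \<bullet> (map_matrix of_real X *v z))"

definition mu :: "(real \<Rightarrow> real) \<Rightarrow> 'm \<Rightarrow> 'm \<Rightarrow> (real^'m) \<times> (real^'m) \<Rightarrow> real" where
  "mu u i j p = moment_pairing u (Phi p) (xi i j)"


section \<open>The Lagrangian and its subbundle\<close>

text \<open>In the index type \<^typ>\<open>7\<close> the numerals 1 to 7 denote its seven distinct elements (with \<open>7 = 0\<close>).\<close>

definition L :: "((real^7) \<times> (real^7)) set" where
  "L = {(vector [x1, 0, x3, 0, x5, 0, 0], vector [0, xi2, 0, xi4, 0, xi6, xi7]) |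
         x1 x3 x5 xi2 xi4 xi6 xi7. x1\<^sup>2 + x3\<^sup>2 + x5\<^sup>2 = 1}"

definition L_hat :: "((real^7) \<times> (real^7)) set" where
  "L_hat = {(vector [x1, 0, x3, 0, x5, 0, 0], vector [0, xi2, 0, xi4, 0, 0, 0]) |
         x1 x3 x5 xi2 xi4. x1\<^sup>2 + x3\<^sup>2 + x5\<^sup>2 = 1}"

lemma L_hat_subset_L: "L_hat \<subseteq> L"
  unfolding L_hat_def L_def by blast

definition L_hat_pr :: "((real^7) \<times> (real^7)) set" where
  "L_hat_pr = {p \<in> L_hat. \<forall>q\<in>L_hat. isotropy p \<subseteq> isotropy q}"

definition moment_level :: "(real \<Rightarrow> real) \<Rightarrow> real \<Rightarrow> real \<Rightarrow> ((real^7) \<times> (real^7)) set" where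
  "moment_level u c1 c2 =
     {p \<in> TS. mu u 1 2 p = c1 \<and> mu u 3 4 p = c2 \<and> mu u 5 6 p = 0 \<and> mu u 5 7 p = 0 \<and> mu u 6 7 p = 0}"

definition V :: "(real \<Rightarrow> real) \<Rightarrow> real \<Rightarrow> real \<Rightarrow> ((real^7) \<times> (real^7)) set" where
  "V u c1 c2 = L_hat_pr \<inter> moment_level u c1 c2"

definition V_hat :: "(real \<Rightarrow> real) \<Rightarrow> real \<Rightarrow> real \<Rightarrow> ((real^7) \<times> (real^7)) set" where
  "V_hat u c1 c2 = L_hat \<inter> moment_level u c1 c2"

end

theory Submission
  imports Defs "HOL-Complex_Analysis.Cauchy_Integral_Formula"
begin

text \<open>
  The first point is that \<open>\<Omega> = c \<Omega>\<^sub>0\<close> with a constant \<open>c\<close>. The differential equation for \<open>u\<close> makes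
  \<open>\<omega>\<^sup>6\<close> a constant multiple of \<open>\<Omega>\<^sub>0 \<and> cnj \<Omega>\<^sub>0\<close>, so that \<open>\<Omega> / \<Omega>\<^sub>0\<close> has constant modulus; it is holomorphic,
  and any two points of the quadric can be joined through entire curves
  \<open>\<zeta> \<mapsto> cos(\<zeta>) x + sin(\<zeta>) y\<close>, along which it is constant by Liouville's theorem. On a Lagrangian frame the
  Gram determinant is then \<open>|\<Omega>|\<^sup>2\<close>, so that a Lagrangian submanifold is special as soon as \<open>\<Omega>\<^sub>0\<close> has
  constant phase on it up to sign, the sign being absorbed by the orientation of the chart.

  The image of \<open>H \<cdot> V\<close> under \<^const>\<open>Phi\<close> consists of the \<open>z\<close> for which \<open>(z\<^sub>1, z\<^sub>2)\<close>, \<open>(z\<^sub>3, z\<^sub>4)\<close> and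
  \<open>(z\<^sub>5, z\<^sub>6, z\<^sub>7)\<close> are nonzero, \<open>z\<^sub>5, z\<^sub>6, z\<^sub>7\<close> are real, the real and imaginary parts are orthogonal in each of the planes \<open>(z\<^sub>1, z\<^sub>2)\<close> and \<open>(z\<^sub>3, z\<^sub>4)\<close>, and
  \<open>-2 u'(r\<^sup>2) Im(cnj z\<^sub>1 z\<^sub>2) = c\<^sub>1\<close>, \<open>-2 u'(r\<^sup>2) Im(cnj z\<^sub>3 z\<^sub>4) = c\<^sub>2\<close>. These equations are solved as a graph over
  the real (if \<open>c\<^sub>i = 0\<close> and the plane component is real) or the imaginary parts of the coordinates.

  For \<open>c = 0\<close> the saturation is the union of the four sets of \<open>z\<close> whose coordinates are real or imaginary
  according to a fixed pattern that is uniform on each of the two planes. Members need be neither closed nor disjoint, and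
  the fifth one is an open hemisphere of the zero section.
\<close>


section \<open>Finite index types\<close>

text \<open>The level equations contain u'(r^2), and r^2 involves every coordinate, so solving them
  as a graph looks like an implicit problem. It becomes explicit because r^2 = 1 + 2 |Im z|^2 on the
  quadric: in each plane the chart coordinates are either the imaginary parts themselves or, when
  the plane component is real, the imaginary parts vanish. Hence u'(r^2) is a known function of the
  coordinates, the other half of each plane is an explicit multiple F of the rotated coordinates,
  and a single square root, for one of z_5, z_6, z_7, remains. The Lagrangian condition comes down
  to the derivative of the relation F u'(r^2) |x|^2 = c/2. On a level set the phase is the same in
  all charts because the coefficients k_1, k_2 in {1, i}, which record the choice in each plane,
  enter the determinant squared. The constant 64 \<kappa>, the value of |\<Omega>/\<Omega>_0|^2, is
  2^6 \<kappa>: the factor 2^6 comes from \<omega> = -2 Im h with h the complex Hessian of u(r^2),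
  and the differential equation says that the determinant of h in an adapted frame is
  \<kappa>.\<close>

lemma exhaust_7: fixes x :: 7
  shows "x = 1 \<or> x = 2 \<or> x = 3 \<or> x = 4 \<or> x = 5 \<or> x = 6 \<or> x = 7"
proof (induct x)
  case (of_int z)
  then have "0 \<le> z" and "z < 7" by simp_all
  then have "z = 0 \<or> z = 1 \<or> z = 2 \<or> z = 3 \<or> z = 4 \<or> z = 5 \<or> z = 6" by arith
  then show ?case by auto
qed

lemma forall_7: "(\<forall>i::7. P i) \<longleftrightarrow> P 1 \<and> P 2 \<and> P 3 \<and> P 4 \<and> P 5 \<and> P 6 \<and> P 7"
  by (metis exhaust_7)

lemma UNIV_7: "UNIV = {1, 2, 3, 4, 5, 6, 7::7}"
  using exhaust_7 by auto

lemma sum_7: "sum f (UNIV::7 set) = f 1 + f 2 + f 3 + f 4 + f 5 + f 6 + f 7"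
  unfolding UNIV_7 by (simp add: ac_simps)

lemma vector_7 [simp]:
  "(vector [x1,x2,x3,x4,x5,x6,x7] :: 'a::zero^7)$1 = x1"
  "(vector [x1,x2,x3,x4,x5,x6,x7] :: 'a::zero^7)$2 = x2"
  "(vector [x1,x2,x3,x4,x5,x6,x7] :: 'a::zero^7)$3 = x3"
  "(vector [x1,x2,x3,x4,x5,x6,x7] :: 'a::zero^7)$4 = x4"
  "(vector [x1,x2,x3,x4,x5,x6,x7] :: 'a::zero^7)$5 = x5"
  "(vector [x1,x2,x3,x4,x5,x6,x7] :: 'a::zero^7)$6 = x6"
  "(vector [x1,x2,x3,x4,x5,x6,x7] :: 'a::zero^7)$7 = x7"
  unfolding vector_def by simp_all


section \<open>Calculus of smooth maps\<close>

lemma Ck_on_continuous: "Ck_on k S f \<Longrightarrow> continuous_on S f"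
proof (cases k)
  case (Suc n)
  assume "Ck_on k S f"
  then obtain f' where "\<forall>x\<in>S. (f has_derivative f' x) (at x)"
    using Suc by auto
  then show ?thesis
    using continuous_at_imp_continuous_on has_derivative_continuous by blast
qed auto

text \<open>\<open>Ck_on\<close> differentiates in the ambient space, so the values on
  \<open>S\<close> determine the derivatives only because \<open>S\<close> is open.\<close>

lemma Ck_on_cong:
  assumes "open S" "Ck_on k S f" "\<And>x. x \<in> S \<Longrightarrow> f x = g x"
  shows "Ck_on k S g"
proof (cases k)
  case 0
  with assms show ?thesis by (auto cong: continuous_on_cong)
next
  case (Suc n)
  with assms obtain f' where f': "\<forall>x\<in>S. (f has_derivative f' x) (at x)" "\<forall>v. Ck_on n S (\<lambda>x. f' x v)"
    by auto
  have "(g has_derivative f' x) (at x)" if "x \<in> S" for x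
    using has_derivative_transform_within_open[of f "f' x" x UNIV S g] f' that assms by auto
  with f' Suc show ?thesis by auto
qed

lemma Ck_on_subset: "Ck_on k S f \<Longrightarrow> T \<subseteq> S \<Longrightarrow> Ck_on k T f"
proof (induction k arbitrary: f)
  case 0
  then show ?case by (auto intro: continuous_on_subset)
next
  case (Suc k)
  then obtain f' where f': "\<forall>x\<in>S. (f has_derivative f' x) (at x)" "\<forall>v. Ck_on k S (\<lambda>x. f' x v)"
    by auto
  with Suc.IH[OF _ Suc.prems(2)] Suc.prems(2) show ?case
    by (intro iffD2[OF Ck_on.simps(2)] exI[of _ f']) auto
qed

lemma Ck_on_Suc_imp: "Ck_on (Suc k) S f \<Longrightarrow> Ck_on k S f"
proof (induction k arbitrary: f)
  case 0
  then show ?case using Ck_on_continuous[OF 0] by simp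
next
  case (Suc k)
  then obtain f' where f': "\<forall>x\<in>S. (f has_derivative f' x) (at x)" "\<forall>v. Ck_on (Suc k) S (\<lambda>x. f' x v)"
    by (metis Ck_on.simps(2))
  have "\<forall>v. Ck_on k S (\<lambda>x. f' x v)" using Suc.IH f'(2) by blast
  then show ?case unfolding Ck_on.simps(2) using f'(1) by blast
qed

lemma Ck_on_const: "Ck_on k S (\<lambda>x. c)"
proof (induction k arbitrary: c)
  case (Suc k)
  then show ?case
    by (auto intro!: exI[of _ "\<lambda>x v. 0"] has_derivative_const)
qed auto

lemma Ck_on_linear:
  assumes "bounded_linear f"
  shows "Ck_on k S f"
proof (cases k)
  case 0
  then show ?thesis using assms by (simp add: linear_continuous_on)
next
  case (Suc n)
  then show ?thesis
    using bounded_linear.has_derivative[OF assms has_derivative_ident]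
    by (auto intro!: exI[of _ "\<lambda>x. f"] Ck_on_const)
qed

lemma Ck_on_linear_compose:
  assumes "bounded_linear h"
  shows "Ck_on k S f \<Longrightarrow> Ck_on k S (\<lambda>x. h (f x))"
proof (induction k arbitrary: f)
  case 0
  then show ?case
    by (auto intro: continuous_on_compose2[OF linear_continuous_on[OF assms]])
next
  case (Suc k)
  then obtain f' where f': "\<forall>x\<in>S. (f has_derivative f' x) (at x)" "\<forall>v. Ck_on k S (\<lambda>x. f' x v)"
    by auto
  then show ?case using Suc.IH
    by (auto intro!: exI[of _ "\<lambda>x v. h (f' x v)"] bounded_linear.has_derivative[OF assms])
qed

lemma Ck_on_compose_linear:
  assumes "bounded_linear h"
  shows "Ck_on k S f \<Longrightarrow> Ck_on k (h -` S) (\<lambda>x. f (h x))"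
proof (induction k arbitrary: f)
  case 0
  then show ?case
    by (auto intro!: continuous_on_compose2[of S f] linear_continuous_on[OF assms])
next
  case (Suc k)
  then obtain f' where f': "\<forall>x\<in>S. (f has_derivative f' x) (at x)" "\<forall>v. Ck_on k S (\<lambda>x. f' x v)"
    by auto
  have "((\<lambda>x. f (h x)) has_derivative (\<lambda>v. f' (h x) (h v))) (at x)" if "h x \<in> S" for x
    using has_derivative_compose[of h h x UNIV f "f' (h x)"] f' that
      bounded_linear.has_derivative[OF assms has_derivative_ident] by auto
  moreover have "Ck_on k (h -` S) (\<lambda>x. f' (h x) (h v))" for v
    using Suc.IH[of "\<lambda>y. f' y (h v)"] f' by auto
  ultimately show ?case
    by (auto intro!: exI[of _ "\<lambda>x v. f' (h x) (h v)"])
qed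

lemma Ck_on_add: "Ck_on k S f \<Longrightarrow> Ck_on k S g \<Longrightarrow> Ck_on k S (\<lambda>x. f x + g x)"
proof (induction k arbitrary: f g)
  case 0
  then show ?case by (auto intro: continuous_on_add)
next
  case (Suc k)
  then obtain f' g' where f': "\<forall>x\<in>S. (f has_derivative f' x) (at x)" "\<forall>v. Ck_on k S (\<lambda>x. f' x v)"
    and g': "\<forall>x\<in>S. (g has_derivative g' x) (at x)" "\<forall>v. Ck_on k S (\<lambda>x. g' x v)"
    by auto
  then show ?case using Suc.IH
    by (auto intro!: exI[of _ "\<lambda>x v. f' x v + g' x v"] has_derivative_add)
qed

lemma Ck_on_sum: "(\<And>i. i \<in> I \<Longrightarrow> Ck_on k S (f i)) \<Longrightarrow> Ck_on k S (\<lambda>x. \<Sum>i\<in>I. f i x)"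
proof (induction I rule: infinite_finite_induct)
  case (insert i I)
  then have "Ck_on k S (\<lambda>x. f i x + (\<Sum>i\<in>I. f i x))" by (intro Ck_on_add) auto
  with insert show ?case by simp
qed (simp_all add: Ck_on_const)

lemma Ck_on_scaleR:
  fixes f :: "'a::euclidean_space \<Rightarrow> real"
  shows "Ck_on k S f \<Longrightarrow> Ck_on k S g \<Longrightarrow> Ck_on k S (\<lambda>x. f x *\<^sub>R g x)"
proof (induction k arbitrary: f g)
  case 0
  then show ?case by (auto intro: continuous_on_scaleR)
next
  case (Suc k)
  then obtain f' g' where f': "\<forall>x\<in>S. (f has_derivative f' x) (at x)" "\<forall>v. Ck_on k S (\<lambda>x. f' x v)"
    and g': "\<forall>x\<in>S. (g has_derivative g' x) (at x)" "\<forall>v. Ck_on k S (\<lambda>x. g' x v)"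
    by auto
  have "Ck_on k S f" "Ck_on k S g" using Suc.prems Ck_on_Suc_imp[of k S f] Ck_on_Suc_imp[of k S g] by (simp_all del: Ck_on.simps)
  then have "Ck_on k S (\<lambda>x. f x *\<^sub>R g' x v + f' x v *\<^sub>R g x)" for v
    by (intro Ck_on_add Suc.IH f'(2)[rule_format] g'(2)[rule_format])
  then show ?case using f' g'
    by (auto intro!: exI[of _ "\<lambda>x v. f x *\<^sub>R g' x v + f' x v *\<^sub>R g x"] has_derivative_scaleR)
qed

lemma Ck_on_mult:
  fixes f g :: "'a::euclidean_space \<Rightarrow> real"
  shows "Ck_on k S f \<Longrightarrow> Ck_on k S g \<Longrightarrow> Ck_on k S (\<lambda>x. f x * g x)"
  using Ck_on_scaleR[of k S f g] by simp

lemma Ck_on_minus: "Ck_on k S f \<Longrightarrow> Ck_on k S (\<lambda>x. - f x)"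
  by (rule Ck_on_linear_compose[OF bounded_linear_minus[OF bounded_linear_ident]])

lemma Ck_on_diff: "Ck_on k S f \<Longrightarrow> Ck_on k S g \<Longrightarrow> Ck_on k S (\<lambda>x. f x - g x)"
  using Ck_on_add[OF _ Ck_on_minus, of k S f g] by simp

text \<open>The inner map is scalar, so the chain rule yields a product of two scalar functions, and
  the product rule closes the induction on the order.\<close>

lemma Ck_on_compose_real:
  fixes g :: "real \<Rightarrow> real" and f :: "'a::euclidean_space \<Rightarrow> real"
  shows "Ck_on k T g \<Longrightarrow> Ck_on k S f \<Longrightarrow> f ` S \<subseteq> T \<Longrightarrow> Ck_on k S (\<lambda>x. g (f x))"
proof (induction k arbitrary: f g)
  case 0
  then show ?case by (auto intro: continuous_on_compose2)
next
  case (Suc k)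
  then obtain f' g' where f': "\<forall>x\<in>S. (f has_derivative f' x) (at x)" "\<forall>v. Ck_on k S (\<lambda>x. f' x v)"
    and g': "\<forall>x\<in>T. (g has_derivative g' x) (at x)" "\<forall>v. Ck_on k T (\<lambda>x. g' x v)"
    by auto
  have "((\<lambda>x. g (f x)) has_derivative (\<lambda>v. g' (f x) 1 * f' x v)) (at x)" if "x \<in> S" for x
  proof -
    have fx: "f x \<in> T" using that Suc.prems by auto
    have "((\<lambda>x. g (f x)) has_derivative (\<lambda>v. g' (f x) (f' x v))) (at x)"
      by (rule has_derivative_compose[OF f'(1)[rule_format, OF that] g'(1)[rule_format, OF fx]])
    then show ?thesis
    proof (rule has_derivative_eq_rhs, intro ext)
      show "g' (f x) (f' x v) = g' (f x) 1 * f' x v" for v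
        using linear_scale[OF has_derivative_linear[OF g'(1)[rule_format, OF fx]], of "f' x v" 1]
        by (simp add: mult.commute)
    qed
  qed
  moreover have "Ck_on k S (\<lambda>x. g' (f x) 1 * f' x v)" for v
    by (rule Ck_on_mult[OF Suc.IH[OF g'(2)[rule_format] Ck_on_Suc_imp[OF Suc.prems(2)] Suc.prems(3)]
        f'(2)[rule_format]])
  ultimately show ?case
    by (auto intro!: exI[of _ "\<lambda>x v. g' (f x) 1 * f' x v"])
qed

text \<open>The derivative is a polynomial in \<open>inverse\<close> itself, which the induction
  hypothesis covers; for \<open>sqrt\<close> below it is a multiple of the reciprocal of
  \<open>sqrt\<close>.\<close>

lemma Ck_on_inverse: "Ck_on k (- {0}) (inverse :: real \<Rightarrow> real)"
proof (induction k)
  case 0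
  then show ?case by (auto intro!: continuous_intros)
next
  case (Suc k)
  have "Ck_on k (- {0}) (\<lambda>x::real. - (inverse x * v * inverse x))" for v
    by (intro Ck_on_minus Ck_on_mult Suc Ck_on_const)
  then show ?case
    by (auto intro!: exI[of _ "\<lambda>x v. - (inverse x * v * inverse x)"] has_derivative_inverse')
qed

lemma Ck_on_sqrt: "Ck_on k {0<..} sqrt"
proof (induction k)
  case 0
  then show ?case by (auto intro!: continuous_intros)
next
  case (Suc k)
  have "Ck_on k {0<..} (\<lambda>x::real. inverse (sqrt x) * (v / 2))" for v
    by (intro Ck_on_mult Ck_on_const Ck_on_compose_real[OF Ck_on_inverse Suc]) auto
  moreover have "(sqrt has_derivative (\<lambda>v. inverse (sqrt x) * (v / 2))) (at x)" if "x > 0" for x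
    using DERIV_real_sqrt[OF that] unfolding has_field_derivative_def
    by (rule has_derivative_eq_rhs) (auto simp: fun_eq_iff)
  ultimately show ?case
    by (auto intro!: exI[of _ "\<lambda>x v. inverse (sqrt x) * (v / 2)"])
qed

lemma Ck_on_inverse_compose:
  fixes f :: "'a::euclidean_space \<Rightarrow> real"
  shows "Ck_on k S f \<Longrightarrow> (\<And>x. x \<in> S \<Longrightarrow> f x \<noteq> 0) \<Longrightarrow> Ck_on k S (\<lambda>x. inverse (f x))"
  by (rule Ck_on_compose_real[OF Ck_on_inverse]) auto

lemma Ck_on_sqrt_compose:
  fixes f :: "'a::euclidean_space \<Rightarrow> real"
  shows "Ck_on k S f \<Longrightarrow> (\<And>x. x \<in> S \<Longrightarrow> f x > 0) \<Longrightarrow> Ck_on k S (\<lambda>x. sqrt (f x))"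
  by (rule Ck_on_compose_real[OF Ck_on_sqrt]) auto

lemma Ck_on_nth: "Ck_on k S (\<lambda>x::real^'n. x $ i)"
  by (rule Ck_on_linear) (rule bounded_linear_vec_nth)

lemma smooth_on_has_derivative:
  assumes "smooth_on S f" "x \<in> S"
  shows "(f has_derivative frechet_derivative f (at x)) (at x)"
proof -
  have "Ck_on (Suc 0) S f" using assms smooth_on_def by blast
  then have "f differentiable at x" using assms(2) unfolding differentiable_def by auto
  then show ?thesis by (simp add: frechet_derivative_works)
qed

text \<open>\<open>smooth_on\<close> may supply a different derivative at each order; uniqueness of
  the derivative makes all of them agree with \<open>frechet_derivative\<close>.\<close>

lemma smooth_on_frechet_derivative:
  assumes "open S" "smooth_on S f"
  shows "smooth_on S (\<lambda>x. frechet_derivative f (at x) v)"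
  unfolding smooth_on_def
proof
  fix k
  have "Ck_on (Suc k) S f" using assms smooth_on_def by blast
  then obtain f' where f': "\<forall>x\<in>S. (f has_derivative f' x) (at x)" "\<forall>v. Ck_on k S (\<lambda>x. f' x v)"
    by auto
  then have "f' x v = frechet_derivative f (at x) v" if "x \<in> S" for x
    using frechet_derivative_at[of f "f' x" x] that f'(1) by auto
  then show "Ck_on k S (\<lambda>x. frechet_derivative f (at x) v)"
    by (rule Ck_on_cong[OF assms(1) f'(2)[rule_format]])
qed

lemma smooth_on_deriv:
  assumes "open S" "smooth_on S (u :: real \<Rightarrow> real)"
  shows "smooth_on S (deriv u)" "\<And>x. x \<in> S \<Longrightarrow> (u has_real_derivative deriv u x) (at x)"
proof -
  have *: "(u has_real_derivative frechet_derivative u (at x) 1) (at x)" if "x \<in> S" for x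
  proof -
    have D: "(u has_derivative frechet_derivative u (at x)) (at x)"
      by (rule smooth_on_has_derivative[OF assms(2) that])
    show ?thesis
      unfolding has_field_derivative_def
    proof (rule has_derivative_eq_rhs[OF D], rule ext)
      show "frechet_derivative u (at x) y = frechet_derivative u (at x) 1 * y" for y
        using linear_scale[OF has_derivative_linear[OF D], of y 1] by (simp add: mult.commute)
    qed
  qed
  have d: "deriv u x = frechet_derivative u (at x) 1" if "x \<in> S" for x
    using * that DERIV_imp_deriv by blast
  show "smooth_on S (deriv u)"
    unfolding smooth_on_def
  proof
    fix k
    show "Ck_on k S (deriv u)"
    proof (rule Ck_on_cong[OF assms(1)])
      show "Ck_on k S (\<lambda>x. frechet_derivative u (at x) 1)"
        using smooth_on_frechet_derivative[OF assms, of 1] by (simp add: smooth_on_def)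
    qed (simp add: d)
  qed
  show "(u has_real_derivative deriv u x) (at x)" if "x \<in> S" for x
    using *[OF that] d[OF that] by simp
qed


section \<open>The Stenzel form in coordinates\<close>

lemma rsq_eq_inner: "rsq z = z \<bullet> z"
  by (simp add: rsq_def inner_vec_def inner_complex_def)

lemma rsq_eq_sum: "rsq z = (\<Sum>i\<in>UNIV. (Re (z $ i))\<^sup>2 + (Im (z $ i))\<^sup>2)"
  by (simp add: rsq_def power2_eq_square)

text \<open>Real and imaginary parts of the defining equation. The third identity is the one that
  later expresses r^2 through the chart coordinates.\<close>

lemma quadric_Re_Im:
  assumes "z \<in> quadric"
  shows "(\<Sum>i\<in>UNIV. (Re (z $ i))\<^sup>2) - (\<Sum>i\<in>UNIV. (Im (z $ i))\<^sup>2) = 1"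
    "(\<Sum>i\<in>UNIV. Re (z $ i) * Im (z $ i)) = 0"
    "rsq z = 1 + 2 * (\<Sum>i\<in>UNIV. (Im (z $ i))\<^sup>2)"
proof -
  have z: "(\<Sum>i\<in>UNIV. (z $ i)\<^sup>2) = 1" using assms by (simp add: quadric_def)
  show 1: "(\<Sum>i\<in>UNIV. (Re (z $ i))\<^sup>2) - (\<Sum>i\<in>UNIV. (Im (z $ i))\<^sup>2) = 1"
    using arg_cong[OF z, of Re] by (simp add: power2_eq_square sum_subtractf)
  show "(\<Sum>i\<in>UNIV. Re (z $ i) * Im (z $ i)) = 0"
  proof -
    have "2 * (\<Sum>i\<in>UNIV. Re (z $ i) * Im (z $ i)) = Im (\<Sum>i\<in>UNIV. (z $ i)\<^sup>2)"
      by (simp add: power2_eq_square sum_distrib_left mult_ac)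
    with z show ?thesis by simp
  qed
  show "rsq z = 1 + 2 * (\<Sum>i\<in>UNIV. (Im (z $ i))\<^sup>2)"
    using 1 by (simp add: rsq_eq_sum sum.distrib)
qed

lemma rsq_ge_1: "z \<in> quadric \<Longrightarrow> 1 \<le> rsq z"
  by (simp add: quadric_Re_Im(3) sum_nonneg)

definition smooth_from_1 :: "(real \<Rightarrow> real) \<Rightarrow> bool" where
  "smooth_from_1 u \<longleftrightarrow> (\<exists>S. open S \<and> {1..} \<subseteq> S \<and> smooth_on S u)"

text \<open>The complex Hessian of u(r^2), linear in \<open>v\<close> and conjugate linear in
  \<open>w\<close>. The metric is 2 Re and the Stenzel form is -2 Im of it, and all later
  computations go through it.\<close>

definition hermitian :: "(real \<Rightarrow> real) \<Rightarrow> complex^'m \<Rightarrow> complex^'m \<Rightarrow> complex^'m \<Rightarrow> complex" where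
  "hermitian u z v w = of_real (deriv u (rsq z)) * (\<Sum>i\<in>UNIV. v $ i * cnj (w $ i)) +
     of_real (deriv (deriv u) (rsq z)) *
       ((\<Sum>i\<in>UNIV. cnj (z $ i) * v $ i) * cnj (\<Sum>i\<in>UNIV. cnj (z $ i) * w $ i))"

lemma has_derivative_rsq_comp:
  assumes "(f has_real_derivative d) (at (rsq z))"
  shows "((\<lambda>z. complex_of_real (f (rsq z))) has_derivative (\<lambda>h. of_real (d * (2 * (z \<bullet> h))))) (at z)"
proof -
  have "(rsq has_derivative (\<lambda>h. 2 * (z \<bullet> h))) (at z)"
    unfolding rsq_eq_inner[abs_def]
    by (auto intro!: derivative_eq_intros simp: inner_commute)
  from has_derivative_compose[OF this assms[unfolded has_field_derivative_def]]
  show ?thesis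
    by (rule has_derivative_of_real)
qed

lemma d_zbar_rsq:
  assumes "(f has_real_derivative d) (at (rsq z))"
  shows "d_zbar k (\<lambda>z. of_real (f (rsq z))) z = of_real d * z $ k"
  unfolding d_zbar_def frechet_derivative_at[OF has_derivative_rsq_comp[OF assms], symmetric]
  by (simp add: inner_axis inner_complex_def complex_eq_iff)

lemma d_z_d_zbar_rsq:
  assumes S: "open S" "smooth_on S u" "rsq z \<in> S"
  shows "d_z j (d_zbar k (\<lambda>z. of_real (u (rsq z)))) z =
    of_real (deriv u (rsq z)) * (if j = k then 1 else 0) +
    of_real (deriv (deriv u) (rsq z)) * (cnj (z $ j) * z $ k)"
proof -
  let ?D = "\<lambda>h. of_real (deriv u (rsq z)) * h $ k + of_real (deriv (deriv u) (rsq z) * (2 * (z \<bullet> h))) * z $ k"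
  have "((\<lambda>z. of_real (deriv u (rsq z)) * z $ k) has_derivative ?D) (at z)"
    by (rule has_derivative_mult[OF has_derivative_rsq_comp[OF smooth_on_deriv(2)[OF S(1)
            smooth_on_deriv(1)[OF S(1,2)] S(3)]]
          bounded_linear.has_derivative[OF bounded_linear_vec_nth has_derivative_ident]])
  \<comment> \<open>The formula for \<open>d_zbar\<close> holds only where \<open>rsq\<close> lies
    in \<open>S\<close>; this is a neighbourhood of \<open>z\<close>, so the formula may be
    differentiated there.\<close>
  moreover have "open (rsq -` S)"
    by (intro open_vimage S) (auto simp: rsq_eq_inner[abs_def] intro!: continuous_intros)
  moreover have "d_zbar k (\<lambda>z. of_real (u (rsq z))) x = of_real (deriv u (rsq x)) * x $ k"
    if "rsq x \<in> S" for x
    by (rule d_zbar_rsq[OF smooth_on_deriv(2)[OF S(1,2) that]])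
  ultimately have "(d_zbar k (\<lambda>z. of_real (u (rsq z))) has_derivative ?D) (at z)"
    using S(3) by (elim has_derivative_transform_within_open) auto
  then have "frechet_derivative (d_zbar k (\<lambda>z. of_real (u (rsq z)))) (at z) = ?D"
    by (rule frechet_derivative_at[symmetric])
  moreover have "axis j c $ k = (if j = k then c else 0)" for c :: complex
    by (simp add: axis_def)
  ultimately show ?thesis
    unfolding d_z_def by (simp add: inner_axis inner_complex_def complex_eq_iff field_simps)
qed

lemma stenzel_form_eq:
  assumes "smooth_from_1 u" "1 \<le> rsq z"
  shows "stenzel_form u z v w = \<i> * (hermitian u z v w - hermitian u z w v)"
proof -
  obtain S where S: "open S" "{1..} \<subseteq> S" "smooth_on S u"
    using assms(1) unfolding smooth_from_1_def by blast
  then have z: "rsq z \<in> S" using assms(2) by auto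
  let ?a = "of_real (deriv u (rsq z)) :: complex" and ?b = "of_real (deriv (deriv u) (rsq z)) :: complex"
  have *: "(\<Sum>j\<in>UNIV. \<Sum>k\<in>UNIV. (?a * (if j = k then 1 else 0) + ?b * (cnj (z $ j) * z $ k)) * (v $ j * cnj (w $ k)))
      = hermitian u z v w" for v w :: "complex^'a"
  proof -
    have "(\<Sum>j\<in>UNIV. \<Sum>k\<in>UNIV. (?a * (if j = k then 1 else 0) + ?b * (cnj (z $ j) * z $ k)) * (v $ j * cnj (w $ k)))
      = (\<Sum>j\<in>UNIV. \<Sum>k\<in>UNIV. if j = k then ?a * (v $ j * cnj (w $ k)) else 0) +
        ?b * (\<Sum>j\<in>UNIV. \<Sum>k\<in>UNIV. (cnj (z $ j) * v $ j) * (z $ k * cnj (w $ k)))"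
      unfolding sum_distrib_left sum.distrib[symmetric] by (intro sum.cong refl) (auto simp: algebra_simps)
    also have "\<dots> = hermitian u z v w"
      unfolding sum_product[symmetric] by (simp add: hermitian_def sum_distrib_left)
    finally show ?thesis .
  qed
  show ?thesis
    unfolding stenzel_form_def i_ddbar_def d_z_d_zbar_rsq[OF S(1,3) z]
    by (simp only: right_diff_distrib sum_subtractf *)
qed

lemma hermitian_cnj: "cnj (hermitian u z v w) = hermitian u z w v"
  by (simp add: hermitian_def mult_ac)

lemma stenzel_form_Im:
  assumes "smooth_from_1 u" "1 \<le> rsq z"
  shows "stenzel_form u z v w = of_real (- 2 * Im (hermitian u z v w))"
  unfolding stenzel_form_eq[OF assms] hermitian_cnj[of u z v w, symmetric]
  by (simp add: complex_eq_iff)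

lemma hermitian_add_left: "hermitian u z (v + v') w = hermitian u z v w + hermitian u z v' w"
  by (simp add: hermitian_def algebra_simps sum.distrib)

lemma hermitian_scale_left: "hermitian u z (c *s v) w = c * hermitian u z v w"
proof -
  have "(\<Sum>i\<in>UNIV. (c *s v) $ i * cnj (w $ i)) = c * (\<Sum>i\<in>UNIV. v $ i * cnj (w $ i))"
    "(\<Sum>i\<in>UNIV. cnj (z $ i) * (c *s v) $ i) = c * (\<Sum>i\<in>UNIV. cnj (z $ i) * v $ i)"
    by (simp_all add: sum_distrib_left mult_ac)
  then show ?thesis unfolding hermitian_def by (simp add: algebra_simps)
qed

lemma hermitian_scale_right: "hermitian u z v (c *s w) = cnj c * hermitian u z v w"
  by (metis hermitian_cnj hermitian_scale_left complex_cnj_mult)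

lemma hermitian_sum_left: "hermitian u z (\<Sum>i\<in>I. v i) w = (\<Sum>i\<in>I. hermitian u z (v i) w)"
proof (induction I rule: infinite_finite_induct)
  case (insert i I)
  then show ?case by (simp add: hermitian_add_left)
qed (simp_all add: hermitian_def)

lemma hermitian_sum_right: "hermitian u z v (\<Sum>i\<in>I. w i) = (\<Sum>i\<in>I. hermitian u z v (w i))"
  unfolding hermitian_cnj[of u z _ v, symmetric] hermitian_sum_left by simp

lemma stenzel_metric_eq:
  assumes "smooth_from_1 u" "1 \<le> rsq z"
  shows "stenzel_metric u z v w = 2 * Re (hermitian u z v w)"
  unfolding stenzel_metric_def stenzel_form_Im[OF assms] hermitian_scale_right by simp


section \<open>The Stenzel potential\<close>

lemma smooth_from_1_deriv:
  assumes "smooth_from_1 u"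
  shows "smooth_from_1 (deriv u)" "\<And>r. 1 \<le> r \<Longrightarrow> (u has_real_derivative deriv u r) (at r)"
  using assms unfolding smooth_from_1_def
  by (meson smooth_on_deriv atLeast_iff subset_iff)+

lemma smooth_from_1_continuous: "smooth_from_1 u \<Longrightarrow> continuous_on {1..} u"
  by (meson DERIV_isCont atLeast_iff continuous_at_imp_continuous_on smooth_from_1_deriv(2))

lemma stenzel_potential_smooth: "stenzel_potential TYPE('m::finite) \<kappa> u \<Longrightarrow> smooth_from_1 u"
  unfolding stenzel_potential_def smooth_from_1_def Let_def by blast

lemma stenzel_metric_pos:
  assumes "stenzel_potential TYPE('m::finite) \<kappa> u" "z \<in> quadric" "v \<in> quadric_tangent z" "v \<noteq> 0"
  shows "stenzel_metric u z v (v :: complex^'m) > 0"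
  using assms unfolding stenzel_potential_def Let_def by blast

text \<open>With r = cosh t, the point \<open>z\<close> has the entries cosh(t/2) and i sinh(t/2),
  hence lies in the quadric over the value r. The third axis is tangent and Hermitian orthogonal to
  \<open>z\<close>, so the u'' term of the metric vanishes on it and positivity of the metric is
  positivity of u'.\<close>

lemma stenzel_potential_deriv_pos:
  assumes pot: "stenzel_potential TYPE(7) \<kappa> u" and r: "1 \<le> r"
  shows "deriv u r > 0"
proof -
  define z :: "complex^7" where
    "z = vector [of_real (sqrt ((r + 1) / 2)), \<i> * of_real (sqrt ((r - 1) / 2)), 0, 0, 0, 0, 0]"
  have z: "z \<in> quadric"
    using r by (simp add: quadric_def sum_7 z_def power_mult_distrib of_real_power[symmetric]
        del: of_real_power) (simp add: field_simps)
  have rz: "rsq z = r"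
    using r by (simp add: rsq_eq_sum sum_7 z_def) (simp add: field_simps)
  have "stenzel_metric u z (axis 3 1) (axis 3 1) > 0"
    by (rule stenzel_metric_pos[OF pot z]) (auto simp: quadric_tangent_def sum_7 z_def axis_def vec_eq_iff)
  then show ?thesis
    using stenzel_potential_smooth[OF pot] rz r
    by (simp add: stenzel_metric_eq hermitian_def sum_7 z_def axis_def)
qed

text \<open>Since U'(t) = u'(cosh t) sinh t, both sides of the differential equation carry the
  factor sinh^5 t. It is cancelled for t > 0, and continuity gives r = 1.\<close>

lemma stenzel_potential_ode:
  assumes pot: "stenzel_potential TYPE(7) \<kappa> u" and r: "1 \<le> r"
  shows "deriv u r ^ 5 * (deriv (deriv u) r * (r\<^sup>2 - 1) + r * deriv u r) = \<kappa>"
proof -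
  note sm = stenzel_potential_smooth[OF pot]
  note d1 = smooth_from_1_deriv(2)[OF sm]
  note d2 = smooth_from_1_deriv(2)[OF smooth_from_1_deriv(1)[OF sm]]
  have dU: "deriv (\<lambda>t. u (cosh t)) = (\<lambda>s. deriv u (cosh s) * sinh s)"
  proof
    fix s :: real
    have "((\<lambda>t. u (cosh t)) has_real_derivative deriv u (cosh s) * sinh s) (at s)"
      by (rule DERIV_chain2[OF d1]) (auto intro!: derivative_eq_intros cosh_real_ge_1)
    then show "deriv (\<lambda>t. u (cosh t)) s = deriv u (cosh s) * sinh s"
      by (rule DERIV_imp_deriv)
  qed
  have eq: "deriv u r ^ 5 * (deriv (deriv u) r * (r\<^sup>2 - 1) + r * deriv u r) = \<kappa>" if "r > 1" for r
  proof -
    define s where "s = arcosh r"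
    have rs: "r = cosh s" and s: "s > 0"
      using that by (auto simp: s_def cosh_arcosh_real)
    have "((\<lambda>s. (deriv u (cosh s) * sinh s) ^ 6) has_real_derivative \<kappa> * 6 * sinh s ^ 5) (at s)"
      using pot unfolding stenzel_potential_def Let_def dU by simp
    moreover have "((\<lambda>s. (deriv u (cosh s) * sinh s) ^ 6) has_real_derivative
        6 * (deriv u (cosh s) * sinh s) ^ 5 *
        (deriv (deriv u) (cosh s) * sinh s * sinh s + cosh s * deriv u (cosh s))) (at s)"
      by (rule derivative_eq_intros refl DERIV_chain2[OF d2] cosh_real_ge_1)+ simp
    ultimately have "\<kappa> * 6 * sinh s ^ 5 = 6 * (deriv u (cosh s) * sinh s) ^ 5 *
        (deriv (deriv u) (cosh s) * sinh s * sinh s + cosh s * deriv u (cosh s))"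
      by (rule DERIV_unique)
    then have "sinh s ^ 5 * (deriv u r ^ 5 * (deriv (deriv u) r * (sinh s)\<^sup>2 + r * deriv u r)) = sinh s ^ 5 * \<kappa>"
      by (simp add: rs power_mult_distrib power2_eq_square algebra_simps)
    then show ?thesis
      using s unfolding mult_cancel_left by (simp add: rs cosh_square_eq)
  qed
  have c: "continuous_on (closure {1<..}) (\<lambda>r. deriv u r ^ 5 * (deriv (deriv u) r * (r\<^sup>2 - 1) + r * deriv u r))"
    using smooth_from_1_continuous[OF smooth_from_1_deriv(1)[OF sm]]
      smooth_from_1_continuous[OF smooth_from_1_deriv(1)[OF smooth_from_1_deriv(1)[OF sm]]]
    by (auto intro!: continuous_intros)
  show ?thesis
    by (rule continuous_constant_on_closure[OF c]) (use eq r in auto)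
qed


section \<open>Alternating forms\<close>

text \<open>Leibniz' formula over natural number indices, which is how the forms index their
  arguments.\<close>

definition ndet :: "nat \<Rightarrow> (nat \<Rightarrow> nat \<Rightarrow> complex) \<Rightarrow> complex" where
  "ndet n M = (\<Sum>p | p permutes {..<n}. of_int (sign p) * (\<Prod>i<n. M i (p i)))"

lemma complex_alternating_local:
  assumes "complex_alternating k \<alpha>" "\<And>i. i < k \<Longrightarrow> v i = w i"
  shows "\<alpha> v = \<alpha> w"
  using assms(1)[unfolded complex_alternating_def, THEN conjunct1, rule_format, of v w] assms(2) .

lemma complex_alternating_linear:
  assumes "complex_alternating k \<alpha>" "i < k"
  shows "\<alpha> (v(i := a *s x + b *s y)) = a * \<alpha> (v(i := x)) + b * \<alpha> (v(i := y))"
  using assms(1)[unfolded complex_alternating_def, THEN conjunct2, THEN conjunct1, rule_format, OF assms(2)] .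

lemma complex_alternating_eq_0:
  assumes "complex_alternating k \<alpha>" "i < k" "j < k" "i \<noteq> j" "v i = v j"
  shows "\<alpha> v = 0"
  using assms(1)[unfolded complex_alternating_def, THEN conjunct2, THEN conjunct2, rule_format, OF assms(2,3)]
    assms(4,5) by blast

lemma complex_alternating_add:
  "complex_alternating k \<alpha> \<Longrightarrow> i < k \<Longrightarrow> \<alpha> (v(i := x + y)) = \<alpha> (v(i := x)) + \<alpha> (v(i := y))"
  using complex_alternating_linear[of k \<alpha> i v 1 x 1 y] by simp

lemma complex_alternating_scale:
  "complex_alternating k \<alpha> \<Longrightarrow> i < k \<Longrightarrow> \<alpha> (v(i := a *s x)) = a * \<alpha> (v(i := x))"
  using complex_alternating_linear[of k \<alpha> i v a x 0 x] by simp

lemma complex_alternating_sum: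
  assumes "complex_alternating k \<alpha>" "i < k"
  shows "\<alpha> (v(i := (\<Sum>j\<in>J. c j *s x j))) = (\<Sum>j\<in>J. c j * \<alpha> (v(i := x j)))"
proof (induction J rule: infinite_finite_induct)
  case (insert j J)
  then show ?case
    by (simp add: complex_alternating_add[OF assms] complex_alternating_scale[OF assms] del: fun_upd_apply)
qed (use complex_alternating_scale[OF assms, of v 0 0] in \<open>simp_all del: fun_upd_apply\<close>)

lemma complex_alternating_transpose:
  assumes \<alpha>: "complex_alternating k \<alpha>" and ab: "a < k" "b < k" "a \<noteq> b"
  shows "\<alpha> (v \<circ> Transposition.transpose a b) = - \<alpha> v"
proof -
  let ?w = "\<lambda>x y. v(a := x, b := y)"
  have add_b: "\<alpha> (?w x (y + y')) = \<alpha> (?w x y) + \<alpha> (?w x y')" for x y y'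
    by (rule complex_alternating_add[OF \<alpha> ab(2)])
  have add_a: "\<alpha> (?w (x + x') y) = \<alpha> (?w x y) + \<alpha> (?w x' y)" for x x' y
    using complex_alternating_add[OF \<alpha> ab(1), of "v(b := y)" x x'] ab(3)
    by (simp add: fun_upd_twist)
  have eq_0: "\<alpha> (?w x x) = 0" for x
    by (rule complex_alternating_eq_0[OF \<alpha> ab]) (use ab in auto)
  have "0 = \<alpha> (?w (v a + v b) (v a + v b))" by (rule eq_0[symmetric])
  also have "\<dots> = \<alpha> (?w (v a) (v b)) + \<alpha> (?w (v b) (v a))"
    unfolding add_a add_b unfolding eq_0 by (simp only: add_0_left add_0_right add.commute)
  also have "?w (v a) (v b) = v" by simp
  also have "?w (v b) (v a) = v \<circ> Transposition.transpose a b"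
    using ab by (auto simp: fun_eq_iff Transposition.transpose_def)
  finally have "\<alpha> v + \<alpha> (v \<circ> Transposition.transpose a b) = 0" by (simp only:)
  then show ?thesis by (simp only: eq_neg_iff_add_eq_0 add.commute)
qed

lemma complex_alternating_permute:
  assumes \<alpha>: "complex_alternating k \<alpha>" and p: "p permutes {..<k}"
  shows "\<alpha> (\<lambda>i. v (p i)) = of_int (sign p) * \<alpha> v"
proof -
  have "\<forall>v. \<alpha> (v \<circ> p) = of_int (sign p) * \<alpha> v"
    using p finite_lessThan[of k]
  proof (induction rule: permutes_induct)
    case id
    then show ?case by simp
  next
    case (swap a b p)
    have "\<alpha> (v \<circ> (Transposition.transpose a b \<circ> p)) = of_int (sign p) * \<alpha> (v \<circ> Transposition.transpose a b)" for v
      using swap.IH by (metis comp_assoc)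
    moreover have "sign (Transposition.transpose a b \<circ> p) = - sign p"
      using swap sign_compose[OF permutation_swap_id permutes_imp_permutation[OF _ swap.hyps(4)]]
      by (simp add: sign_swap_id)
    ultimately show ?case
      using swap complex_alternating_transpose[OF \<alpha>, of a b] by (simp del: comp_apply add: comp_assoc)
  qed
  then show ?thesis by (simp add: comp_def)
qed

text \<open>The slots from \<open>m\<close> on hold arbitrary vectors, because the induction step
  moves a vector \<open>f j\<close> into slot \<open>m\<close> before it applies the
  hypothesis.\<close>

lemma complex_alternating_expand:
  fixes n :: nat
  assumes \<alpha>: "complex_alternating k \<alpha>" and "m \<le> k"
  shows "\<alpha> (\<lambda>i. if i < m then \<Sum>j<n. B i j *s f j else v i) =
    (\<Sum>g\<in>{..<m} \<rightarrow>\<^sub>E {..<n}. (\<Prod>i<m. B i (g i)) * \<alpha> (\<lambda>i. if i < m then f (g i) else v i))"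
  using \<open>m \<le> k\<close>
proof (induction m arbitrary: v)
  case 0
  then show ?case by simp
next
  case (Suc m)
  let ?S = "\<lambda>i. \<Sum>j<n. B i j *s f j"
  let ?u = "\<lambda>j i. if i < m then ?S i else (v(m := f j)) i"
  have m: "m < k" using Suc.prems by simp
  have "\<alpha> (\<lambda>i. if i < Suc m then ?S i else v i) = \<alpha> ((\<lambda>i. if i < m then ?S i else v i)(m := ?S m))"
    by (rule arg_cong[of _ _ \<alpha>]) (auto simp: less_Suc_eq fun_eq_iff)
  also have "\<dots> = (\<Sum>j<n. B m j * \<alpha> ((\<lambda>i. if i < m then ?S i else v i)(m := f j)))"
    by (rule complex_alternating_sum[OF \<alpha> m])
  also have "\<dots> = (\<Sum>j<n. B m j * \<alpha> (?u j))"
    by (intro sum.cong refl arg_cong2[of _ _ _ _ "(*)"] arg_cong[of _ _ \<alpha>]) (auto simp: fun_eq_iff)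
  also have "\<dots> = (\<Sum>j<n. \<Sum>g\<in>{..<m} \<rightarrow>\<^sub>E {..<n}. B m j * ((\<Prod>i<m. B i (g i)) *
      \<alpha> (\<lambda>i. if i < m then f (g i) else (v(m := f j)) i)))"
    using Suc by (simp add: sum_distrib_left)
  also have "\<dots> = (\<Sum>(j, g)\<in>{..<n} \<times> ({..<m} \<rightarrow>\<^sub>E {..<n}). (\<Prod>i<Suc m. B i ((g(m := j)) i)) *
      \<alpha> (\<lambda>i. if i < Suc m then f ((g(m := j)) i) else v i))"
    unfolding sum.cartesian_product
  proof (intro sum.cong refl, clarify)
    fix j and g :: "nat \<Rightarrow> nat"
    have "(\<lambda>i. if i < m then f (g i) else (v(m := f j)) i) =
        (\<lambda>i. if i < Suc m then f ((g(m := j)) i) else v i)"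
      by (auto simp: fun_eq_iff less_Suc_eq)
    then show "B m j * ((\<Prod>i<m. B i (g i)) * \<alpha> (\<lambda>i. if i < m then f (g i) else (v(m := f j)) i)) =
        (\<Prod>i<Suc m. B i ((g(m := j)) i)) * \<alpha> (\<lambda>i. if i < Suc m then f ((g(m := j)) i) else v i)"
      by (simp add: mult_ac)
  qed
  also have "\<dots> = (\<Sum>g\<in>(\<lambda>(j, g). g(m := j)) ` ({..<n} \<times> ({..<m} \<rightarrow>\<^sub>E {..<n})).
      (\<Prod>i<Suc m. B i (g i)) * \<alpha> (\<lambda>i. if i < Suc m then f (g i) else v i))"
    by (subst sum.reindex) (auto intro: inj_combinator simp: case_prod_unfold o_def simp del: prod.lessThan_Suc
        intro!: inj_combinator[of m "{..<m}" "\<lambda>_. {..<n}", unfolded case_prod_unfold])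
  also have "(\<lambda>(j, g). g(m := j)) ` ({..<n} \<times> ({..<m} \<rightarrow>\<^sub>E {..<n})) = {..<Suc m} \<rightarrow>\<^sub>E {..<n}"
    using PiE_insert_eq[of m "{..<m}" "\<lambda>_. {..<n}"] by (simp add: lessThan_Suc)
  finally show ?case .
qed

lemma complex_alternating_ndet:
  assumes \<alpha>: "complex_alternating k \<alpha>" and v: "\<And>i. i < k \<Longrightarrow> v i = (\<Sum>j<k. B i j *s f j)"
  shows "\<alpha> v = ndet k B * \<alpha> f"
proof -
  let ?E = "{..<k} \<rightarrow>\<^sub>E {..<k}"
  let ?F = "\<lambda>g. (\<Prod>i<k. B i (g i)) * \<alpha> (\<lambda>i. f (g i))"
  have "\<alpha> v = \<alpha> (\<lambda>i. if i < k then \<Sum>j<k. B i j *s f j else v i)"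
    by (rule complex_alternating_local[OF \<alpha>]) (simp add: v)
  also have "\<dots> = (\<Sum>g\<in>?E. (\<Prod>i<k. B i (g i)) * \<alpha> (\<lambda>i. if i < k then f (g i) else v i))"
    by (rule complex_alternating_expand[OF \<alpha> order_refl])
  also have "\<dots> = (\<Sum>g\<in>?E. ?F g)"
    by (intro sum.cong refl arg_cong2[of _ _ _ _ "(*)"] complex_alternating_local[OF \<alpha>]) auto
  \<comment> \<open>An index map that takes a value twice puts equal vectors into two slots, so its
    term is zero.\<close>
  also have "\<dots> = (\<Sum>g\<in>{g\<in>?E. inj_on g {..<k}}. ?F g)"
  proof (rule sum.mono_neutral_right)
    show "\<forall>g\<in>?E - {g \<in> ?E. inj_on g {..<k}}. ?F g = 0"
      using complex_alternating_eq_0[OF \<alpha>] unfolding inj_on_def by fastforce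
  qed (auto intro: finite_PiE)
  also have "\<dots> = (\<Sum>p | p permutes {..<k}. ?F p)"
  \<comment> \<open>Injective self-maps of the index range are the permutations. The witnesses only
    adjust the values outside the range: \<open>undefined\<close> for \<open>PiE\<close>, the
    identity for \<open>permutes\<close>.\<close>
  proof (rule sum.reindex_bij_witness[of _ "\<lambda>p. restrict p {..<k}" "\<lambda>g i. if i < k then g i else i"])
    fix g assume g: "g \<in> {g\<in>?E. inj_on g {..<k}}"
    then have "g ` {..<k} = {..<k}"
      by (intro endo_inj_surj) auto
    then have "bij_betw g {..<k} {..<k}" using g by (auto simp: bij_betw_def)
    then have "bij_betw (\<lambda>i. if i < k then g i else i) {..<k} {..<k}"
      by (rule bij_betw_cong[THEN iffD1, rotated]) auto
    then have "(\<lambda>i. if i < k then g i else i) permutes {..<k}"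
      by (rule bij_imp_permutes) simp
    then show "(\<lambda>i. if i < k then g i else i) \<in> {p. p permutes {..<k}}" by simp
    show "(\<lambda>i\<in>{..<k}. if i < k then g i else i) = g"
      using g by (auto simp: fun_eq_iff PiE_def extensional_def)
    show "?F (\<lambda>i. if i < k then g i else i) = ?F g"
      by (intro arg_cong2[of _ _ _ _ "(*)"] prod.cong complex_alternating_local[OF \<alpha>]) auto
  next
    fix p assume p: "p \<in> {p. p permutes {..<k}}"
    then show "restrict p {..<k} \<in> {g\<in>?E. inj_on g {..<k}}"
      using permutes_in_image[of p "{..<k}"] permutes_inj[of p "{..<k}"]
      by (auto simp: inj_on_def PiE_def Pi_def inj_def)
    show "(\<lambda>i. if i < k then restrict p {..<k} i else i) = p"
      using p permutes_not_in[of p "{..<k}"] by (auto simp: fun_eq_iff)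
  qed
  also have "\<dots> = ndet k B * \<alpha> f"
    unfolding ndet_def sum_distrib_right
    by (intro sum.cong refl) (simp add: complex_alternating_permute[OF \<alpha>] mult_ac)
  finally show ?thesis .
qed

lemma sum_permutes_reindex:
  assumes f: "bij_betw f A B"
  shows "(\<Sum>p | p permutes B. g p) = (\<Sum>p | p permutes A. g (map_permutation A f p))"
proof (rule sum.reindex_bij_witness[of _ "map_permutation A f" "map_permutation B (inv_into A f)"])
  have f': "bij_betw (inv_into A f) B A" by (rule bij_betw_inv_into[OF f])
  have inj: "inj_on f A" and im: "f ` A = B" using f by (auto simp: bij_betw_def)
  have 1: "map_permutation A f (map_permutation B (inv_into A f) p) = p" if "p permutes B" for p
    by (rule map_permutation_compose_inv[OF f' that]) (use im in \<open>auto simp: f_inv_into_f\<close>)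
  then show "map_permutation A f (map_permutation B (inv_into A f) p) = p" if "p \<in> {p. p permutes B}" for p
    using that by simp
  show "map_permutation B (inv_into A f) p \<in> {p. p permutes A}" if "p \<in> {p. p permutes B}" for p
    using map_permutation_permutes[OF f'] that by auto
  show "g (map_permutation A f (map_permutation B (inv_into A f) p)) = g p" if "p \<in> {p. p permutes B}" for p
    using 1 that by simp
  show "map_permutation A f p \<in> {p. p permutes B}" if "p \<in> {p. p permutes A}" for p
    using map_permutation_permutes[OF f] that by auto
  show "map_permutation B (inv_into A f) (map_permutation A f p) = p" if "p \<in> {p. p permutes A}" for p
    by (rule map_permutation_compose_inv[OF f]) (use that inj in auto)
qed

lemma ndet_eq_det:
  assumes ix: "bij_betw ix (UNIV :: 'n::finite set) {..<k}"
  shows "ndet k M = det (\<chi> r s :: 'n. M (ix r) (ix s))"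
proof -
  have inj: "inj_on ix (UNIV :: 'n set)" using ix by (auto simp: bij_betw_def)
  have "ndet k M = (\<Sum>p | p permutes (UNIV::'n set). of_int (sign (map_permutation UNIV ix p)) *
      (\<Prod>i<k. M i (map_permutation UNIV ix p i)))"
    unfolding ndet_def by (rule sum_permutes_reindex[OF ix])
  also have "\<dots> = det (\<chi> r s :: 'n. M (ix r) (ix s))"
    unfolding det_def
  proof (intro sum.cong refl)
    fix p :: "'n \<Rightarrow> 'n" assume p: "p \<in> {p. p permutes UNIV}"
    have "(\<Prod>i<k. M i (map_permutation UNIV ix p i)) = (\<Prod>r\<in>UNIV. M (ix r) (map_permutation UNIV ix p (ix r)))"
      by (rule prod.reindex_bij_betw[OF ix, symmetric])
    then show "of_int (sign (map_permutation UNIV ix p)) * (\<Prod>i<k. M i (map_permutation UNIV ix p i)) =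
        of_int (sign p) * (\<Prod>i\<in>UNIV. (\<chi> r s. M (ix r) (ix s)) $ i $ p i)"
      using p inj by (simp add: sign_map_permutation map_permutation_apply)
  qed
  finally show ?thesis .
qed

lemma complex_alternating_det:
  assumes ix: "bij_betw ix (UNIV :: 'n::finite set) {..<k}"
  shows "complex_alternating k (\<lambda>v. det ((\<chi> r. v (ix r)) :: complex^'n^'n))"
  unfolding complex_alternating_def
proof (intro conjI allI impI)
  fix v w :: "nat \<Rightarrow> complex^'n" assume "\<forall>i<k. v i = w i"
  moreover have "ix r < k" for r using ix by (auto simp: bij_betw_def)
  ultimately show "det ((\<chi> r. v (ix r)) :: complex^'n^'n) = det ((\<chi> r. w (ix r)) :: complex^'n^'n)" by simp
next
  fix v :: "nat \<Rightarrow> complex^'n" and i a b x y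
  assume "i < k"
  then obtain r0 where r0: "ix r0 = i"
    using ix unfolding bij_betw_def by (metis imageE lessThan_iff)
  have *: "ix r = i \<longleftrightarrow> r = r0" for r
    using r0 ix by (auto simp: bij_betw_def inj_on_def)
  show "det ((\<chi> r. (v(i := a *s x + b *s y)) (ix r)) :: complex^'n^'n) =
      a * det ((\<chi> r. (v(i := x)) (ix r)) :: complex^'n^'n) + b * det ((\<chi> r. (v(i := y)) (ix r)) :: complex^'n^'n)"
    by (simp add: * fun_upd_def det_row_add[of r0] det_row_mul[of r0])
next
  fix v :: "nat \<Rightarrow> complex^'n" and i j
  assume *: "i < k" "j < k" "i \<noteq> j \<and> v i = v j"
  then obtain r s where "ix r = i" "ix s = j"
    using ix unfolding bij_betw_def by (metis imageE lessThan_iff)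
  then show "det ((\<chi> r. v (ix r)) :: complex^'n^'n) = 0"
    using * by (intro det_identical_rows[of r s]) (auto simp: row_def vec_eq_iff)
qed

text \<open>This interior product, with \<open>z\<close> in slot 0 and the other arguments shifted,
  turns the complex volume form into \<Omega>_0.\<close>

lemma complex_alternating_contract:
  assumes "complex_alternating (Suc k) \<alpha>"
  shows "complex_alternating k (\<lambda>v. \<alpha> (case_nat z v))"
  unfolding complex_alternating_def
proof (intro conjI allI impI)
  fix v w :: "nat \<Rightarrow> complex^'a" assume "\<forall>i<k. v i = w i"
  then show "\<alpha> (case_nat z v) = \<alpha> (case_nat z w)"
    by (intro complex_alternating_local[OF assms]) (auto split: nat.split)
next
  fix v :: "nat \<Rightarrow> complex^'a" and i a b x y
  assume i: "i < k"
  have "case_nat z (v(i := x)) = (case_nat z v)(Suc i := x)" for x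
    by (auto simp: fun_eq_iff split: nat.split)
  then show "\<alpha> (case_nat z (v(i := a *s x + b *s y))) =
      a * \<alpha> (case_nat z (v(i := x))) + b * \<alpha> (case_nat z (v(i := y)))"
    using complex_alternating_linear[OF assms] i by simp
next
  fix v :: "nat \<Rightarrow> complex^'a" and i j
  assume "i < k" "j < k" "i \<noteq> j \<and> v i = v j"
  then show "\<alpha> (case_nat z v) = 0"
    by (intro complex_alternating_eq_0[OF assms, of "Suc i" "Suc j"]) auto
qed


section \<open>Wedge products\<close>

lemma permutes_shift:
  fixes k n :: nat
  assumes "p permutes {..<n}"
  obtains q where "q permutes {k..<k + n}" "sign q = sign p" "\<And>i. i < n \<Longrightarrow> q (k + i) = k + p i"
proof
  have f: "bij_betw ((+) k) {..<n} {k..<k + n}"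
    by (simp add: bij_betw_def lessThan_atLeast0 add.commute)
  let ?q = "map_permutation {..<n} ((+) k) p"
  show "?q permutes {k..<k + n}" by (rule map_permutation_permutes[OF f assms])
  show "sign ?q = sign p" by (rule sign_map_permutation) (use assms in auto)
  show "?q (k + i) = k + p i" if "i < n" for i
    using map_permutation_apply[of "(+) k" "{..<n}" i p] that by simp
qed

lemma permutes_unshift:
  fixes k n :: nat
  assumes "q permutes {k..<k + n}"
  obtains p where "p permutes {..<n}" "sign q = sign p" "\<And>i. i < n \<Longrightarrow> q (k + i) = k + p i"
proof
  have f: "bij_betw (\<lambda>i. i - k) {k..<k + n} {..<n}"
    by (rule bij_betw_byWitness[of _ "\<lambda>i. k + i"]) auto
  let ?p = "map_permutation {k..<k + n} (\<lambda>i. i - k) q"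
  show "?p permutes {..<n}" by (rule map_permutation_permutes[OF f assms])
  show "sign q = sign ?p"
    by (rule sign_map_permutation[symmetric]) (use assms f in \<open>auto simp: bij_betw_def\<close>)
  show "q (k + i) = k + ?p i" if "i < n" for i
  proof -
    have "q (k + i) \<in> {k..<k + n}" using that permutes_in_image[OF assms, of "k + i"] by simp
    then show ?thesis
      using map_permutation_apply[of "\<lambda>i. i - k" "{k..<k + n}" "k + i" q] that f
      by (auto simp: bij_betw_def)
  qed
qed

text \<open>The antisymmetry is built into the sum over all permutations: replacing \<sigma> by
  \<pi> \<circ> \<sigma> costs exactly the sign of \<pi>.\<close>

lemma wedge_permute:
  assumes \<pi>: "\<pi> permutes {..<k + l}"
  shows "wedge k l \<alpha> \<beta> (\<lambda>i. v (\<pi> i)) = of_int (sign \<pi>) * wedge k l \<alpha> \<beta> v"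
proof -
  have s: "of_int (sign \<sigma>) = of_int (sign \<pi>) * (of_int (sign (\<pi> \<circ> \<sigma>)) :: complex)" if "\<sigma> permutes {..<k + l}" for \<sigma>
    using sign_compose[OF permutes_imp_permutation[OF _ \<pi>] permutes_imp_permutation[OF _ that]]
    by (simp flip: of_int_mult)
  let ?G = "\<lambda>\<sigma>. of_int (sign \<sigma>) * \<alpha> (\<lambda>i. v (\<sigma> i)) * \<beta> (\<lambda>i. v (\<sigma> (k + i)))"
  have "(\<Sum>\<sigma> | \<sigma> permutes {..<k + l}. of_int (sign \<sigma>) * \<alpha> (\<lambda>i. v (\<pi> (\<sigma> i))) * \<beta> (\<lambda>i. v (\<pi> (\<sigma> (k + i)))))
      = (\<Sum>\<sigma> | \<sigma> permutes {..<k + l}. of_int (sign \<pi>) * ?G (\<pi> \<circ> \<sigma>))"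
    by (intro sum.cong refl) (simp add: s mult_ac)
  also have "\<dots> = of_int (sign \<pi>) * (\<Sum>\<sigma> | \<sigma> permutes {..<k + l}. ?G \<sigma>)"
    unfolding sum_distrib_left[symmetric] by (subst (2) setum_permutations_compose_left[OF \<pi>]) simp
  finally show ?thesis by (simp add: wedge_def)
qed

lemma wedge_power_permute:
  assumes "\<pi> permutes {..<2 * m}"
  shows "wedge_power m \<omega> (\<lambda>i. v (\<pi> i)) = of_int (sign \<pi>) * wedge_power m \<omega> v"
proof (cases m)
  case 0
  with assms show ?thesis by simp
next
  case (Suc n)
  then show ?thesis using wedge_permute[of \<pi> 2 "2 * n"] assms by simp
qed

text \<open>Laplace expansion along the first \<open>n\<close> columns, up to the factor \<open>(n!)\<^sup>2\<close> that comes from summing over all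
  permutations instead of shuffles.\<close>

lemma sum_ndet_ndet:
  "(\<Sum>\<sigma> | \<sigma> permutes {..<n + n}. of_int (sign \<sigma>) * ndet n (\<lambda>i. A (\<sigma> i)) * ndet n (\<lambda>i. C (\<sigma> (n + i)))) =
    (fact n)\<^sup>2 * ndet (n + n) (\<lambda>k l. if k < n then A l k else C l (k - n))"
proof -
  let ?M = "\<lambda>k l. if k < n then A l k else C l (k - n)"
  let ?P = "{p. p permutes {..<n}}" and ?S = "{\<sigma>. \<sigma> permutes {..<n + n}}"
  \<comment> \<open>For fixed p and q the two act together as one permutation \<pi> of all 2n
    indices, p on the first half and q shifted to the second. Substituting \<sigma> \<circ> \<pi>
    cancels both signs, so each of the (n!)^2 pairs gives the same determinant.\<close>
  have inner: "(\<Sum>\<sigma>\<in>?S. of_int (sign \<sigma>) * (of_int (sign p) * (\<Prod>i<n. A (\<sigma> i) (p i))) *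
      (of_int (sign q) * (\<Prod>i<n. C (\<sigma> (n + i)) (q i)))) = ndet (n + n) ?M"
    if p: "p permutes {..<n}" and q: "q permutes {..<n}" for p q
  proof -
    obtain q' where q': "q' permutes {n..<n + n}" "sign q' = sign q" "\<And>i. i < n \<Longrightarrow> q' (n + i) = n + q i"
      using permutes_shift[OF q] by metis
    let ?\<pi> = "p \<circ> q'"
    have pq: "p permutes {..<n + n}" "q' permutes {..<n + n}"
      by (rule permutes_subset[OF p]) (auto intro: permutes_subset[OF q'(1)])
    have \<pi>: "?\<pi> permutes {..<n + n}" by (rule permutes_compose[OF pq(2,1)])
    have sgn: "sign ?\<pi> = sign p * sign q"
      using sign_compose[of p q'] pq q'(2) permutes_imp_permutation[of "{..<n + n}"] by simp
    have lo: "?\<pi> i = p i" "p i < n" if "i < n" for i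
      using permutes_not_in[OF q'(1)] that permutes_in_image[OF p] by auto
    have hi: "?\<pi> (n + i) = n + q i" if "i < n" for i
      using that q'(3) permutes_not_in[OF p] by auto
    have split: "(\<Prod>k<n + n. F k) = (\<Prod>i<n. F i) * (\<Prod>i<n. F (n + i))" for F :: "nat \<Rightarrow> complex"
    proof -
      have "(\<Prod>k<n + n. F k) = (\<Prod>k\<in>{..<n}. F k) * (\<Prod>k\<in>{n..<n + n}. F k)"
        by (subst prod.union_disjoint[symmetric]) (auto intro!: prod.cong)
      also have "(\<Prod>k\<in>{n..<n + n}. F k) = (\<Prod>i<n. F (n + i))"
        by (rule prod.reindex_bij_witness[of _ "\<lambda>i. n + i" "\<lambda>k. k - n"]) auto
      finally show ?thesis .
    qed
    have "(\<Sum>\<sigma>\<in>?S. of_int (sign \<sigma>) * (of_int (sign p) * (\<Prod>i<n. A (\<sigma> i) (p i))) *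
        (of_int (sign q) * (\<Prod>i<n. C (\<sigma> (n + i)) (q i))))
      = (\<Sum>\<sigma>\<in>?S. of_int (sign ?\<pi>) * (of_int (sign \<sigma>) * (\<Prod>k<n + n. ?M (?\<pi> k) (\<sigma> k))))"
      unfolding split sgn by (intro sum.cong refl) (simp add: lo hi mult_ac del: comp_apply)
    also have "\<dots> = (\<Sum>\<sigma>\<in>?S. of_int (sign ?\<pi>) * (of_int (sign (\<sigma> \<circ> ?\<pi>)) * (\<Prod>k<n + n. ?M (?\<pi> k) ((\<sigma> \<circ> ?\<pi>) k))))"
      by (rule sum_permutations_compose_right[OF \<pi>])
    also have "\<dots> = (\<Sum>\<sigma>\<in>?S. of_int (sign \<sigma>) * (\<Prod>k<n + n. ?M k (\<sigma> k)))"
    proof (intro sum.cong refl)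
      fix \<sigma> assume \<sigma>: "\<sigma> \<in> ?S"
      have "sign (\<sigma> \<circ> ?\<pi>) = sign \<sigma> * sign ?\<pi>"
        using sign_compose[of \<sigma> ?\<pi>] \<sigma> \<pi> permutes_imp_permutation[of "{..<n + n}"] by simp
      then have "of_int (sign ?\<pi>) * of_int (sign (\<sigma> \<circ> ?\<pi>)) = (of_int (sign \<sigma>) :: complex)"
        by (simp del: comp_apply flip: of_int_mult)
      moreover have "(\<Prod>k<n + n. ?M (?\<pi> k) ((\<sigma> \<circ> ?\<pi>) k)) = (\<Prod>k<n + n. ?M k (\<sigma> k))"
        using prod.permute[OF \<pi>, of "\<lambda>k. ?M k (\<sigma> k)"] unfolding comp_def by (rule sym)
      ultimately show "of_int (sign ?\<pi>) * (of_int (sign (\<sigma> \<circ> ?\<pi>)) * (\<Prod>k<n + n. ?M (?\<pi> k) ((\<sigma> \<circ> ?\<pi>) k))) =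
          of_int (sign \<sigma>) * (\<Prod>k<n + n. ?M k (\<sigma> k))"
        unfolding mult.assoc[symmetric] by (simp only:)
    qed
    finally show ?thesis by (simp add: ndet_def)
  qed
  have "(\<Sum>\<sigma>\<in>?S. of_int (sign \<sigma>) * ndet n (\<lambda>i. A (\<sigma> i)) * ndet n (\<lambda>i. C (\<sigma> (n + i)))) =
    (\<Sum>\<sigma>\<in>?S. \<Sum>p\<in>?P. \<Sum>q\<in>?P. of_int (sign \<sigma>) * (of_int (sign p) * (\<Prod>i<n. A (\<sigma> i) (p i))) *
      (of_int (sign q) * (\<Prod>i<n. C (\<sigma> (n + i)) (q i))))"
    unfolding ndet_def sum_distrib_left sum_distrib_right
    by (rule sum.cong[OF refl], rule sum.swap)
  also have "\<dots> = (\<Sum>p\<in>?P. \<Sum>\<sigma>\<in>?S. \<Sum>q\<in>?P. of_int (sign \<sigma>) * (of_int (sign p) * (\<Prod>i<n. A (\<sigma> i) (p i))) *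
      (of_int (sign q) * (\<Prod>i<n. C (\<sigma> (n + i)) (q i))))"
    by (rule sum.swap)
  also have "\<dots> = (\<Sum>p\<in>?P. \<Sum>q\<in>?P. \<Sum>\<sigma>\<in>?S. of_int (sign \<sigma>) * (of_int (sign p) * (\<Prod>i<n. A (\<sigma> i) (p i))) *
      (of_int (sign q) * (\<Prod>i<n. C (\<sigma> (n + i)) (q i))))"
    by (intro sum.cong refl sum.swap)
  also have "\<dots> = (\<Sum>p\<in>?P. \<Sum>q\<in>?P. ndet (n + n) ?M)"
    by (intro sum.cong refl) (use inner in blast)
  also have "\<dots> = (fact n)\<^sup>2 * ndet (n + n) ?M"
    by (simp add: card_permutations power2_eq_square)
  finally show ?thesis .
qed

lemma norm_det_unitary:
  fixes M :: "complex^'n^'n"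
  assumes "\<And>r s. (\<Sum>l\<in>UNIV. M $ r $ l * cnj (M $ s $ l)) = (if r = s then of_real c else 0)" and "c \<ge> 0"
  shows "(norm (det M))\<^sup>2 = c ^ CARD('n)"
proof -
  let ?H = "(\<chi> i j. cnj (M $ j $ i)) :: complex^'n^'n"
  have "det ?H = det (\<chi> i j. cnj (M $ i $ j))"
    using det_transpose[of "(\<chi> i j. cnj (M $ i $ j)) :: complex^'n^'n"]
    by (simp add: transpose_def)
  also have "\<dots> = cnj (det M)"
    unfolding det_def by simp
  finally have H: "det ?H = cnj (det M)" .
  have "M ** ?H = (\<chi> i j. if i = j then of_real c else 0)"
    by (simp add: matrix_matrix_mult_def assms(1) vec_eq_iff)
  then have "det M * cnj (det M) = det ((\<chi> i j. if i = j then of_real c else 0) :: complex^'n^'n)"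
    using det_mul[of M ?H] H by simp
  also have "\<dots> = of_real (c ^ CARD('n))"
    by (subst det_diagonal) auto
  finally have "of_real ((norm (det M))\<^sup>2) = (of_real (c ^ CARD('n)) :: complex)"
    by (metis complex_norm_square)
  then show ?thesis using of_real_eq_iff by blast
qed

text \<open>Only the modulus is computed, which avoids determining the sign of the shuffle that separates the
  vectors \<open>f\<^sub>j\<close> from the vectors \<open>\<i>f\<^sub>j\<close>; the sign is recovered later from positivity.\<close>

lemma norm_wedge_cnj:
  fixes \<alpha> :: "(complex^'m) form"
  assumes \<alpha>: "complex_alternating n \<alpha>" and N: "CARD('N::finite) = n + n"
    and v: "\<And>j. j < n \<Longrightarrow> v (2 * j) = f j" "\<And>j. j < n \<Longrightarrow> v (Suc (2 * j)) = \<i> *s f j"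
  shows "norm (wedge n n \<alpha> (\<lambda>w. cnj (\<alpha> w)) v) = 2 ^ n * (norm (\<alpha> f))\<^sup>2"
proof -
  \<comment> \<open>Coefficients of the \<open>v k\<close> in the vectors \<open>f j\<close>: row 2j
    is the unit vector e_j, row 2j + 1 is i times it.\<close>
  define A :: "nat \<Rightarrow> nat \<Rightarrow> complex" where
    "A k j = (if k = 2 * j then 1 else if k = Suc (2 * j) then \<i> else 0)" for k j
  have vA: "v k = (\<Sum>j<n. A k j *s f j)" if "k < n + n" for k
  proof -
    have "(\<Sum>j<n. A k j *s f j) = (\<Sum>j\<in>{k div 2}. A k j *s f j)"
      by (rule sum.mono_neutral_right) (use that in \<open>auto simp: A_def\<close>)
    moreover have "v k = A k (k div 2) *s f (k div 2)"
    proof (cases "even k")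
      case True
      then have "k = 2 * (k div 2)" by simp
      then show ?thesis using v(1)[of "k div 2"] that by (simp add: A_def)
    next
      case False
      then have "k = Suc (2 * (k div 2))" by simp
      then show ?thesis using v(2)[of "k div 2"] that False by (simp add: A_def) presburger
    qed
    ultimately show ?thesis by simp
  qed
  have lt: "\<sigma> k < n + n" if "\<sigma> permutes {..<n + n}" "k < n + n" for \<sigma> k
    using permutes_in_image[OF that(1)] that(2) by auto
  let ?S = "{\<sigma>. \<sigma> permutes {..<n + n}}"
  let ?C = "\<lambda>k j. cnj (A k j)"
  have cnj_ndet: "cnj (ndet n B) = ndet n (\<lambda>i j. cnj (B i j))" for B
    by (simp add: ndet_def)
  \<comment> \<open>The two halves of this square matrix are A and its conjugate, transposed; its
    determinant is the whole combinatorial content of the wedge product.\<close>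
  let ?M = "\<lambda>k l. if k < n then A l k else ?C l (k - n)"
  have "(\<Sum>\<sigma>\<in>?S. of_int (sign \<sigma>) * \<alpha> (\<lambda>i. v (\<sigma> i)) * cnj (\<alpha> (\<lambda>i. v (\<sigma> (n + i))))) =
      (\<Sum>\<sigma>\<in>?S. \<alpha> f * cnj (\<alpha> f) * (of_int (sign \<sigma>) * ndet n (\<lambda>i. A (\<sigma> i)) * ndet n (\<lambda>i. ?C (\<sigma> (n + i)))))"
  proof (intro sum.cong refl)
    fix \<sigma> assume "\<sigma> \<in> ?S"
    then have \<sigma>: "\<sigma> permutes {..<n + n}" by simp
    have "\<alpha> (\<lambda>i. v (\<sigma> i)) = ndet n (\<lambda>i. A (\<sigma> i)) * \<alpha> f"
      by (rule complex_alternating_ndet[OF \<alpha>]) (use vA lt[OF \<sigma>] in simp)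
    moreover have "\<alpha> (\<lambda>i. v (\<sigma> (n + i))) = ndet n (\<lambda>i. A (\<sigma> (n + i))) * \<alpha> f"
      by (rule complex_alternating_ndet[OF \<alpha>]) (use vA lt[OF \<sigma>] in simp)
    ultimately show "of_int (sign \<sigma>) * \<alpha> (\<lambda>i. v (\<sigma> i)) * cnj (\<alpha> (\<lambda>i. v (\<sigma> (n + i)))) =
        \<alpha> f * cnj (\<alpha> f) * (of_int (sign \<sigma>) * ndet n (\<lambda>i. A (\<sigma> i)) * ndet n (\<lambda>i. ?C (\<sigma> (n + i))))"
      by (simp add: cnj_ndet)
  qed
  also have "\<dots> = \<alpha> f * cnj (\<alpha> f) * ((fact n)\<^sup>2 * ndet (n + n) ?M)"
    using sum_ndet_ndet[of n A ?C] by (simp only: sum_distrib_left[symmetric])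
  finally have W: "wedge n n \<alpha> (\<lambda>w. cnj (\<alpha> w)) v = \<alpha> f * cnj (\<alpha> f) * ndet (n + n) ?M"
    by (simp add: wedge_def power2_eq_square)
  obtain ix :: "'N \<Rightarrow> nat" where ix: "bij_betw ix UNIV {..<n + n}"
    using finite_same_card_bij[of "UNIV::'N set" "{..<n + n}"] N by auto
  let ?D = "(\<chi> r s. ?M (ix s) (ix r)) :: complex^'N^'N"
  have D: "ndet (n + n) ?M = det ?D"
    using ndet_eq_det[OF ix, of ?M] det_transpose[of ?D] by (simp add: transpose_def)
  \<comment> \<open>The two halves of a product of rows are conjugate to each other, so its value is
    2 Re of a product of entries 1 or i: it is 2 on the diagonal and 0 elsewhere. Hence the
    determinant has modulus 2^n.\<close>
  have "(norm (det ?D))\<^sup>2 = 2 ^ CARD('N)"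
  proof (rule norm_det_unitary)
    fix r s :: 'N
    have r: "ix r < n + n" and s: "ix s < n + n" using ix by (auto simp: bij_betw_def)
    have rs: "ix r = ix s \<longleftrightarrow> r = s" using ix by (auto simp: bij_betw_def inj_on_def)
    have "(\<Sum>l\<in>UNIV. ?D $ r $ l * cnj (?D $ s $ l)) = (\<Sum>k<n + n. ?M k (ix r) * cnj (?M k (ix s)))"
      using sum.reindex_bij_betw[OF ix, of "\<lambda>k. ?M k (ix r) * cnj (?M k (ix s))"] by simp
    also have "\<dots> = (\<Sum>k<n. A (ix r) k * cnj (A (ix s) k)) + (\<Sum>k<n. cnj (A (ix r) k * cnj (A (ix s) k)))"
    proof -
      have "(\<Sum>k<n + n. ?M k (ix r) * cnj (?M k (ix s))) =
          (\<Sum>k\<in>{..<n}. ?M k (ix r) * cnj (?M k (ix s))) + (\<Sum>k\<in>{n..<n + n}. ?M k (ix r) * cnj (?M k (ix s)))"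
        by (subst sum.union_disjoint[symmetric]) (auto intro!: sum.cong)
      also have "(\<Sum>k\<in>{n..<n + n}. ?M k (ix r) * cnj (?M k (ix s))) =
          (\<Sum>k<n. cnj (A (ix r) k * cnj (A (ix s) k)))"
        by (rule sum.reindex_bij_witness[of _ "\<lambda>k. n + k" "\<lambda>k. k - n"]) auto
      finally show ?thesis by simp
    qed
    also have "\<dots> = of_real (2 * Re (\<Sum>k<n. A (ix r) k * cnj (A (ix s) k)))"
      unfolding cnj_sum[symmetric] by (rule complex_add_cnj)
    also have "(\<Sum>k<n. A (ix r) k * cnj (A (ix s) k)) = A (ix r) (ix r div 2) * cnj (A (ix s) (ix r div 2))"
    proof -
      have "(\<Sum>k<n. A (ix r) k * cnj (A (ix s) k)) = (\<Sum>k\<in>{ix r div 2}. A (ix r) k * cnj (A (ix s) k))"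
        by (rule sum.mono_neutral_right) (use r in \<open>auto simp: A_def\<close>)
      then show ?thesis by simp
    qed
    also have "Re (A (ix r) (ix r div 2) * cnj (A (ix s) (ix r div 2))) = (if r = s then 1 else 0)"
      unfolding rs[symmetric] by (auto simp: A_def)
    finally show "(\<Sum>l\<in>UNIV. ?D $ r $ l * cnj (?D $ s $ l)) = (if r = s then of_real 2 else 0)"
      by simp
  qed simp
  then have "norm (det ?D) = 2 ^ n"
    using N power2_eq_imp_eq[of "norm (det ?D)" "2 ^ n"] by (simp add: power_add power2_eq_square)
  then show ?thesis
    unfolding W D by (simp add: norm_mult power2_eq_square)
qed

text \<open>The permutations with the same first two values as \<rho> are \<rho> \<circ> \<tau> with
  \<tau> fixing 0 and 1. The sign of \<tau> is cancelled by the antisymmetry of \<open>W\<close>, so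
  all (2m)! terms are equal.\<close>

lemma sum_wedge_2_coset:
  assumes \<rho>: "\<rho> permutes {..<2 + 2 * m}"
    and W: "\<And>\<pi> v. \<pi> permutes {..<2 * m} \<Longrightarrow> W (\<lambda>i. v (\<pi> i)) = of_int (sign \<pi>) * W v"
  shows "(\<Sum>\<sigma> | \<sigma> permutes {..<2 + 2 * m} \<and> \<sigma> 0 = \<rho> 0 \<and> \<sigma> 1 = \<rho> 1.
      of_int (sign \<sigma>) * \<omega> (v (\<sigma> 0)) (v (\<sigma> 1)) * W (\<lambda>i. v (\<sigma> (2 + i)))) =
    fact (2 * m) * (of_int (sign \<rho>) * \<omega> (v (\<rho> 0)) (v (\<rho> 1)) * (W (\<lambda>i. v (\<rho> (2 + i))) :: complex))"
    (is "(\<Sum>\<sigma>\<in>?A. ?F \<sigma>) = _ * ?c")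
proof -
  let ?T = "{\<tau>. \<tau> permutes {2..<2 + 2 * m}}"
  have T01: "\<tau> 0 = 0" "\<tau> 1 = 1" "\<tau> permutes {..<2 + 2 * m}" if "\<tau> \<in> ?T" for \<tau>
  proof -
    from that have \<tau>: "\<tau> permutes {2..<2 + 2 * m}" by simp
    show "\<tau> 0 = 0" "\<tau> 1 = 1" using permutes_not_in[OF \<tau>] by auto
    show "\<tau> permutes {..<2 + 2 * m}" by (rule permutes_subset[OF \<tau>]) auto
  qed
  have "(\<Sum>\<sigma>\<in>?A. ?F \<sigma>) = (\<Sum>\<tau>\<in>?T. ?F (\<rho> \<circ> \<tau>))"
  proof (rule sum.reindex_bij_witness[of _ "\<lambda>\<tau>. \<rho> \<circ> \<tau>" "\<lambda>\<sigma>. inv \<rho> \<circ> \<sigma>"])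
    fix \<sigma> assume \<sigma>: "\<sigma> \<in> ?A"
    show 1: "\<rho> \<circ> (inv \<rho> \<circ> \<sigma>) = \<sigma>"
      by (simp add: fun_eq_iff permutes_inverses[OF \<rho>])
    have "(inv \<rho> \<circ> \<sigma>) permutes {..<2 + 2 * m}"
      using \<sigma> permutes_compose permutes_inv[OF \<rho>] by blast
    moreover have "(inv \<rho> \<circ> \<sigma>) x = x" if "x \<in> {..<2 + 2 * m} - {2..<2 + 2 * m}" for x
    proof -
      have "x = 0 \<or> x = 1" using that by auto
      then show ?thesis using \<sigma> permutes_inverses[OF \<rho>] by auto
    qed
    ultimately show "inv \<rho> \<circ> \<sigma> \<in> ?T"
      using permutes_superset by blast
    show "?F (\<rho> \<circ> (inv \<rho> \<circ> \<sigma>)) = ?F \<sigma>" unfolding 1 ..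
  next
    fix \<tau> assume \<tau>: "\<tau> \<in> ?T"
    show "inv \<rho> \<circ> (\<rho> \<circ> \<tau>) = \<tau>"
      by (simp add: fun_eq_iff permutes_inverses[OF \<rho>])
    show "\<rho> \<circ> \<tau> \<in> ?A"
      using T01[OF \<tau>] permutes_compose[OF _ \<rho>] by auto
  qed
  also have "\<dots> = (\<Sum>\<tau>\<in>?T. ?c)"
  proof (intro sum.cong refl)
    fix \<tau> assume \<tau>: "\<tau> \<in> ?T"
    then obtain \<tau>' where \<tau>': "\<tau>' permutes {..<2 * m}" "sign \<tau> = sign \<tau>'" "\<And>i. i < 2 * m \<Longrightarrow> \<tau> (2 + i) = 2 + \<tau>' i"
      using permutes_unshift[of \<tau> 2 "2 * m"] by auto
    have eq: "\<tau> (2 + i) = 2 + \<tau>' i" for i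
      using \<tau>' permutes_not_in[OF \<tau>'(1), of i] permutes_not_in[of \<tau> "{2..<2 + 2 * m}" "2 + i"] \<tau>
      by (cases "i < 2 * m") auto
    have s: "of_int (sign (\<rho> \<circ> \<tau>)) * of_int (sign \<tau>) = (of_int (sign \<rho>) :: complex)"
      using sign_compose[OF permutes_imp_permutation[OF _ \<rho>] permutes_imp_permutation[OF _ T01(3)[OF \<tau>]]]
      by (simp flip: of_int_mult)
    have "W (\<lambda>i. v ((\<rho> \<circ> \<tau>) (2 + i))) = of_int (sign \<tau>) * W (\<lambda>i. v (\<rho> (2 + i)))"
      using W[OF \<tau>'(1), of "\<lambda>i. v (\<rho> (2 + i))"] \<tau>'(2) by (simp only: comp_apply eq)
    then show "?F (\<rho> \<circ> \<tau>) = ?c"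
      using T01[OF \<tau>] by (simp add: s[symmetric])
  qed
  also have "\<dots> = fact (2 * m) * ?c"
    using card_permutations[of "{2..<2 + 2 * m}" "2 * m"] by simp
  finally show ?thesis .
qed

text \<open>The vectors come in symplectic pairs numbered (2a, 2a + 1). Only permutations that send
  0 and 1 to one of these pairs, in either order, contribute; the induction hypothesis for the
  remaining pairs shows that each pair contributes the same, and division by 2! (2m)! leaves the
  factor m + 1.\<close>

lemma wedge_power_symplectic:
  fixes \<omega> :: "'v \<Rightarrow> 'v \<Rightarrow> complex"
  assumes "\<And>a b. a < m \<Longrightarrow> b < m \<Longrightarrow> \<omega> (v (2 * a)) (v (2 * b + 1)) = (if a = b then l a else 0)"
    and "\<And>a b. a < m \<Longrightarrow> b < m \<Longrightarrow> \<omega> (v (2 * b + 1)) (v (2 * a)) = (if a = b then - l a else 0)"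
    and "\<And>a b. a < m \<Longrightarrow> b < m \<Longrightarrow> \<omega> (v (2 * a)) (v (2 * b)) = 0"
    and "\<And>a b. a < m \<Longrightarrow> b < m \<Longrightarrow> \<omega> (v (2 * a + 1)) (v (2 * b + 1)) = 0"
  shows "wedge_power m (\<lambda>w. \<omega> (w 0) (w 1)) v = fact m * (\<Prod>a<m. l a)"
  using assms
proof (induction m arbitrary: v l)
  case 0
  then show ?case by simp
next
  case (Suc m)
  note h = Suc.prems
  let ?W = "wedge_power m (\<lambda>w. \<omega> (w 0) (w 1))"
  let ?N = "2 + 2 * m"
  let ?F = "\<lambda>\<sigma>. of_int (sign \<sigma>) * \<omega> (v (\<sigma> 0)) (v (\<sigma> 1)) * ?W (\<lambda>i. v (\<sigma> (2 + i)))"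
  let ?A = "\<lambda>k l. {\<sigma>. \<sigma> permutes {..<?N} \<and> \<sigma> 0 = k \<and> \<sigma> 1 = l}"
  let ?S = "{\<sigma>. \<sigma> permutes {..<?N}}"
  let ?L = "\<Prod>a<Suc m. l a"
  \<comment> \<open>Exchanges pair 0 with pair j by two transpositions, so it brings pair j to the
    front without a sign.\<close>
  define \<rho> where "\<rho> j = Transposition.transpose 0 (2 * j) \<circ> Transposition.transpose 1 (2 * j + 1)" for j :: nat
  have \<rho>perm: "\<rho> j permutes {..<?N}" if "j < Suc m" for j
    unfolding \<rho>_def using that by (intro permutes_compose permutes_swap_id) auto
  have \<rho>0: "\<rho> j 0 = 2 * j" "\<rho> j 1 = 2 * j + 1" for j
    by (auto simp: \<rho>_def Transposition.transpose_def)
  have \<rho>2: "\<rho> j (2 * a) = 2 * Transposition.transpose 0 j a"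
    "\<rho> j (2 * a + 1) = 2 * Transposition.transpose 0 j a + 1" for j a
    by (auto simp: \<rho>_def Transposition.transpose_def) presburger+
  have \<rho>sgn: "sign (\<rho> j) = 1" for j
    unfolding \<rho>_def by (subst sign_compose) (auto simp: permutation_swap_id sign_swap_id)
  have Wj: "?W (\<lambda>i. v (\<rho> j (2 + i))) = fact m * (\<Prod>a<m. l (Transposition.transpose 0 j (Suc a)))"
    if j: "j < Suc m" for j
  proof (rule Suc.IH)
    let ?t = "\<lambda>a. Transposition.transpose 0 j (Suc a)"
    have t: "?t a < Suc m" if "a < m" for a using that j by (auto simp: Transposition.transpose_def)
    have tt: "?t a = ?t b \<longleftrightarrow> a = b" for a b by (metis Suc_inject transpose_involutory)
    have e: "\<rho> j (2 + 2 * a) = 2 * ?t a" "\<rho> j (2 + (2 * a + 1)) = 2 * ?t a + 1" for a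
      using \<rho>2[of j "Suc a"] by auto
    fix a b assume ab: "a < m" "b < m"
    show "\<omega> (v (\<rho> j (2 + 2 * a))) (v (\<rho> j (2 + (2 * b + 1)))) = (if a = b then l (?t a) else 0)"
      unfolding e using h(1)[OF t[OF ab(1)] t[OF ab(2)]] tt by simp
    show "\<omega> (v (\<rho> j (2 + (2 * b + 1)))) (v (\<rho> j (2 + 2 * a))) = (if a = b then - l (?t a) else 0)"
      unfolding e using h(2)[OF t[OF ab(1)] t[OF ab(2)]] tt by simp
    show "\<omega> (v (\<rho> j (2 + 2 * a))) (v (\<rho> j (2 + 2 * b))) = 0"
      unfolding e using h(3)[OF t[OF ab(1)] t[OF ab(2)]] by simp
    show "\<omega> (v (\<rho> j (2 + (2 * a + 1)))) (v (\<rho> j (2 + (2 * b + 1)))) = 0"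
      unfolding e using h(4)[OF t[OF ab(1)] t[OF ab(2)]] by simp
  qed
  have lW: "l j * ?W (\<lambda>i. v (\<rho> j (2 + i))) = fact m * ?L" if j: "j < Suc m" for j
  proof -
    have "?L = (\<Prod>a<Suc m. l (Transposition.transpose 0 j a))"
      using prod.permute[OF permutes_swap_id[of 0 "{..<Suc m}" j], of l] j by (simp add: comp_def)
    also have "\<dots> = l j * (\<Prod>a<m. l (Transposition.transpose 0 j (Suc a)))"
      by (subst prod.lessThan_Suc_shift) simp
    finally show ?thesis unfolding Wj[OF j] by simp
  qed
  have A1: "(\<Sum>\<sigma>\<in>?A (2 * j) (2 * j + 1). ?F \<sigma>) = fact (2 * m) * (fact m * ?L)" if j: "j < Suc m" for j
  proof -
    have "(\<Sum>\<sigma>\<in>?A (2 * j) (2 * j + 1). ?F \<sigma>) = fact (2 * m) *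
        (of_int (sign (\<rho> j)) * \<omega> (v (2 * j)) (v (2 * j + 1)) * ?W (\<lambda>i. v (\<rho> j (2 + i))))"
      using sum_wedge_2_coset[OF \<rho>perm[OF j], where W = ?W and \<omega> = \<omega> and v = v, OF wedge_power_permute]
      unfolding \<rho>0 .
    also have "\<omega> (v (2 * j)) (v (2 * j + 1)) = l j" using h(1)[OF j j] by simp
    finally show ?thesis by (simp only: \<rho>sgn of_int_1 mult_1 lW[OF j])
  qed
  have A2: "(\<Sum>\<sigma>\<in>?A (2 * j + 1) (2 * j). ?F \<sigma>) = fact (2 * m) * (fact m * ?L)" if j: "j < Suc m" for j
  proof -
    let ?\<rho> = "\<rho> j \<circ> Transposition.transpose 0 1"
    have p: "?\<rho> permutes {..<?N}"
      by (intro permutes_compose \<rho>perm[OF j] permutes_swap_id) auto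
    have s: "sign ?\<rho> = - 1"
      using sign_compose[OF permutes_imp_permutation[OF _ \<rho>perm[OF j]] permutation_swap_id] \<rho>sgn[of j]
      by (simp add: sign_swap_id)
    have r: "?\<rho> 0 = 2 * j + 1" "?\<rho> 1 = 2 * j" "?\<rho> (2 + i) = \<rho> j (2 + i)" for i
      using \<rho>0[of j] by (auto simp: Transposition.transpose_def)
    have "(\<Sum>\<sigma>\<in>?A (2 * j + 1) (2 * j). ?F \<sigma>) = fact (2 * m) *
        (of_int (sign ?\<rho>) * \<omega> (v (2 * j + 1)) (v (2 * j)) * ?W (\<lambda>i. v (\<rho> j (2 + i))))"
      using sum_wedge_2_coset[OF p, where W = ?W and \<omega> = \<omega> and v = v, OF wedge_power_permute]
      unfolding r .
    also have "\<omega> (v (2 * j + 1)) (v (2 * j)) = - l j" using h(2)[OF j j] by simp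
    also have "of_int (sign ?\<rho>) * - l j = l j" by (simp only: s) simp
    finally show ?thesis by (simp only: lW[OF j])
  qed
  have zero: "?F \<sigma> = 0" if "\<sigma> \<in> ?S" "\<nexists>j. j < Suc m \<and> (\<sigma> 0 = 2 * j \<and> \<sigma> 1 = 2 * j + 1 \<or> \<sigma> 0 = 2 * j + 1 \<and> \<sigma> 1 = 2 * j)" for \<sigma>
  proof -
    have lt: "\<sigma> 0 < ?N" "\<sigma> 1 < ?N" using that(1) permutes_in_image[of \<sigma> "{..<?N}"] by auto
    define a b where "a = \<sigma> 0 div 2" and "b = \<sigma> 1 div 2"
    have ab: "a < Suc m" "b < Suc m" using lt by (auto simp: a_def b_def)
    have ca: "\<sigma> 0 = 2 * a \<or> \<sigma> 0 = 2 * a + 1" and cb: "\<sigma> 1 = 2 * b \<or> \<sigma> 1 = 2 * b + 1"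
      by (auto simp: a_def b_def)
    have "\<omega> (v (\<sigma> 0)) (v (\<sigma> 1)) = 0"
      using ca cb
    proof (elim disjE)
      assume *: "\<sigma> 0 = 2 * a" "\<sigma> 1 = 2 * b + 1"
      then have "a \<noteq> b" using that(2) ab by blast
      then show ?thesis unfolding * using h(1)[OF ab] by simp
    next
      assume *: "\<sigma> 0 = 2 * a + 1" "\<sigma> 1 = 2 * b"
      then have "a \<noteq> b" using that(2) ab by blast
      then show ?thesis unfolding * using h(2)[OF ab(2,1)] by simp
    next
      assume *: "\<sigma> 0 = 2 * a" "\<sigma> 1 = 2 * b"
      then show ?thesis unfolding * using h(3)[OF ab] by simp
    next
      assume *: "\<sigma> 0 = 2 * a + 1" "\<sigma> 1 = 2 * b + 1"
      then show ?thesis unfolding * using h(4)[OF ab] by simp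
    qed
    then show ?thesis by simp
  qed
  have finS: "finite ?S" by (simp add: finite_permutations)
  have "(\<Sum>\<sigma>\<in>?S. ?F \<sigma>) = (\<Sum>\<sigma>\<in>(\<Union>j<Suc m. ?A (2 * j) (2 * j + 1) \<union> ?A (2 * j + 1) (2 * j)). ?F \<sigma>)"
    by (rule sum.mono_neutral_right[OF finS]) (use zero in blast)+
  also have "\<dots> = (\<Sum>j<Suc m. \<Sum>\<sigma>\<in>?A (2 * j) (2 * j + 1) \<union> ?A (2 * j + 1) (2 * j). ?F \<sigma>)"
  proof (rule sum.UNION_disjoint)
    show "\<forall>i\<in>{..<Suc m}. finite (?A (2 * i) (2 * i + 1) \<union> ?A (2 * i + 1) (2 * i))"
      using finS by auto
    show "\<forall>i\<in>{..<Suc m}. \<forall>j\<in>{..<Suc m}. i \<noteq> j \<longrightarrow>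
        (?A (2 * i) (2 * i + 1) \<union> ?A (2 * i + 1) (2 * i)) \<inter> (?A (2 * j) (2 * j + 1) \<union> ?A (2 * j + 1) (2 * j)) = {}"
      by auto
  qed simp
  also have "\<dots> = (\<Sum>j<Suc m. 2 * (fact (2 * m) * (fact m * ?L)))"
  proof (intro sum.cong refl)
    fix j assume j: "j \<in> {..<Suc m}"
    have "(\<Sum>\<sigma>\<in>?A (2 * j) (2 * j + 1) \<union> ?A (2 * j + 1) (2 * j). ?F \<sigma>) =
        (\<Sum>\<sigma>\<in>?A (2 * j) (2 * j + 1). ?F \<sigma>) + (\<Sum>\<sigma>\<in>?A (2 * j + 1) (2 * j). ?F \<sigma>)"
      by (rule sum.union_disjoint) (use finS in auto)
    then show "(\<Sum>\<sigma>\<in>?A (2 * j) (2 * j + 1) \<union> ?A (2 * j + 1) (2 * j). ?F \<sigma>) = 2 * (fact (2 * m) * (fact m * ?L))"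
      using A1 A2 j by simp
  qed
  finally have "(\<Sum>\<sigma>\<in>?S. ?F \<sigma>) = of_nat (Suc m) * (2 * (fact (2 * m) * (fact m * ?L)))" by simp
  then have "wedge_power (Suc m) (\<lambda>w. \<omega> (w 0) (w 1)) v =
      of_nat (Suc m) * (2 * (fact (2 * m) * (fact m * ?L))) / (fact 2 * fact (2 * m))"
    by (simp add: wedge_def)
  also have "\<dots> = fact (Suc m) * ?L"
    by (simp add: field_simps del: prod.lessThan_Suc)
  finally show ?case .
qed


section \<open>Orthonormal frames along the quadric\<close>

definition orthonormal :: "nat \<Rightarrow> (nat \<Rightarrow> 'a::real_inner) \<Rightarrow> bool" where
  "orthonormal n E \<longleftrightarrow> (\<forall>i<n. \<forall>j<n. E i \<bullet> E j = (if i = j then 1 else 0))"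

lemma inverse_norm_square:
  "x \<noteq> 0 \<Longrightarrow> inverse (norm x) * (inverse (norm x) * (norm x * norm x)) = (1 :: real)"
  by (simp add: field_simps)

lemma orthonormal_extend:
  fixes E :: "nat \<Rightarrow> 'a::euclidean_space"
  assumes "orthonormal k E" "k \<le> DIM('a)"
  shows "\<exists>E'. orthonormal DIM('a) E' \<and> (\<forall>i<k. E' i = E i)"
  using assms
proof (induction "DIM('a) - k" arbitrary: k E)
  case 0
  then show ?case by auto
next
  case (Suc n)
  have "dim (E ` {..<k}) \<le> card (E ` {..<k})"
    by (rule dim_le_card') simp
  also have "\<dots> \<le> k" using card_image_le[of "{..<k}" E] by simp
  finally have "dim (E ` {..<k}) < DIM('a)" using Suc by simp
  then obtain x where x: "x \<noteq> 0" "\<And>y. y \<in> span (E ` {..<k}) \<Longrightarrow> orthogonal x y"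
    using orthogonal_to_subspace_exists by blast
  then have xE: "x \<bullet> E i = 0" "E i \<bullet> x = 0" if "i < k" for i
    using that x(2)[OF span_base[of "E i" "E ` {..<k}"]] by (auto simp: orthogonal_def inner_commute[of _ x])
  let ?E = "E(k := x /\<^sub>R norm x)"
  have "orthonormal (Suc k) ?E"
    using Suc.prems(1) x(1) xE
    by (auto simp: orthonormal_def less_Suc_eq power2_norm_eq_inner[symmetric] power2_eq_square
        inverse_norm_square)
  moreover have "n = DIM('a) - Suc k" "Suc k \<le> DIM('a)" using Suc by auto
  ultimately obtain E' where "orthonormal DIM('a) E'" "\<forall>i<Suc k. E' i = ?E i"
    using Suc.hyps(1) by blast
  then show ?case by (auto intro!: exI[of _ E'])
qed

section \<open>Complex bilinear algebra and the adapted frame of the quadric\<close>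

definition cvec :: "real^'n \<Rightarrow> complex^'n" where
  "cvec x = (\<chi> i. of_real (x $ i))"

definition cdot :: "complex^'n \<Rightarrow> complex^'n \<Rightarrow> complex" where
  "cdot v w = (\<Sum>i\<in>UNIV. v $ i * w $ i)"

definition vcnj :: "complex^'n \<Rightarrow> complex^'n" where
  "vcnj v = (\<chi> i. cnj (v $ i))"

lemma cdot_simps [simp]:
  "cdot (v + v') w = cdot v w + cdot v' w" "cdot w (v + v') = cdot w v + cdot w v'"
  "cdot (c *s v) w = c * cdot v w" "cdot w (c *s v) = c * cdot w v"
  "cdot (cvec x) (cvec y) = of_real (x \<bullet> y)"
  "cdot (- v) w = - cdot v w" "cdot w (- v) = - cdot w v"
  "cdot (v - v') w = cdot v w - cdot v' w" "cdot w (v - v') = cdot w v - cdot w v'"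
  by (simp_all add: cdot_def cvec_def sum.distrib sum_distrib_left algebra_simps inner_vec_def
      sum_negf sum_subtractf)

lemma vcnj_simps [simp]:
  "vcnj (v + w) = vcnj v + vcnj w" "vcnj (v - w) = vcnj v - vcnj w" "vcnj (- v) = - vcnj v" "vcnj (c *s v) = cnj c *s vcnj v" "vcnj (cvec x) = cvec x"
  by (simp_all add: vcnj_def cvec_def vec_eq_iff)

lemma cdot_commute: "cdot v w = cdot w v"
  by (simp add: cdot_def mult.commute)

lemma quadric_cdot: "z \<in> quadric \<longleftrightarrow> cdot z z = 1"
  by (simp add: quadric_def cdot_def power2_eq_square)

lemma quadric_tangent_cdot: "v \<in> quadric_tangent z \<longleftrightarrow> cdot z v = 0"
  by (simp add: quadric_tangent_def cdot_def)

lemma rsq_cdot: "of_real (rsq z) = cdot z (vcnj z)"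
proof -
  have "(\<Sum>i\<in>UNIV. z $ i * cnj (z $ i)) = of_real (\<Sum>i\<in>UNIV. (norm (z $ i))\<^sup>2)"
    by (simp only: complex_norm_square of_real_sum)
  then show ?thesis by (simp add: rsq_def cdot_def vcnj_def)
qed

lemma hermitian_cdot:
  "hermitian u z v w = of_real (deriv u (rsq z)) * cdot v (vcnj w) +
    of_real (deriv (deriv u) (rsq z)) * (cdot (vcnj z) v * cnj (cdot (vcnj z) w))"
  by (simp add: hermitian_def cdot_def vcnj_def)

text \<open>Meant for z = a e_0 + b e_1 with a^2 + b^2 = 1: the first vector is the derivative of z
  under rotation of the plane of e_0 and e_1, the others are e_2, ..., e_6, whence the shift of the
  index. It serves both a = C, b = i S and a = cos \<zeta>, b = sin \<zeta>.\<close>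

definition quadric_frame :: "complex \<Rightarrow> complex \<Rightarrow> (nat \<Rightarrow> real^'n) \<Rightarrow> nat \<Rightarrow> complex^'n" where
  "quadric_frame a b E i = (if i = 0 then (- b) *s cvec (E 0) + a *s cvec (E 1) else cvec (E (Suc i)))"

lemma cvec_expand:
  fixes E :: "nat \<Rightarrow> real^'n"
  assumes E: "orthonormal CARD('n) E"
  shows "t = (\<Sum>k<CARD('n). cdot t (cvec (E k)) *s cvec (E k))"
proof -
  let ?n = "CARD('n)"
  have inj: "inj_on E {..<?n}"
    using E unfolding orthonormal_def inj_on_def by (metis lessThan_iff zero_neq_one)
  have orth: "pairwise orthogonal (E ` {..<?n})"
    using E by (auto simp: pairwise_def orthogonal_def orthonormal_def)
  have nrm: "norm v = 1" if "v \<in> E ` {..<?n}" for v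
    using E that by (auto simp: orthonormal_def norm_eq_1)
  have "independent (E ` {..<?n})"
    using pairwise_orthogonal_independent[OF orth] nrm by fastforce
  then have "UNIV \<subseteq> span (E ` {..<?n})"
    by (intro card_ge_dim_independent) (auto simp: card_image[OF inj])
  then have real: "x = (\<Sum>k<?n. (x \<bullet> E k) *\<^sub>R E k)" for x
    using orthonormal_basis_expand[OF orth nrm, of x] by (simp add: sum.reindex[OF inj] subset_eq)
  show ?thesis
  proof (subst vec_eq_iff, rule allI)
    fix i
    let ?R = "(\<chi> i. Re (t $ i)) :: real^'n" and ?I = "(\<chi> i. Im (t $ i)) :: real^'n"
    have "cdot t (cvec x) = of_real (?R \<bullet> x) + \<i> * of_real (?I \<bullet> x)" for x
      by (simp add: complex_eq_iff cdot_def cvec_def inner_vec_def)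
    moreover have "Re (t $ i) = (\<Sum>k<?n. (?R \<bullet> E k) *\<^sub>R E k) $ i" "Im (t $ i) = (\<Sum>k<?n. (?I \<bullet> E k) *\<^sub>R E k) $ i"
      using arg_cong[OF real[of ?R], of "\<lambda>v. v $ i"] arg_cong[OF real[of ?I], of "\<lambda>v. v $ i"]
      by (simp_all only: vec_lambda_beta)
    ultimately show "t $ i = (\<Sum>k<?n. cdot t (cvec (E k)) *s cvec (E k)) $ i"
      by (simp add: complex_eq_iff cvec_def)
  qed
qed

lemma orthonormal_inner:
  "orthonormal n E \<Longrightarrow> i < n \<Longrightarrow> j < n \<Longrightarrow> E i \<bullet> E j = (if i = j then 1 else 0)"
  by (simp add: orthonormal_def)

lemma quadric_frame_tangent:
  fixes E :: "nat \<Rightarrow> real^7"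
  assumes E: "orthonormal 7 E" and i: "i < 6"
  shows "quadric_frame a b E i \<in> quadric_tangent (a *s cvec (E 0) + b *s cvec (E 1))"
  using i unfolding quadric_tangent_cdot
  by (auto simp: quadric_frame_def orthonormal_inner[OF E])

lemma quadric_frame_quadric:
  fixes E :: "nat \<Rightarrow> real^7"
  assumes E: "orthonormal 7 E" and ab: "a\<^sup>2 + b\<^sup>2 = 1"
  shows "a *s cvec (E 0) + b *s cvec (E 1) \<in> quadric"
  unfolding quadric_cdot using ab by (simp add: orthonormal_inner[OF E] power2_eq_square)

lemma quadric_frame_expand:
  fixes E :: "nat \<Rightarrow> real^7"
  assumes E: "orthonormal 7 E" and ab: "a\<^sup>2 + b\<^sup>2 = 1"
    and t: "t \<in> quadric_tangent (a *s cvec (E 0) + b *s cvec (E 1))"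
  shows "\<exists>B. t = (\<Sum>j<6. B j *s quadric_frame a b E j)"
proof -
  define c where "c k = cdot t (cvec (E k))" for k
  have t: "a * c 0 + b * c 1 = 0"
    using t by (simp add: quadric_tangent_cdot c_def cdot_commute[of t])
  let ?B = "\<lambda>j. if j = 0 then - b * c 0 + a * c 1 else c (Suc j)"
  \<comment> \<open>As a c_0 + b c_1 = 0, the pair (c_0, c_1) is a multiple of (-b, a), and a^2 +
    b^2 = 1 identifies the factor as -b c_0 + a c_1.\<close>
  have "- b * (- b * c 0 + a * c 1) = (a\<^sup>2 + b\<^sup>2) * c 0 - a * (a * c 0 + b * c 1)"
    "a * (- b * c 0 + a * c 1) = (a\<^sup>2 + b\<^sup>2) * c 1 - b * (a * c 0 + b * c 1)"
    by (simp_all add: algebra_simps power2_eq_square)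
  then have e: "- b * (- b * c 0 + a * c 1) = c 0" "a * (- b * c 0 + a * c 1) = c 1"
    unfolding t ab by simp_all
  define X where "X = - b * c 0 + a * c 1"
  have "t = (\<Sum>k<7. c k *s cvec (E k))"
    using cvec_expand[of E t] E by (simp add: c_def)
  also have "\<dots> = c 0 *s cvec (E 0) + c 1 *s cvec (E 1) + (\<Sum>k<5. c (k + 2) *s cvec (E (k + 2)))"
    by (simp add: eval_nat_numeral add.assoc)
  also have "c 0 *s cvec (E 0) + c 1 *s cvec (E 1) = X *s ((- b) *s cvec (E 0) + a *s cvec (E 1))"
    unfolding vector_add_ldistrib vector_smult_assoc mult.commute[of X] using e unfolding X_def by (simp only:)
  also have "\<dots> = ?B 0 *s quadric_frame a b E 0"
    by (simp add: quadric_frame_def X_def)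
  also have "?B 0 *s quadric_frame a b E 0 + (\<Sum>k<5. c (k + 2) *s cvec (E (k + 2)))
      = (\<Sum>j<6. ?B j *s quadric_frame a b E j)"
    by (simp add: eval_nat_numeral add.assoc quadric_frame_def)
  finally show ?thesis by (rule exI[where x = ?B])
qed

section \<open>Numberings of the coordinates and \<Omega>_0 as a determinant\<close>

lemma bij_of_nat_6: "bij_betw (of_nat :: nat \<Rightarrow> 6) {..<6} UNIV"
proof -
  have "x \<in> of_nat ` {..<6}" for x :: 6
  proof (induct x)
    case (of_int z)
    then show ?case by (auto intro!: image_eqI[of _ _ "nat z"])
  qed
  then have surj: "(of_nat :: nat \<Rightarrow> 6) ` {..<6} = UNIV" by auto
  have "inj_on (of_nat :: nat \<Rightarrow> 6) {..<6}"
    by (rule eq_card_imp_inj_on) (simp_all add: surj)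
  with surj show ?thesis by (simp add: bij_betw_def)
qed

text \<open>\<open>index_6\<close> inverts the numbering by \<open>of_nat\<close> that
  \<open>coord_frame\<close> uses. For \<open>index_7\<close> any bijection serves: another choice
  changes \<open>vol\<close> by a sign only.\<close>

definition index_6 :: "6 \<Rightarrow> nat" where "index_6 = inv_into {..<6} of_nat"
definition index_7 :: "7 \<Rightarrow> nat" where "index_7 = (SOME f. bij_betw f UNIV {..<7})"

lemma bij_index_6: "bij_betw index_6 UNIV {..<6}"
  unfolding index_6_def by (rule bij_betw_inv_into[OF bij_of_nat_6])

lemma of_nat_index_6 [simp]: "of_nat (index_6 r) = r"
  unfolding index_6_def using bij_of_nat_6 by (intro f_inv_into_f) (auto simp: bij_betw_def)

lemma bij_index_7: "bij_betw index_7 UNIV {..<7}"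
  unfolding index_7_def
  by (rule someI_ex[of "\<lambda>f. bij_betw f UNIV {..<7}"]) (rule finite_same_card_bij; simp)

text \<open>The form \<open>\<Omega>\<^sub>0\<close>: contracting \<open>dz\<^sub>1 \<and> \<dots> \<and> dz\<^sub>7\<close> with the Euler field \<open>z\<close>, on which
  \<open>\<onehalf> d(\<Sum> z\<^sub>i\<^sup>2)\<close> takes the value 1.\<close>

definition vol :: "complex^7 \<Rightarrow> (nat \<Rightarrow> complex^7) \<Rightarrow> complex" where
  "vol z t = det ((\<chi> r. case_nat z t (index_7 r)) :: complex^7^7)"

lemma complex_alternating_vol: "complex_alternating 6 (vol z)"
proof -
  have "complex_alternating (Suc 6) (\<lambda>v. det ((\<chi> r. v (index_7 r)) :: complex^7^7))"
    using complex_alternating_det[OF bij_index_7] by simp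
  from complex_alternating_contract[OF this] show ?thesis
    unfolding vol_def[abs_def] .
qed

text \<open>Lets a chart put \<open>z\<close> into a row of its choice; the real factor does not
  affect a phase that matters only up to sign.\<close>

lemma vol_permute:
  assumes g: "bij_betw g (UNIV :: 7 set) {..<7}"
  obtains s :: real where "\<bar>s\<bar> = 1" "vol z t = of_real s * det ((\<chi> r. case_nat z t (g r)) :: complex^7^7)"
proof -
  have inj: "inj g" "inj index_7" and rg: "range g = {..<7}" "range index_7 = {..<7}"
    using g bij_index_7 by (auto simp: bij_betw_def)
  define p where "p r = inv g (index_7 r)" for r
  have gp: "g (p r) = index_7 r" for r
    unfolding p_def using rg by (intro f_inv_into_f) auto
  have "inj p" unfolding inj_def by (metis gp inj(2) injD)
  then have "bij p" by (simp add: bij_def finite_UNIV_inj_surj)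
  then have p: "p permutes UNIV" by (rule bij_imp_permutes) simp
  have "vol z t = of_int (sign p) * det ((\<chi> r. case_nat z t (g r)) :: complex^7^7)"
    using det_permute_rows[OF p, of "(\<chi> r. case_nat z t (g r)) :: complex^7^7"]
    by (simp add: vol_def gp)
  moreover have "\<bar>of_int (sign p) :: real\<bar> = 1" by (simp add: sign_def)
  ultimately show ?thesis using that[of "of_int (sign p)"] by simp
qed

lemma det_of_real: "det ((\<chi> i j. of_real (A i j)) :: complex^'n^'n) = of_real (det (\<chi> i j. A i j))"
  by (simp add: det_def)

lemma vol_orthonormal:
  assumes E: "orthonormal 7 E"
  shows "norm (vol (cvec (E 0)) (\<lambda>i. cvec (E (Suc i)))) = 1"
proof -
  have "case_nat (cvec (E 0)) (\<lambda>i. cvec (E (Suc i))) = (\<lambda>k. cvec (E k))"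
    by (auto simp: fun_eq_iff split: nat.split)
  then have "vol (cvec (E 0)) (\<lambda>i. cvec (E (Suc i))) = det (\<chi> r. cvec (E (index_7 r)))"
    by (simp add: vol_def)
  also have "\<dots> = of_real (det (\<chi> r i. E (index_7 r) $ i))"
    unfolding cvec_def by (rule det_of_real)
  finally have v: "vol (cvec (E 0)) (\<lambda>i. cvec (E (Suc i))) = of_real (det (\<chi> r i. E (index_7 r) $ i))" .
  have "index_7 r < 7" "index_7 r = index_7 s \<longleftrightarrow> r = s" for r s
    using bij_index_7 by (auto simp: bij_betw_def inj_on_def)
  then have "(\<chi> r i. E (index_7 r) $ i) ** transpose (\<chi> r i. E (index_7 r) $ i) = mat 1"
    using orthonormal_inner[OF E]
    by (simp add: matrix_matrix_mult_def transpose_def vec_eq_iff mat_def inner_vec_def)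
  then have "orthogonal_matrix (transpose (\<chi> r i. E (index_7 r) $ i))"
    by (simp add: orthogonal_matrix)
  then have "\<bar>det (\<chi> r i. E (index_7 r) $ i)\<bar> = 1"
    using det_orthogonal_matrix by fastforce
  then show ?thesis unfolding v by simp
qed

text \<open>The first two rows arise from e_0 and e_1 by a matrix of determinant a^2 + b^2 = 1, and
  the other rows are the same. So the value is constant along a complex great circle.\<close>

lemma vol_quadric_frame:
  fixes E :: "nat \<Rightarrow> real^7"
  assumes ab: "a\<^sup>2 + b\<^sup>2 = 1"
  shows "vol (a *s cvec (E 0) + b *s cvec (E 1)) (quadric_frame a b E) =
    vol (cvec (E 0)) (\<lambda>i. cvec (E (Suc i)))"
proof -
  define D :: "(nat \<Rightarrow> complex^7) \<Rightarrow> complex" where "D v = det (\<chi> r. v (index_7 r))" for v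
  have D: "complex_alternating 7 D"
    unfolding D_def[abs_def] by (rule complex_alternating_det[OF bij_index_7])
  define e where "e k = cvec (E k)" for k
  have z: "case_nat (a *s cvec (E 0) + b *s cvec (E 1)) (quadric_frame a b E) =
      (e(1 := (- b) *s e 0 + a *s e 1))(0 := a *s e 0 + b *s e 1)"
    by (auto simp: fun_eq_iff e_def quadric_frame_def split: nat.split)
  have z1: "case_nat (cvec (E 0)) (\<lambda>i. cvec (E (Suc i))) = e"
    by (auto simp: fun_eq_iff e_def split: nat.split)
  have l0: "D (v(0 := a *s x + b *s y)) = a * D (v(0 := x)) + b * D (v(0 := y))" for v x y
    by (rule complex_alternating_linear[OF D]) simp
  have l1: "D (e(1 := (- b) *s e 0 + a *s e 1, 0 := x)) = - b * D (e(1 := e 0, 0 := x)) + a * D (e(1 := e 1, 0 := x))" for x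
  proof -
    have tw: "e(1 := y, 0 := x) = e(0 := x, 1 := y)" for y by (auto simp: fun_eq_iff)
    show ?thesis unfolding tw by (rule complex_alternating_linear[OF D]) simp
  qed
  have same: "D (e(1 := x, 0 := x)) = 0" for x
    by (rule complex_alternating_eq_0[OF D, of 0 1]) auto
  have "e(1 := e 0, 0 := e 1) = e \<circ> Transposition.transpose 0 1"
    by (auto simp: fun_eq_iff Transposition.transpose_def)
  then have swap: "D (e(1 := e 0, 0 := e 1)) = - D e"
    using complex_alternating_transpose[OF D, of 0 1 e] by simp
  have id: "e(1 := e 1, 0 := e 0) = e" by simp
  have "D ((e(1 := (- b) *s e 0 + a *s e 1))(0 := a *s e 0 + b *s e 1)) = (a\<^sup>2 + b\<^sup>2) * D e"
    unfolding l0 l1 same swap id by (simp add: algebra_simps power2_eq_square)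
  then show ?thesis
    unfolding vol_def z z1 D_def ab by simp
qed

text \<open>Re z and Im z are orthogonal with |Re z|^2 - |Im z|^2 = 1; normalising them gives the
  first two frame vectors. If Im z = 0, only the first is prescribed and S = 0.\<close>

lemma quadric_decompose:
  fixes z :: "complex^7"
  assumes z: "z \<in> quadric"
  obtains E C S where "orthonormal 7 E" "C > 0" "C\<^sup>2 - S\<^sup>2 = 1"
    "z = of_real C *s cvec (E 0) + (\<i> * of_real S) *s cvec (E 1)"
proof -
  define R J :: "real^7" where "R = (\<chi> i. Re (z $ i))" and "J = (\<chi> i. Im (z $ i))"
  have R: "(norm R)\<^sup>2 - (norm J)\<^sup>2 = 1" "R \<bullet> J = 0"
    using quadric_Re_Im(1,2)[OF z] unfolding power2_norm_eq_inner
    by (simp_all add: inner_vec_def power2_eq_square R_def J_def)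
  have "R \<noteq> 0"
  proof
    assume "R = 0"
    then have "- (norm J)\<^sup>2 = 1" using R(1) by simp
    then show False using zero_le_power2[of "norm J"] by linarith
  qed
  then have R0: "norm R > 0" by simp
  let ?k = "if J = 0 then 1 else 2 :: nat"
  let ?E = "\<lambda>i::nat. if i = 0 then R /\<^sub>R norm R else J /\<^sub>R norm J"
  have on: "orthonormal ?k ?E"
    using R(2) R0 by (auto simp: orthonormal_def less_Suc_eq numeral_2_eq_2 inner_commute
        power2_norm_eq_inner[symmetric] power2_eq_square inverse_norm_square)
  have k: "?k \<le> DIM(real^7)" and DIM7: "DIM(real^7) = 7" by simp_all
  obtain E where E: "orthonormal 7 E" "\<forall>i<?k. E i = ?E i"
    using orthonormal_extend[OF on k] unfolding DIM7 by blast
  show ?thesis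
  proof (rule that[OF E(1) R0 R(1)])
    have e: "R = norm R *\<^sub>R E 0" "J = norm J *\<^sub>R E 1"
      using E(2) R0 by (auto split: if_splits)
    have "Re (z $ i) = norm R * E 0 $ i" "Im (z $ i) = norm J * E 1 $ i" for i
      using arg_cong[OF e(1), of "\<lambda>v. v $ i"] arg_cong[OF e(2), of "\<lambda>v. v $ i"]
      by (simp_all add: R_def J_def)
    then show "z = of_real (norm R) *s cvec (E 0) + (\<i> * of_real (norm J)) *s cvec (E 1)"
      by (simp add: vec_eq_iff complex_eq_iff cvec_def)
  qed
qed


section \<open>The holomorphic volume form\<close>

text \<open>The squared lengths of the frame vectors in the Stenzel metric, for r = rsq z. The
  vector of index 0 is the only one that can fail to be Hermitian orthogonal to z: its Hermitian
  square is r, and its product with z has squared modulus 4 C^2 S^2 = r^2 - 1.\<close>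

definition frame_weight :: "(real \<Rightarrow> real) \<Rightarrow> real \<Rightarrow> nat \<Rightarrow> real" where
  "frame_weight u r i = (if i = 0 then 2 * (deriv (deriv u) r * (r\<^sup>2 - 1) + r * deriv u r) else 2 * deriv u r)"

lemma prod_frame_weight:
  assumes "stenzel_potential TYPE(7) \<kappa> u" "1 \<le> r"
  shows "(\<Prod>i<6. frame_weight u r i) = 64 * \<kappa>"
  using stenzel_potential_ode[OF assms]
  by (simp add: frame_weight_def eval_nat_numeral algebra_simps)

lemma hermitian_quadric_frame:
  assumes E: "orthonormal 7 E" and CS: "C\<^sup>2 - S\<^sup>2 = 1"
    and z: "z = of_real C *s cvec (E 0) + (\<i> * of_real S) *s cvec (E 1)"
    and ij: "i < 6" "j < 6"
  shows "2 * hermitian u z (quadric_frame (of_real C) (\<i> * of_real S) E i) (quadric_frame (of_real C) (\<i> * of_real S) E j) =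
    (if i = j then of_real (frame_weight u (rsq z) i) else 0)"
proof -
  have "of_real (rsq z) = (of_real (C\<^sup>2 + S\<^sup>2) :: complex)"
    unfolding rsq_cdot z by (simp add: orthonormal_inner[OF E] power2_eq_square algebra_simps)
  then have r: "rsq z = C\<^sup>2 + S\<^sup>2" using of_real_eq_iff by blast
  have "(C\<^sup>2 + S\<^sup>2)\<^sup>2 - 1 = (C\<^sup>2 + S\<^sup>2)\<^sup>2 - (C\<^sup>2 - S\<^sup>2)\<^sup>2" by (simp add: CS)
  also have "\<dots> = 4 * C\<^sup>2 * S\<^sup>2" by (simp add: power2_eq_square algebra_simps)
  finally have r2: "(rsq z)\<^sup>2 - 1 = 4 * C\<^sup>2 * S\<^sup>2" using r by simp
  have zf: "cdot (vcnj z) (quadric_frame (of_real C) (\<i> * of_real S) E i) =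
      (if i = 0 then - 2 * \<i> * of_real (C * S) else 0)" if "i < 6" for i
    unfolding z using that by (auto simp: quadric_frame_def orthonormal_inner[OF E] algebra_simps)
  have ff: "cdot (quadric_frame (of_real C) (\<i> * of_real S) E i) (vcnj (quadric_frame (of_real C) (\<i> * of_real S) E j)) =
      (if i = j then if i = 0 then of_real (rsq z) else 1 else 0)"
    unfolding r using ij by (auto simp: quadric_frame_def orthonormal_inner[OF E] algebra_simps power2_eq_square)
  show ?thesis
    unfolding hermitian_cdot zf[OF ij(1)] zf[OF ij(2)] ff frame_weight_def r2
    by (auto simp: algebra_simps power2_eq_square)
qed

lemma stenzel_potential_kappa: "stenzel_potential TYPE('m::finite) \<kappa> u \<Longrightarrow> \<kappa> > 0"
  unfolding stenzel_potential_def Let_def by blast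

text \<open>Evaluates the normalisation of \<Omega> on the real basis f_0, i f_0, ..., f_5, i f_5:
  the power of the Stenzel form gives the product 64 \<kappa> of the weights, the other side has
  modulus (1/2)^6 2^6 |\<alpha>(f)|^2. The ambient form \<alpha> stands in for
  \<open>\<Omega> z\<close>, which is prescribed on tangent vectors only.\<close>

lemma calabi_yau_norm_frame:
  fixes \<Omega> :: "complex^7 \<Rightarrow> (complex^7) form" and E :: "nat \<Rightarrow> real^7"
  assumes cy: "stenzel_calabi_yau \<kappa> u \<Omega>"
    and E: "orthonormal 7 E" and CS: "C\<^sup>2 - S\<^sup>2 = 1"
    and z: "z = of_real C *s cvec (E 0) + (\<i> * of_real S) *s cvec (E 1)"
    and \<alpha>: "complex_alternating 6 \<alpha>" "\<And>v. (\<forall>i<6. v i \<in> quadric_tangent z) \<Longrightarrow> \<Omega> z v = \<alpha> v"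
  shows "(norm (\<alpha> (quadric_frame (of_real C) (\<i> * of_real S) E)))\<^sup>2 = 64 * \<kappa>"
proof -
  let ?f = "quadric_frame (of_real C) (\<i> * of_real S) E"
  have pot: "stenzel_potential TYPE(7) \<kappa> u" using cy by (simp add: stenzel_calabi_yau_def)
  have ab: "(of_real C)\<^sup>2 + (\<i> * of_real S)\<^sup>2 = (1 :: complex)"
    using CS by (simp add: power_mult_distrib flip: of_real_power of_real_diff)
  have zQ: "z \<in> quadric" unfolding z by (rule quadric_frame_quadric[OF E ab])
  note r1 = rsq_ge_1[OF zQ]
  note sm = stenzel_potential_smooth[OF pot]
  define v where "v k = (if even k then ?f (k div 2) else \<i> *s ?f (k div 2))" for k
  have tan: "v k \<in> quadric_tangent z" if "k < 12" for k
  proof -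
    have "?f (k div 2) \<in> quadric_tangent z"
      unfolding z using that by (intro quadric_frame_tangent[OF E]) simp
    then show ?thesis by (simp add: v_def quadric_tangent_cdot)
  qed
  let ?l = "\<lambda>a. complex_of_real (frame_weight u (rsq z) a)"
  have H: "hermitian u z (?f a) (?f b) = (if a = b then of_real (frame_weight u (rsq z) a / 2) else 0)"
    if "a < 6" "b < 6" for a b
    using hermitian_quadric_frame[OF E CS z that, of u] by (auto simp: field_simps)
  have "wedge_power 6 (\<lambda>w. stenzel_form u z (w 0) (w 1)) v = fact 6 * (\<Prod>a<6. ?l a)"
    by (rule wedge_power_symplectic)
      (auto simp: v_def stenzel_form_Im[OF sm r1] hermitian_scale_left hermitian_scale_right H)
  also have "(\<Prod>a<6. ?l a) = of_real (64 * \<kappa>)"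
    unfolding prod_frame_weight[OF pot r1, symmetric] by simp
  finally have W: "wedge_power 6 (\<lambda>w. stenzel_form u z (w 0) (w 1)) v = fact 6 * of_real (64 * \<kappa>)" .
  have "wedge 6 6 (\<Omega> z) (\<lambda>w. cnj (\<Omega> z w)) v = wedge 6 6 \<alpha> (\<lambda>w. cnj (\<alpha> w)) v"
    unfolding wedge_def
  proof (intro arg_cong2[of _ _ _ _ "(/)"] sum.cong refl)
    fix \<sigma> :: "nat \<Rightarrow> nat" assume "\<sigma> \<in> {\<sigma>. \<sigma> permutes {..<6 + 6}}"
    then have \<sigma>: "\<sigma> i < 12" if "i < 12" for i using permutes_in_image[of \<sigma> "{..<12}" i] that by simp
    have "\<Omega> z (\<lambda>i. v (\<sigma> i)) = \<alpha> (\<lambda>i. v (\<sigma> i))" "\<Omega> z (\<lambda>i. v (\<sigma> (6 + i))) = \<alpha> (\<lambda>i. v (\<sigma> (6 + i)))"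
      by (intro \<alpha>(2) allI impI tan \<sigma>; simp)+
    then show "of_int (sign \<sigma>) * \<Omega> z (\<lambda>i. v (\<sigma> i)) * cnj (\<Omega> z (\<lambda>i. v (\<sigma> (6 + i)))) =
        of_int (sign \<sigma>) * \<alpha> (\<lambda>i. v (\<sigma> i)) * cnj (\<alpha> (\<lambda>i. v (\<sigma> (6 + i))))" by simp
  qed
  moreover have "norm (wedge 6 6 \<alpha> (\<lambda>w. cnj (\<alpha> w)) v) = 2 ^ 6 * (norm (\<alpha> ?f))\<^sup>2"
    by (rule norm_wedge_cnj[where 'N = 12, OF \<alpha>(1)]) (auto simp: v_def)
  ultimately have N: "norm (wedge 6 6 (\<Omega> z) (\<lambda>w. cnj (\<Omega> z w)) v) = 64 * (norm (\<alpha> ?f))\<^sup>2" by simp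
  have "wedge_power 6 (\<lambda>w. stenzel_form u z (w 0) (w 1)) v / fact 6 =
      (- 1) ^ (6 * 5 div 2) * (\<i> / 2) ^ 6 * wedge 6 6 (\<Omega> z) (\<lambda>w. cnj (\<Omega> z w)) v"
    using cy zQ tan unfolding stenzel_calabi_yau_def by simp
  then have "of_real (64 * \<kappa>) = (- 1) ^ (6 * 5 div 2) * (\<i> / 2) ^ 6 * wedge 6 6 (\<Omega> z) (\<lambda>w. cnj (\<Omega> z w)) v"
    unfolding W by (simp del: of_real_mult)
  then have "norm (complex_of_real (64 * \<kappa>)) = norm ((- 1) ^ (6 * 5 div 2) * (\<i> / 2) ^ 6 * wedge 6 6 (\<Omega> z) (\<lambda>w. cnj (\<Omega> z w)) v)"
    by simp
  then show ?thesis
    using stenzel_potential_kappa[OF pot] unfolding norm_mult norm_power norm_of_real N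
    by (simp add: norm_divide power_divide)
qed

text \<open>Both forms have top degree on the six-dimensional tangent space, so each is the same
  determinant times its value on the adapted frame, where \<Omega>_0 has modulus 1.\<close>

lemma calabi_yau_ratio:
  fixes \<Omega> :: "complex^7 \<Rightarrow> (complex^7) form"
  assumes cy: "stenzel_calabi_yau \<kappa> u \<Omega>" and zQ: "z \<in> quadric"
  obtains h where "(norm h)\<^sup>2 = 64 * \<kappa>"
    "\<And>t. (\<forall>i<6. t i \<in> quadric_tangent z) \<Longrightarrow> \<Omega> z t = h * vol z t"
proof -
  obtain E C S where E: "orthonormal 7 E" "C > 0" "C\<^sup>2 - S\<^sup>2 = 1"
    and z: "z = of_real C *s cvec (E 0) + (\<i> * of_real S) *s cvec (E 1)"
    by (rule quadric_decompose[OF zQ])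
  have ab: "(of_real C)\<^sup>2 + (\<i> * of_real S)\<^sup>2 = (1 :: complex)"
    using E(3) by (simp add: power_mult_distrib flip: of_real_power of_real_diff)
  obtain \<alpha> where \<alpha>: "complex_alternating 6 \<alpha>" "\<And>v. (\<forall>i<6. v i \<in> quadric_tangent z) \<Longrightarrow> \<Omega> z v = \<alpha> v"
  proof -
    have "holomorphic_volume_form \<Omega>" using cy by (simp add: stenzel_calabi_yau_def)
    then obtain G \<Omega>' where "z \<in> G" "\<forall>z\<in>G. complex_alternating 6 (\<Omega>' z)"
      "\<forall>z\<in>G \<inter> quadric. \<forall>v. (\<forall>i<6. v i \<in> quadric_tangent z) \<longrightarrow> \<Omega> z v = \<Omega>' z v"
      using zQ unfolding holomorphic_volume_form_def by force
    then show ?thesis using that[of "\<Omega>' z"] zQ by blast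
  qed
  let ?f = "quadric_frame (of_real C) (\<i> * of_real S) E"
  have n: "(norm (\<alpha> ?f))\<^sup>2 = 64 * \<kappa>"
    by (rule calabi_yau_norm_frame[OF cy E(1,3) z \<alpha>])
  have v: "norm (vol z ?f) = 1"
    unfolding z vol_quadric_frame[OF ab] by (rule vol_orthonormal[OF E(1)])
  show ?thesis
  proof (rule that[of "\<alpha> ?f / vol z ?f"])
    show "(norm (\<alpha> ?f / vol z ?f))\<^sup>2 = 64 * \<kappa>" using n v by (simp add: norm_divide)
    fix t :: "nat \<Rightarrow> complex^7" assume t: "\<forall>i<6. t i \<in> quadric_tangent z"
    have "\<forall>i\<in>{..<6}. \<exists>B. t i = (\<Sum>j<6. B j *s ?f j)"
      using quadric_frame_expand[OF E(1) ab] t z by blast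
    then obtain B where B: "\<And>i. i < 6 \<Longrightarrow> t i = (\<Sum>j<6. B i j *s ?f j)"
      unfolding bchoice_iff by blast
    have "\<alpha> t = ndet 6 B * \<alpha> ?f" "vol z t = ndet 6 B * vol z ?f"
      by (rule complex_alternating_ndet[OF \<alpha>(1)], rule B, assumption)
        (rule complex_alternating_ndet[OF complex_alternating_vol], rule B, assumption)
    then show "\<Omega> z t = \<alpha> ?f / vol z ?f * vol z t"
      using \<alpha>(2)[OF t] v by auto
  qed
qed

text \<open>On the complex great circles \<open>cos(\<zeta>)x + sin(\<zeta>)y\<close> the ratio is entire, and it is bounded by the
  preceding lemma.\<close>

lemma calabi_yau_great_circle:
  fixes \<Omega> :: "complex^7 \<Rightarrow> (complex^7) form" and E :: "nat \<Rightarrow> real^7"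
  assumes cy: "stenzel_calabi_yau \<kappa> u \<Omega>" and E: "orthonormal 7 E"
    and h: "\<And>z t. z \<in> quadric \<Longrightarrow> (\<forall>i<6. t i \<in> quadric_tangent z) \<Longrightarrow> \<Omega> z t = h z * vol z t"
    and nh: "\<And>z. z \<in> quadric \<Longrightarrow> (norm (h z))\<^sup>2 = 64 * \<kappa>"
  shows "h (cos \<zeta> *s cvec (E 0) + sin \<zeta> *s cvec (E 1)) = h (cvec (E 0))"
proof -
  define \<gamma> where "\<gamma> \<zeta> = cos \<zeta> *s cvec (E 0) + sin \<zeta> *s cvec (E 1)" for \<zeta> :: complex
  define f where "f \<zeta> = quadric_frame (cos \<zeta>) (sin \<zeta>) E" for \<zeta> :: complex
  have ab: "(cos \<zeta>)\<^sup>2 + (sin \<zeta>)\<^sup>2 = 1" for \<zeta> :: complex by (simp add: add.commute)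
  have \<gamma>Q: "\<gamma> \<zeta> \<in> quadric" for \<zeta> unfolding \<gamma>_def by (rule quadric_frame_quadric[OF E ab])
  have ft: "\<forall>i<6. f \<zeta> i \<in> quadric_tangent (\<gamma> \<zeta>)" for \<zeta>
    unfolding f_def \<gamma>_def using quadric_frame_tangent[OF E] by blast
  let ?V = "vol (cvec (E 0)) (\<lambda>i. cvec (E (Suc i)))"
  have V: "vol (\<gamma> \<zeta>) (f \<zeta>) = ?V" for \<zeta> unfolding \<gamma>_def f_def by (rule vol_quadric_frame[OF ab])
  have V1: "norm ?V = 1" by (rule vol_orthonormal[OF E])
  have eq: "\<Omega> (\<gamma> \<zeta>) (f \<zeta>) = h (\<gamma> \<zeta>) * ?V" for \<zeta> using h[OF \<gamma>Q ft] V by simp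
  have \<gamma>': "(\<gamma> has_derivative (\<lambda>x. x *s ((- sin \<zeta>) *s cvec (E 0) + cos \<zeta> *s cvec (E 1)))) (at \<zeta>)" for \<zeta>
  proof -
    have lin: "bounded_linear (\<lambda>s::complex. s *s c)" for c :: "complex^7"
      by (intro linear_conv_bounded_linear[THEN iffD1] linearI) (auto simp: vec_eq_iff algebra_simps)
    have "(cos has_derivative (*) (- sin \<zeta>)) (at \<zeta>)" "(sin has_derivative (*) (cos \<zeta>)) (at \<zeta>)"
      using DERIV_cos[of \<zeta>] DERIV_sin[of \<zeta>] by (simp_all add: has_field_derivative_def)
    from has_derivative_add[OF bounded_linear.has_derivative[OF lin this(1)] bounded_linear.has_derivative[OF lin this(2)]]
    show ?thesis
      unfolding \<gamma>_def by (rule has_derivative_eq_rhs) (auto simp: vec_eq_iff algebra_simps)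
  qed
  have "(\<lambda>\<zeta>. \<Omega> (\<gamma> \<zeta>) (f \<zeta>)) field_differentiable (at \<zeta>0)" for \<zeta>0
  proof -
    have "holomorphic_volume_form \<Omega>" using cy by (simp add: stenzel_calabi_yau_def)
    then obtain G \<Omega>' where G: "open G" "\<gamma> \<zeta>0 \<in> G" and alt: "\<forall>z\<in>G. complex_alternating 6 (\<Omega>' z)"
      and hol: "\<forall>v. holomorphic_several G (\<lambda>z. \<Omega>' z v)"
      and \<Omega>': "\<forall>z\<in>G \<inter> quadric. \<forall>v. (\<forall>i<6. v i \<in> quadric_tangent z) \<longrightarrow> \<Omega> z v = \<Omega>' z v"
      using \<gamma>Q[of \<zeta>0] unfolding holomorphic_volume_form_def by force
    \<comment> \<open>Holomorphy is available for fixed arguments only. Of the frame only slot 0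
      depends on \<zeta>, so linearity in this slot reduces everything to the two constant argument
      lists with e_0 or e_1 in it.\<close>
    let ?w = "\<lambda>x i. if i = 0 then x else cvec (E (Suc i))"
    have w: "(?w 0)(0 := x) = ?w x" for x by (auto simp: fun_eq_iff)
    have diff: "(\<lambda>\<zeta>. \<Omega>' (\<gamma> \<zeta>) v) field_differentiable (at \<zeta>0)" for v
    proof -
      obtain D where D: "((\<lambda>z. \<Omega>' z v) has_derivative D) (at (\<gamma> \<zeta>0))" "\<And>a v. D (a *s v) = a * D v"
        using hol G(2) unfolding holomorphic_several_def by blast
      have "((\<lambda>\<zeta>. \<Omega>' (\<gamma> \<zeta>) v) has_derivative
          (*) (D ((- sin \<zeta>0) *s cvec (E 0) + cos \<zeta>0 *s cvec (E 1)))) (at \<zeta>0)"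
        by (rule has_derivative_eq_rhs[OF has_derivative_compose[OF \<gamma>' D(1)]])
          (rule ext, subst D(2), rule mult.commute)
      then show ?thesis
        unfolding field_differentiable_def has_field_derivative_def by blast
    qed
    have "open (\<gamma> -` G)"
      using \<gamma>' by (intro open_vimage G continuous_at_imp_continuous_on ballI) (blast intro: has_derivative_continuous)
    moreover have "\<Omega> (\<gamma> \<zeta>) (f \<zeta>) = - sin \<zeta> * \<Omega>' (\<gamma> \<zeta>) (?w (cvec (E 0))) + cos \<zeta> * \<Omega>' (\<gamma> \<zeta>) (?w (cvec (E 1)))"
      if "\<zeta> \<in> \<gamma> -` G" for \<zeta>
    proof -
      have f: "f \<zeta> = (?w 0)(0 := (- sin \<zeta>) *s cvec (E 0) + cos \<zeta> *s cvec (E 1))"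
        by (auto simp: f_def quadric_frame_def fun_eq_iff)
      have "\<Omega> (\<gamma> \<zeta>) (f \<zeta>) = \<Omega>' (\<gamma> \<zeta>) (f \<zeta>)" using \<Omega>' that \<gamma>Q ft by blast
      also have "\<dots> = - sin \<zeta> * \<Omega>' (\<gamma> \<zeta>) ((?w 0)(0 := cvec (E 0))) + cos \<zeta> * \<Omega>' (\<gamma> \<zeta>) ((?w 0)(0 := cvec (E 1)))"
        unfolding f using alt that by (intro complex_alternating_linear[of 6]) auto
      finally show ?thesis unfolding w .
    qed
    moreover have "(\<lambda>\<zeta>. - sin \<zeta> * \<Omega>' (\<gamma> \<zeta>) (?w (cvec (E 0))) + cos \<zeta> * \<Omega>' (\<gamma> \<zeta>) (?w (cvec (E 1)))) field_differentiable (at \<zeta>0)"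
      by (intro field_differentiable_add field_differentiable_mult field_differentiable_minus diff
          field_differentiable_at_sin field_differentiable_at_cos)
    ultimately show ?thesis
      using G(2) unfolding field_differentiable_def
      by (elim exE) (rule exI, rule has_field_derivative_transform_within_open, assumption+, auto)
  qed
  then have "(\<lambda>\<zeta>. \<Omega> (\<gamma> \<zeta>) (f \<zeta>)) holomorphic_on UNIV"
    by (simp add: holomorphic_on_def)
  moreover have "bounded (range (\<lambda>\<zeta>. \<Omega> (\<gamma> \<zeta>) (f \<zeta>)))"
  proof (rule boundedI)
    fix x assume "x \<in> range (\<lambda>\<zeta>. \<Omega> (\<gamma> \<zeta>) (f \<zeta>))"
    then obtain \<zeta> where "x = h (\<gamma> \<zeta>) * ?V" using eq by auto
    then have "(norm x)\<^sup>2 = 64 * \<kappa>" using nh[OF \<gamma>Q] V1 by (simp add: norm_mult)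
    then show "norm x \<le> sqrt (64 * \<kappa>)" by (metis norm_ge_zero order_refl real_sqrt_unique)
  qed
  ultimately have "(\<lambda>\<zeta>. \<Omega> (\<gamma> \<zeta>) (f \<zeta>)) constant_on UNIV"
    by (rule Liouville_theorem)
  then obtain c where c: "\<And>\<zeta>. \<Omega> (\<gamma> \<zeta>) (f \<zeta>) = c"
    by (auto simp: constant_on_def)
  have "h (\<gamma> \<zeta>) * ?V = h (\<gamma> 0) * ?V" using c eq by metis
  then have "h (\<gamma> \<zeta>) = h (\<gamma> 0)" using V1 by auto
  then show ?thesis by (simp add: \<gamma>_def)
qed

lemma calabi_yau_constant:
  fixes \<Omega> :: "complex^7 \<Rightarrow> (complex^7) form"
  assumes cy: "stenzel_calabi_yau \<kappa> u \<Omega>"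
  obtains h where "(norm h)\<^sup>2 = 64 * \<kappa>"
    "\<And>z t. z \<in> quadric \<Longrightarrow> (\<forall>i<6. t i \<in> quadric_tangent z) \<Longrightarrow> \<Omega> z t = h * vol z t"
proof -
  have "\<forall>z\<in>quadric. \<exists>h. (norm h)\<^sup>2 = 64 * \<kappa> \<and> (\<forall>t. (\<forall>i<6. t i \<in> quadric_tangent z) \<longrightarrow> \<Omega> z t = h * vol z t)"
    using calabi_yau_ratio[OF cy] by metis
  then obtain h where nh: "\<And>z. z \<in> quadric \<Longrightarrow> (norm (h z))\<^sup>2 = 64 * \<kappa>"
    and h: "\<And>z t. z \<in> quadric \<Longrightarrow> (\<forall>i<6. t i \<in> quadric_tangent z) \<Longrightarrow> \<Omega> z t = h z * vol z t"
    unfolding bchoice_iff by blast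
  note gc = calabi_yau_great_circle[OF cy _ h nh]
  \<comment> \<open>Two real unit vectors lie on a common great circle, here with a real parameter;
    \<open>w\<close> is the part of \<open>y\<close> orthogonal to \<open>x\<close>. If it vanishes,
    the second frame vector is arbitrary.\<close>
  have 1: "h (cvec y) = h (cvec x)" if "norm x = 1" "norm y = 1" for x y :: "real^7"
  proof -
    define w where "w = y - (x \<bullet> y) *\<^sub>R x"
    let ?k = "if w = 0 then 1 else 2 :: nat"
    let ?E = "\<lambda>i::nat. if i = 0 then x else w /\<^sub>R norm w"
    have xx: "x \<bullet> x = 1" using that by (simp add: norm_eq_1)
    then have xw: "x \<bullet> w = 0" by (simp add: w_def inner_diff_right)
    have "orthonormal ?k ?E"
      using xx xw by (auto simp: orthonormal_def less_Suc_eq numeral_2_eq_2 inner_commute[of _ x]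
        power2_norm_eq_inner[symmetric] power2_eq_square inverse_norm_square
        simp del: inner_diff_right inner_diff_left)
    then have on: "orthonormal ?k ?E" .
    have k: "?k \<le> DIM(real^7)" and DIM7: "DIM(real^7) = 7" by simp_all
    obtain E where E: "orthonormal 7 E" "\<forall>i<?k. E i = ?E i"
      using orthonormal_extend[OF on k] unfolding DIM7 by blast
    have E0: "E 0 = x" using E(2) by (auto split: if_splits)
    have wE: "w = norm w *\<^sub>R E 1" using E(2) by (cases "w = 0") auto
    have yw: "y = (x \<bullet> y) *\<^sub>R x + w" by (simp add: w_def)
    have "1 = y \<bullet> y" using that by (simp add: norm_eq_1)
    also have "\<dots> = ((x \<bullet> y) *\<^sub>R x + w) \<bullet> ((x \<bullet> y) *\<^sub>R x + w)"
      unfolding yw[symmetric] ..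
    also have "\<dots> = (x \<bullet> y)\<^sup>2 + (norm w)\<^sup>2"
      using xx xw unfolding inner_add_left inner_add_right power2_norm_eq_inner
      by (simp add: inner_commute[of w x] power2_eq_square)
    finally obtain s where s: "x \<bullet> y = cos s" "norm w = sin s"
      using sincos_total_2pi[of "x \<bullet> y" "norm w"] by metis
    have "y = (x \<bullet> y) *\<^sub>R x + norm w *\<^sub>R E 1"
      using yw wE by simp
    then have "y = cos s *\<^sub>R E 0 + sin s *\<^sub>R E 1"
      unfolding s(2) unfolding s(1) E0 .
    then have "cvec y = cos (of_real s) *s cvec (E 0) + sin (of_real s) *s cvec (E 1)"
      by (simp add: cvec_def vec_eq_iff cos_of_real sin_of_real)
    then show ?thesis using gc[OF E(1), of "of_real s"] E0 by simp
  qed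
  \<comment> \<open>At the imaginary parameter i t the cosine is cosh t and the sine is i sinh t, so
    a great circle through the real point e_0 reaches z = C e_0 + i S e_1 when S = sinh t.\<close>
  have 2: "h z = h (cvec (axis 1 1))" if zQ: "z \<in> quadric" for z
  proof -
    obtain E C S where E: "orthonormal 7 E" "C > 0" "C\<^sup>2 - S\<^sup>2 = 1"
      and z: "z = of_real C *s cvec (E 0) + (\<i> * of_real S) *s cvec (E 1)"
      by (rule quadric_decompose[OF zQ])
    have S: "S = sinh (arsinh S)" by simp
    have "C\<^sup>2 = (cosh (arsinh S))\<^sup>2" using E(3) by (simp add: cosh_square_eq)
    then have "C = cosh (arsinh S)" using E(2) by (simp add: power2_eq_iff_nonneg)
    moreover have co: "cosh (complex_of_real t) = of_real (cosh t)" for t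
      by (simp add: cosh_field_def exp_of_real[symmetric])
    moreover have si: "sin (\<i> * complex_of_real t) = \<i> * of_real (sinh t)" for t
    proof -
      have "sin (\<i> * complex_of_real t) = \<i> * sinh (complex_of_real t)"
        by (simp add: sinh_conv_sin)
      also have "sinh (complex_of_real t) = of_real (sinh t)"
        by (simp add: sinh_field_def exp_of_real[symmetric])
      finally show ?thesis .
    qed
    ultimately have "z = cos (\<i> * of_real (arsinh S)) *s cvec (E 0) + sin (\<i> * of_real (arsinh S)) *s cvec (E 1)"
      unfolding z cosh_conv_cos[symmetric] co si using S by simp
    then have "h z = h (cvec (E 0))" using gc[OF E(1)] by metis
    also have "\<dots> = h (cvec (axis 1 1))"
      by (rule 1) (use orthonormal_inner[OF E(1), of 0 0] in \<open>auto simp: norm_eq_1\<close>)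
    finally show ?thesis .
  qed
  have Q: "cvec (axis 1 1) \<in> (quadric :: (complex^7) set)"
    by (simp add: quadric_cdot)
  show ?thesis
    by (rule that[OF nh[OF Q]]) (use h 2 in metis)
qed

text \<open>On a Lagrangian family the values of \<open>hermitian\<close> are real, so the Gram
  matrix is B D times the adjoint of B, where B expands the family in the adapted frame and D is the
  diagonal matrix of weights. Its determinant is 64 \<kappa> |det B|^2, and |det B| is the modulus
  of \<open>vol\<close>.\<close>

lemma gram_vol:
  assumes pot: "stenzel_potential TYPE(7) \<kappa> u" and zQ: "z \<in> quadric"
    and t: "\<forall>i<6. t i \<in> quadric_tangent z"
    and lag: "\<And>i j. i < 6 \<Longrightarrow> j < 6 \<Longrightarrow> stenzel_form u z (t i) (t j) = 0"
  shows "det ((\<chi> r s. stenzel_metric u z (t (index_6 r)) (t (index_6 s))) :: real^6^6) = 64 * \<kappa> * (norm (vol z t))\<^sup>2"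
proof -
  obtain E C S where E: "orthonormal 7 E" "C > 0" "C\<^sup>2 - S\<^sup>2 = 1"
    and z: "z = of_real C *s cvec (E 0) + (\<i> * of_real S) *s cvec (E 1)"
    by (rule quadric_decompose[OF zQ])
  have ab: "(of_real C)\<^sup>2 + (\<i> * of_real S)\<^sup>2 = (1 :: complex)"
    using E(3) by (simp add: power_mult_distrib flip: of_real_power of_real_diff)
  let ?f = "quadric_frame (of_real C) (\<i> * of_real S) E"
  note r1 = rsq_ge_1[OF zQ]
  note sm = stenzel_potential_smooth[OF pot]
  have "\<forall>i\<in>{..<6}. \<exists>B. t i = (\<Sum>j<6. B j *s ?f j)"
    using quadric_frame_expand[OF E(1) ab] t z by blast
  then obtain B where B: "\<And>i. i < 6 \<Longrightarrow> t i = (\<Sum>j<6. B i j *s ?f j)"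
    unfolding bchoice_iff by blast
  have "vol z t = ndet 6 B * vol z ?f"
    by (rule complex_alternating_ndet[OF complex_alternating_vol B])
  moreover have "norm (vol z ?f) = 1"
    unfolding z vol_quadric_frame[OF ab] by (rule vol_orthonormal[OF E(1)])
  ultimately have nB: "norm (vol z t) = norm (ndet 6 B)" by (simp add: norm_mult)
  let ?B = "(\<chi> r s. B (index_6 r) (index_6 s)) :: complex^6^6"
  let ?m = "\<lambda>r. complex_of_real (frame_weight u (rsq z) (index_6 r))"
  have i6: "index_6 r < 6" for r using bij_index_6 by (auto simp: bij_betw_def)
  have g: "of_real (stenzel_metric u z (t i) (t j)) = (\<Sum>k<6. B i k * of_real (frame_weight u (rsq z) k) * cnj (B j k))"
    if ij: "i < 6" "j < 6" for i j
  proof -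
    have "Im (hermitian u z (t i) (t j)) = 0"
      using lag[OF ij] by (simp add: stenzel_form_Im[OF sm r1])
    then have "of_real (stenzel_metric u z (t i) (t j)) = 2 * hermitian u z (t i) (t j)"
      by (simp add: stenzel_metric_eq[OF sm r1] complex_eq_iff)
    also have "\<dots> = (\<Sum>k<6. \<Sum>l<6. B i k * cnj (B j l) * (2 * hermitian u z (?f k) (?f l)))"
      unfolding B[OF ij(1)] B[OF ij(2)] hermitian_sum_left hermitian_sum_right
        hermitian_scale_left hermitian_scale_right sum_distrib_left
      by (subst sum.swap, intro sum.cong refl) (simp add: mult_ac)
    also have "\<dots> = (\<Sum>k<6. \<Sum>l<6. if k = l then B i k * cnj (B j l) * of_real (frame_weight u (rsq z) k) else 0)"
      by (intro sum.cong refl) (simp add: hermitian_quadric_frame[OF E(1,3) z])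
    also have "\<dots> = (\<Sum>k<6. B i k * of_real (frame_weight u (rsq z) k) * cnj (B j k))"
      by (intro sum.cong refl) (simp add: mult_ac)
    finally show ?thesis .
  qed
  let ?D = "(\<chi> k s. ?m k * cnj (B (index_6 s) (index_6 k))) :: complex^6^6"
  have "(\<chi> r s. of_real (stenzel_metric u z (t (index_6 r)) (t (index_6 s)))) = ?B ** ?D"
    by (simp add: vec_eq_iff matrix_matrix_mult_def g i6 mult.assoc, intro allI,
        rule sum.reindex_bij_betw[OF bij_index_6, symmetric])
  then have "of_real (det ((\<chi> r s. stenzel_metric u z (t (index_6 r)) (t (index_6 s))) :: real^6^6)) = det ?B * det ?D"
    unfolding det_of_real[symmetric] by (simp add: det_mul)
  also have "det ?D = (\<Prod>r\<in>UNIV. ?m r) * det ((\<chi> k s. cnj (B (index_6 s) (index_6 k))) :: complex^6^6)"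
    using det_rows_mul[of ?m "\<lambda>k. \<chi> s. cnj (B (index_6 s) (index_6 k))"]
    by (simp add: vector_scalar_mult_def)
  also have "det ((\<chi> k s. cnj (B (index_6 s) (index_6 k))) :: complex^6^6) = cnj (det ?B)"
    using det_transpose[of "(\<chi> s k. cnj (B (index_6 s) (index_6 k))) :: complex^6^6"]
    by (simp add: transpose_def) (simp add: det_def)
  also have "(\<Prod>r\<in>UNIV. ?m r) = of_real (64 * \<kappa>)"
    unfolding prod_frame_weight[OF pot r1, symmetric]
    by (simp add: prod.reindex_bij_betw[OF bij_index_6, of "\<lambda>i. complex_of_real (frame_weight u (rsq z) i)"])
  also have "det ?B = ndet 6 B" by (rule ndet_eq_det[OF bij_index_6, symmetric])
  also have "ndet 6 B * (of_real (64 * \<kappa>) * cnj (ndet 6 B)) = of_real (64 * \<kappa> * (norm (ndet 6 B))\<^sup>2)"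
    by (simp add: complex_norm_square[symmetric] mult_ac del: of_real_power)
  finally show ?thesis unfolding nB using of_real_eq_iff by blast
qed


section \<open>Special Lagrangian charts\<close>

lemma local_parametrization_D:
  assumes "local_parametrization W \<phi> N"
  shows "open W" "smooth_on W \<phi>" "\<And>x. x \<in> W \<Longrightarrow> inj (frechet_derivative \<phi> (at x))" "\<phi> ` W \<subseteq> N"
    "\<And>x. x \<in> W \<Longrightarrow> (\<phi> has_derivative frechet_derivative \<phi> (at x)) (at x)"
  using assms smooth_on_has_derivative unfolding local_parametrization_def by blast+

text \<open>The continuous inverse turns an open subset of the domain into a relatively open subset
  of the image.\<close>

lemma local_parametrization_subset:
  assumes lp: "local_parametrization W \<phi> N" and W': "open W'" "W' \<subseteq> W"
  shows "local_parametrization W' \<phi> N"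
proof -
  obtain G \<psi> where G: "open G" "\<phi> ` W = N \<inter> G" and \<psi>: "homeomorphism W (\<phi> ` W) \<phi> \<psi>"
    using lp unfolding local_parametrization_def by blast
  have c: "continuous_on (\<phi> ` W) \<psi>" and inv: "\<And>x. x \<in> W \<Longrightarrow> \<psi> (\<phi> x) = x"
    using \<psi> unfolding homeomorphism_def by auto
  obtain G' where G': "open G'" "G' \<inter> \<phi> ` W = \<psi> -` W' \<inter> \<phi> ` W"
    using c[unfolded continuous_on_open_invariant, rule_format, OF W'(1)] by blast
  have "\<psi> -` W' \<inter> \<phi> ` W = \<phi> ` W'" using inv W'(2) by fastforce
  then have "\<phi> ` W' = N \<inter> (G \<inter> G')" using G' G(2) by auto
  moreover have "homeomorphism W' (\<phi> ` W') \<phi> \<psi>"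
    by (rule homeomorphism_of_subsets[OF \<psi> W'(2) order_refl refl])
  moreover have "smooth_on W' \<phi>"
    using local_parametrization_D(2)[OF lp] Ck_on_subset[OF _ W'(2)] unfolding smooth_on_def by blast
  ultimately show ?thesis
    using W' G(1) G'(1) local_parametrization_D(3)[OF lp] unfolding local_parametrization_def by blast
qed

lemma local_parametrization_Int:
  assumes lp: "local_parametrization W \<phi> N" and G: "open G"
  shows "local_parametrization (W \<inter> \<phi> -` G) \<phi> (N \<inter> G)"
proof -
  have cont: "continuous_on W \<phi>"
    using local_parametrization_D(2)[OF lp] unfolding smooth_on_def by (metis Ck_on.simps(1))
  have o: "open (W \<inter> \<phi> -` G)"
    using continuous_open_preimage[OF cont local_parametrization_D(1)[OF lp] G] .
  have lp': "local_parametrization (W \<inter> \<phi> -` G) \<phi> N"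
    by (rule local_parametrization_subset[OF lp o]) simp
  then obtain G' where "open G'" and G': "\<phi> ` (W \<inter> \<phi> -` G) = N \<inter> G'"
    unfolding local_parametrization_def by blast
  have "N \<inter> G' \<subseteq> G" unfolding G'[symmetric] by auto
  then have "\<phi> ` (W \<inter> \<phi> -` G) = (N \<inter> G) \<inter> G'" using G' by auto
  with \<open>open G'\<close> lp' show ?thesis unfolding local_parametrization_def by blast
qed

lemma local_parametrization_tangent:
  fixes \<phi> :: "real^'n \<Rightarrow> complex^'m"
  assumes lp: "local_parametrization W \<phi> N" and N: "N \<subseteq> quadric" and x: "x \<in> W"
  shows "frechet_derivative \<phi> (at x) v \<in> quadric_tangent (\<phi> x)"
proof -
  let ?D = "frechet_derivative \<phi> (at x)"
  have D: "((\<lambda>x. \<phi> x $ i) has_derivative (\<lambda>v. ?D v $ i)) (at x)" for i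
    by (rule bounded_linear.has_derivative[OF bounded_linear_vec_nth local_parametrization_D(5)[OF lp x]])
  have "((\<lambda>x. \<Sum>i\<in>UNIV. \<phi> x $ i * \<phi> x $ i) has_derivative
      (\<lambda>v. \<Sum>i\<in>UNIV. \<phi> x $ i * ?D v $ i + ?D v $ i * \<phi> x $ i)) (at x)"
    by (intro has_derivative_sum has_derivative_mult D)
  moreover have "((\<lambda>x. \<Sum>i\<in>UNIV. \<phi> x $ i * \<phi> x $ i) has_derivative (\<lambda>v. 0)) (at x)"
  proof (rule has_derivative_transform_within_open[OF has_derivative_const[of 1]])
    show "open W" "x \<in> W" by (rule local_parametrization_D(1)[OF lp], rule x)
    fix y assume "y \<in> W"
    then have "\<phi> y \<in> quadric" using local_parametrization_D(4)[OF lp] N by blast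
    then show "1 = (\<Sum>i\<in>UNIV. \<phi> y $ i * \<phi> y $ i)" by (simp add: quadric_cdot cdot_def)
  qed
  ultimately have "(\<lambda>v. \<Sum>i\<in>UNIV. \<phi> x $ i * ?D v $ i + ?D v $ i * \<phi> x $ i) = (\<lambda>v. 0)"
    by (rule has_derivative_unique)
  from fun_cong[OF this, of v] have "2 * (\<Sum>i\<in>UNIV. \<phi> x $ i * ?D v $ i) = 0"
    unfolding sum.distrib by (simp add: mult.commute)
  then show ?thesis by (simp add: quadric_tangent_def)
qed

text \<open>A chart is admissible if its tangent spaces are Lagrangian and \<open>\<Omega>\<^sub>0\<close> has constant phase on them, up to
  orientation.\<close>

definition admissible_chart ::
  "(real \<Rightarrow> real) \<Rightarrow> complex \<Rightarrow> (complex^7) set \<Rightarrow> (real^6) set \<Rightarrow> (real^6 \<Rightarrow> complex^7) \<Rightarrow> bool" where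
  "admissible_chart u \<epsilon> N W \<phi> \<longleftrightarrow> local_parametrization W \<phi> N \<and>
     (\<forall>x\<in>W. (\<forall>v w. stenzel_form u (\<phi> x) (frechet_derivative \<phi> (at x) v) (frechet_derivative \<phi> (at x) w) = 0) \<and>
        Im (vol (\<phi> x) (coord_frame \<phi> x) / \<epsilon>) = 0)"

lemma frame_volume_eq:
  assumes pot: "stenzel_potential TYPE(7) \<kappa> u" and N: "N \<subseteq> quadric" and ch: "admissible_chart u \<epsilon> N W \<phi>" and x: "x \<in> W"
  shows "frame_volume u \<phi> x = sqrt (64 * \<kappa>) * norm (vol (\<phi> x) (coord_frame \<phi> x))"
    "det ((\<chi> i j :: 6. stenzel_metric u (\<phi> x) (frechet_derivative \<phi> (at x) (axis i 1))
      (frechet_derivative \<phi> (at x) (axis j 1)))) = 64 * \<kappa> * (norm (vol (\<phi> x) (coord_frame \<phi> x)))\<^sup>2"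
proof -
  have lp: "local_parametrization W \<phi> N" using ch by (simp add: admissible_chart_def)
  have z: "\<phi> x \<in> quadric" using local_parametrization_D(4)[OF lp] N x by blast
  have "det ((\<chi> r s. stenzel_metric u (\<phi> x) (coord_frame \<phi> x (index_6 r)) (coord_frame \<phi> x (index_6 s))) :: real^6^6) =
      64 * \<kappa> * (norm (vol (\<phi> x) (coord_frame \<phi> x)))\<^sup>2"
    by (rule gram_vol[OF pot z])
      (use ch x local_parametrization_tangent[OF lp N x] in \<open>auto simp: coord_frame_def admissible_chart_def\<close>)
  then show "det ((\<chi> i j :: 6. stenzel_metric u (\<phi> x) (frechet_derivative \<phi> (at x) (axis i 1))
      (frechet_derivative \<phi> (at x) (axis j 1)))) = 64 * \<kappa> * (norm (vol (\<phi> x) (coord_frame \<phi> x)))\<^sup>2"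
    by (simp add: coord_frame_def)
  then show "frame_volume u \<phi> x = sqrt (64 * \<kappa>) * norm (vol (\<phi> x) (coord_frame \<phi> x))"
    unfolding frame_volume_def by (simp add: real_sqrt_mult)
qed

lemma stenzel_metric_sum_right:
  assumes "smooth_from_1 u" "1 \<le> rsq z"
  shows "stenzel_metric u z v (\<Sum>i\<in>I. c i *\<^sub>R w i) = (\<Sum>i\<in>I. c i * stenzel_metric u z v (w i))"
proof -
  have "c *\<^sub>R w = of_real c *s w" for c and w :: "complex^'a"
    unfolding vec_eq_iff vector_scaleR_component by (simp add: scaleR_conv_of_real)
  then show ?thesis
    by (simp add: stenzel_metric_eq[OF assms] hermitian_sum_right hermitian_scale_right sum_distrib_left mult_ac)
qed

lemma stenzel_metric_commute:
  assumes "smooth_from_1 u" "1 \<le> rsq z"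
  shows "stenzel_metric u z v w = stenzel_metric u z w v"
  unfolding stenzel_metric_eq[OF assms] using hermitian_cnj[of u z v w] by (metis complex_cnj(1) complex.sel(1) cnj.simps(1))

text \<open>If it vanished, so would the Gram determinant; a kernel vector of the Gram matrix yields
  a tangent vector of length zero, against positivity of the metric and injectivity of the
  derivative.\<close>

lemma vol_coord_frame_nonzero:
  assumes pot: "stenzel_potential TYPE(7) \<kappa> u" and N: "N \<subseteq> quadric" and ch: "admissible_chart u \<epsilon> N W \<phi>" and x: "x \<in> W"
  shows "vol (\<phi> x) (coord_frame \<phi> x) \<noteq> 0"
proof
  assume "vol (\<phi> x) (coord_frame \<phi> x) = 0"
  let ?D = "frechet_derivative \<phi> (at x)"
  let ?A = "(\<chi> i j. stenzel_metric u (\<phi> x) (?D (axis i 1)) (?D (axis j 1))) :: real^6^6"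
  have lp: "local_parametrization W \<phi> N" using ch by (simp add: admissible_chart_def)
  have z: "\<phi> x \<in> quadric" using local_parametrization_D(4)[OF lp] N x by blast
  note lin = has_derivative_linear[OF local_parametrization_D(5)[OF lp x]]
  note g = stenzel_potential_smooth[OF pot] rsq_ge_1[OF z]
  have "det ?A = 0" using frame_volume_eq(2)[OF pot N ch x] \<open>vol _ _ = 0\<close> by simp
  then obtain c where c: "c \<noteq> 0" "?A *v c = 0"
    using invertible_det_nz[of ?A] matrix_left_invertible_ker[of ?A] invertible_left_inverse[of ?A] by blast
  have "?D c = ?D (\<Sum>r\<in>UNIV. c $ r *\<^sub>R axis r 1)"
    using basis_expansion[of c] by (simp add: scalar_mult_eq_scaleR)
  also have "\<dots> = (\<Sum>r\<in>UNIV. c $ r *\<^sub>R ?D (axis r 1))"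
    by (simp add: linear_sum[OF lin] linear_scale[OF lin])
  finally have Dc: "?D c = (\<Sum>r\<in>UNIV. c $ r *\<^sub>R ?D (axis r 1))" .
  have "stenzel_metric u (\<phi> x) (?D (axis r 1)) (?D c) = (?A *v c) $ r" for r
    unfolding Dc stenzel_metric_sum_right[OF g] by (simp add: matrix_vector_mult_def mult.commute)
  then have "stenzel_metric u (\<phi> x) (?D c) (?D (axis r 1)) = 0" for r
    using c(2) stenzel_metric_commute[OF g] by simp
  then have "stenzel_metric u (\<phi> x) (?D c) (?D c) = 0"
    by (subst (2) Dc) (simp add: stenzel_metric_sum_right[OF g])
  then have "?D c = 0"
    using stenzel_metric_pos[OF pot z local_parametrization_tangent[OF lp N x], of c] by force
  then have "c = 0"
    using local_parametrization_D(3)[OF lp x] linear_0[OF lin] by (metis injD)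
  with c(1) show False by simp
qed

lemma continuous_on_vol_coord_frame:
  assumes lp: "local_parametrization W \<phi> N"
  shows "continuous_on W (\<lambda>x. vol (\<phi> x) (coord_frame \<phi> x))"
proof -
  note D = local_parametrization_D[OF lp]
  have 1: "continuous_on W \<phi>" using D(2) unfolding smooth_on_def by (metis Ck_on.simps(1))
  have 2: "continuous_on W (\<lambda>x. frechet_derivative \<phi> (at x) v)" for v
    using smooth_on_frechet_derivative[OF D(1,2)] unfolding smooth_on_def by (metis Ck_on.simps(1))
  have "continuous_on W (\<lambda>x. case_nat (\<phi> x) (coord_frame \<phi> x) k)" for k
    using 1 2 by (cases k) (auto simp: coord_frame_def intro!: continuous_intros)
  then show ?thesis
    unfolding vol_def det_def by (auto intro!: continuous_intros)
qed

text \<open>The coordinate 0 is the one in slot 0 of \<open>coord_frame\<close>, so precomposition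
  with this map flips the sign of \<Omega>_0 on the frame.\<close>

definition reflect :: "real^6 \<Rightarrow> real^6" where
  "reflect w = (\<chi> i. if i = 0 then - w $ i else w $ i)"

lemma reflect_reflect [simp]: "reflect (reflect w) = w"
  by (simp add: reflect_def vec_eq_iff)

lemma bounded_linear_reflect: "bounded_linear reflect"
  by (intro linear_conv_bounded_linear[THEN iffD1] linearI) (auto simp: reflect_def vec_eq_iff)

lemma frechet_derivative_reflect:
  assumes "local_parametrization W \<phi> N" "reflect x \<in> W"
  shows "frechet_derivative (\<lambda>x. \<phi> (reflect x)) (at x) = (\<lambda>v. frechet_derivative \<phi> (at (reflect x)) (reflect v))"
  by (rule frechet_derivative_at[symmetric])
    (rule has_derivative_compose[OF bounded_linear.has_derivative[OF bounded_linear_reflect has_derivative_ident]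
        local_parametrization_D(5)[OF assms]])

lemma local_parametrization_reflect:
  assumes lp: "local_parametrization W \<phi> N"
  shows "local_parametrization (reflect -` W) (\<lambda>x. \<phi> (reflect x)) N"
  unfolding local_parametrization_def
proof (intro conjI ballI)
  note D = local_parametrization_D[OF lp]
  have cr: "continuous_on S reflect" for S
    by (rule linear_continuous_on[OF bounded_linear_reflect])
  show "open (reflect -` W)"
    by (rule open_vimage[OF D(1) cr])
  show "smooth_on (reflect -` W) (\<lambda>x. \<phi> (reflect x))"
    using D(2) Ck_on_compose_linear[OF bounded_linear_reflect] unfolding smooth_on_def by blast
  show "inj (frechet_derivative (\<lambda>x. \<phi> (reflect x)) (at x))" if "x \<in> reflect -` W" for x
    using D(3)[of "reflect x"] that unfolding frechet_derivative_reflect[OF lp that[unfolded vimage_eq]]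
    by (metis (no_types, lifting) injD injI reflect_reflect vimageE)
  have "surj reflect" by (metis reflect_reflect surjI)
  then have rW: "reflect ` (reflect -` W) = W" by (rule surj_image_vimage_eq)
  have rW': "reflect ` W = reflect -` W"
    by (intro set_eqI) (metis image_iff reflect_reflect vimage_eq)
  have im: "(\<lambda>x. \<phi> (reflect x)) ` (reflect -` W) = \<phi> ` W"
    unfolding image_image[of \<phi> reflect, symmetric] rW ..
  then show "\<exists>G. open G \<and> (\<lambda>x. \<phi> (reflect x)) ` (reflect -` W) = N \<inter> G"
    using lp unfolding local_parametrization_def by simp
  obtain \<psi> where \<psi>: "homeomorphism W (\<phi> ` W) \<phi> \<psi>"
    using lp unfolding local_parametrization_def by blast
  have "homeomorphism (reflect -` W) W reflect reflect"
    unfolding homeomorphism_def using cr rW rW' by simp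
  from homeomorphism_compose[OF this \<psi>]
  show "\<exists>\<psi>. homeomorphism (reflect -` W) ((\<lambda>x. \<phi> (reflect x)) ` (reflect -` W)) (\<lambda>x. \<phi> (reflect x)) \<psi>"
    unfolding im comp_def by blast
qed

lemma vol_coord_frame_reflect:
  assumes lp: "local_parametrization W \<phi> N" and x: "reflect x \<in> W"
  shows "vol z (coord_frame (\<lambda>x. \<phi> (reflect x)) x) = - vol z (coord_frame \<phi> (reflect x))"
proof -
  let ?D = "frechet_derivative \<phi> (at (reflect x))"
  let ?t = "coord_frame \<phi> (reflect x)"
  have i0: "(of_nat i :: 6) = 0 \<longleftrightarrow> i = 0" if "i < 6" for i
    using bij_of_nat_6 that inj_onD[of "of_nat :: nat \<Rightarrow> 6" "{..<6}" i 0] by (auto simp: bij_betw_def)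
  have r: "reflect (axis j 1) = (if j = 0 then - axis j 1 else axis j 1)" for j
    by (auto simp: reflect_def axis_def vec_eq_iff)
  have "vol z (coord_frame (\<lambda>x. \<phi> (reflect x)) x) = vol z (?t(0 := (- 1) *s ?t 0))"
    by (rule complex_alternating_local[OF complex_alternating_vol])
      (auto simp: coord_frame_def frechet_derivative_reflect[OF lp x] r i0
        linear_neg[OF has_derivative_linear[OF local_parametrization_D(5)[OF lp x]]])
  also have "\<dots> = - 1 * vol z (?t(0 := ?t 0))"
    by (rule complex_alternating_scale[OF complex_alternating_vol]) simp
  finally show ?thesis by simp
qed

lemma admissible_chart_reflect:
  assumes ch: "admissible_chart u \<epsilon> N W \<phi>"
  shows "admissible_chart u \<epsilon> N (reflect -` W) (\<lambda>x. \<phi> (reflect x))"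
proof -
  have lp: "local_parametrization W \<phi> N" using ch by (simp add: admissible_chart_def)
  show ?thesis
    using ch local_parametrization_reflect[OF lp]
    by (auto simp: admissible_chart_def frechet_derivative_reflect[OF lp] vol_coord_frame_reflect[OF lp])
qed

lemma admissible_chart_subset:
  "admissible_chart u \<epsilon> N W \<phi> \<Longrightarrow> open W' \<Longrightarrow> W' \<subseteq> W \<Longrightarrow> admissible_chart u \<epsilon> N W' \<phi>"
  using local_parametrization_subset unfolding admissible_chart_def by blast

text \<open>Write \<Omega> = h \<Omega>_0. On a chart \<Omega>_0 takes the value \<epsilon> d with d
  real, continuous and nonzero, and the frame volume is |h| |d|. Where d > 0 the angle is Arg(h
  \<epsilon>); where d < 0 the chart is composed with \<open>reflect\<close>. Near each point d has
  one sign, so the same angle serves everywhere.\<close>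

lemma special_lagrangianI:
  fixes \<Omega> :: "complex^7 \<Rightarrow> (complex^7) form"
  assumes cy: "stenzel_calabi_yau \<kappa> u \<Omega>" and N: "N \<subseteq> quadric" and \<epsilon>: "norm \<epsilon> = 1"
    and charts: "\<And>p. p \<in> N \<Longrightarrow> \<exists>W \<phi>. admissible_chart u \<epsilon> N W \<phi> \<and> p \<in> \<phi> ` W"
  shows "special_lagrangian u \<Omega> N"
proof -
  have pot: "stenzel_potential TYPE(7) \<kappa> u" using cy by (simp add: stenzel_calabi_yau_def)
  obtain h where nh: "(norm h)\<^sup>2 = 64 * \<kappa>"
    and h: "\<And>z t. z \<in> quadric \<Longrightarrow> (\<forall>i<6. t i \<in> quadric_tangent z) \<Longrightarrow> \<Omega> z t = h * vol z t"
    using calabi_yau_constant[OF cy] by blast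
  have sq: "sqrt (64 * \<kappa>) = norm h" unfolding nh[symmetric] by simp
  define \<theta> where "\<theta> = Arg (h * \<epsilon>)"
  have \<theta>: "h * \<epsilon> = of_real (norm h) * cis \<theta>"
    using \<epsilon> by (cases "h * \<epsilon> = 0") (auto simp: \<theta>_def cis_Arg sgn_div_norm norm_mult scaleR_conv_of_real field_simps)
  have angle: "lagrangian_angle u \<Omega> W \<phi> (\<lambda>x. \<theta>)"
    if ch: "admissible_chart u \<epsilon> N W \<phi>" and pos: "\<And>x. x \<in> W \<Longrightarrow> Re (vol (\<phi> x) (coord_frame \<phi> x) / \<epsilon>) > 0" for W \<phi>
    unfolding lagrangian_angle_def
  proof
    fix x assume x: "x \<in> W"
    have lp: "local_parametrization W \<phi> N" using ch by (simp add: admissible_chart_def)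
    have z: "\<phi> x \<in> quadric" using local_parametrization_D(4)[OF lp] N x by blast
    define d where "d = Re (vol (\<phi> x) (coord_frame \<phi> x) / \<epsilon>)"
    have "vol (\<phi> x) (coord_frame \<phi> x) / \<epsilon> = of_real d"
      using ch x by (simp add: admissible_chart_def d_def complex_eq_iff)
    moreover have "\<epsilon> \<noteq> 0" using \<epsilon> by auto
    ultimately have v: "vol (\<phi> x) (coord_frame \<phi> x) = \<epsilon> * of_real d"
      by (simp add: nonzero_divide_eq_eq mult.commute)
    have "d > 0" using pos[OF x] by (simp add: d_def)
    then have "frame_volume u \<phi> x = norm h * d"
      unfolding frame_volume_eq(1)[OF pot N ch x] v sq using \<epsilon> by (simp add: norm_mult)
    moreover have "\<Omega> (\<phi> x) (coord_frame \<phi> x) = h * (\<epsilon> * of_real d)"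
      using h[OF z] local_parametrization_tangent[OF lp N x] v by (simp add: coord_frame_def)
    ultimately show "\<Omega> (\<phi> x) (coord_frame \<phi> x) = cis \<theta> * of_real (frame_volume u \<phi> x)"
      using \<theta> by (simp add: mult.assoc[symmetric])
  qed
  have "\<exists>W \<phi>. local_parametrization W \<phi> N \<and> p \<in> \<phi> ` W \<and> lagrangian_angle u \<Omega> W \<phi> (\<lambda>x. \<theta>)" if pN: "p \<in> N" for p
  proof -
    obtain W \<phi> x where ch: "admissible_chart u \<epsilon> N W \<phi>" and x: "x \<in> W" "p = \<phi> x"
      using charts[OF pN] by blast
    have lp: "local_parametrization W \<phi> N" using ch by (simp add: admissible_chart_def)
    let ?d = "\<lambda>x. Re (vol (\<phi> x) (coord_frame \<phi> x) / \<epsilon>)"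
    have c: "continuous_on W ?d"
      using \<epsilon> by (intro continuous_intros continuous_on_vol_coord_frame[OF lp]) auto
    have "vol (\<phi> x) (coord_frame \<phi> x) / \<epsilon> \<noteq> 0"
      using vol_coord_frame_nonzero[OF pot N ch x(1)] \<epsilon> by auto
    moreover have "Im (vol (\<phi> x) (coord_frame \<phi> x) / \<epsilon>) = 0"
      using ch x by (simp add: admissible_chart_def)
    ultimately have "?d x \<noteq> 0" by (simp add: complex_eq_iff)
    then consider "?d x > 0" | "?d x < 0" by linarith
    then show ?thesis
    proof cases
      case 1
      have "open (W \<inter> ?d -` {0<..})"
        by (rule continuous_open_preimage[OF c local_parametrization_D(1)[OF lp] open_greaterThan])
      then have ch': "admissible_chart u \<epsilon> N (W \<inter> ?d -` {0<..}) \<phi>"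
        by (rule admissible_chart_subset[OF ch]) simp
      have "lagrangian_angle u \<Omega> (W \<inter> ?d -` {0<..}) \<phi> (\<lambda>x. \<theta>)"
        by (rule angle[OF ch']) simp
      then show ?thesis using ch' x 1 unfolding admissible_chart_def by blast
    next
      case 2
      let ?W = "W \<inter> ?d -` {..<0}" and ?\<phi> = "\<lambda>x. \<phi> (reflect x)"
      have "open ?W"
        by (rule continuous_open_preimage[OF c local_parametrization_D(1)[OF lp] open_lessThan])
      then have "admissible_chart u \<epsilon> N ?W \<phi>"
        by (rule admissible_chart_subset[OF ch]) simp
      then have ch': "admissible_chart u \<epsilon> N (reflect -` ?W) ?\<phi>"
        by (rule admissible_chart_reflect)
      have "lagrangian_angle u \<Omega> (reflect -` ?W) ?\<phi> (\<lambda>x. \<theta>)"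
        by (rule angle[OF ch']) (auto simp: vol_coord_frame_reflect[OF lp])
      moreover have "p \<in> ?\<phi> ` (reflect -` ?W)"
        using x 2 by (intro image_eqI[of _ _ "reflect x"]) auto
      ultimately show ?thesis using ch' unfolding admissible_chart_def by blast
    qed
  qed
  moreover have "lagrangian u N"
    using charts N unfolding lagrangian_def admissible_chart_def by meson
  ultimately show ?thesis unfolding special_lagrangian_def by blast
qed


section \<open>Graph charts\<close>

lemma complex_vec_scaleR_nth: "(c *\<^sub>R v) $ i = of_real c * (v :: complex^'n) $ i"
  by (subst vector_scaleR_component) (simp add: scaleR_conv_of_real)

lemma sum_axis:
  "(\<Sum>j\<in>UNIV. c j *\<^sub>R axis j (k j) + d j *\<^sub>R axis j 1) =
    (\<chi> j. k j * of_real (c j) + of_real (d j) :: complex^'n)"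
proof -
  have "(c *\<^sub>R axis j x :: complex^'n) $ i = (if j = i then x * of_real c else 0)" for c x i j
    by (subst complex_vec_scaleR_nth) (simp add: axis_def)
  then show ?thesis
    by (simp only: vec_eq_iff sum_component vector_add_component sum.distrib) simp
qed

text \<open>The submanifolds below are, locally, graphs \<open>z\<^sub>j = \<kappa>\<^sub>j x\<^sub>j + P\<^sub>j(x)\<close> over real coordinates \<open>x\<^sub>j\<close> with
  \<open>j \<noteq> a\<close>, where \<open>\<kappa>\<^sub>j \<in> {1, \<i>}\<close>, and the equation of the quadric is solved for \<open>x\<^sub>a = \<plusminus>\<surd>T(x)\<close>.\<close>

lemma graph_special_chart:
  fixes a :: 7 and \<kappa> :: "7 \<Rightarrow> complex" and P :: "real^7 \<Rightarrow> real^7" and P' :: "real^7 \<Rightarrow> real^7 \<Rightarrow> real^7"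
    and T :: "real^7 \<Rightarrow> real" and S :: "(real^7) set" and s :: real
  defines "\<pi> \<equiv> \<lambda>z::complex^7. (\<chi> j. if j = a then 0 else Re (cnj (\<kappa> j) * z $ j)) :: real^7"
  defines "\<tau> \<equiv> \<lambda>x y. (\<chi> j. \<kappa> j * of_real (y $ j) + of_real (P' x y $ j)) :: complex^7"
  assumes N: "N \<subseteq> quadric"
    and \<kappa>: "\<And>j. \<kappa> j = 1 \<or> \<kappa> j = \<i>" "\<kappa> a = 1"
    and P0: "\<And>x j. \<kappa> j = 1 \<Longrightarrow> P x $ j = 0"
    and S: "open S" "\<And>j k. Ck_on k S (\<lambda>x. P x $ j)" "\<And>k. Ck_on k S T"
    and P': "\<And>x. x \<in> S \<Longrightarrow> (P has_derivative P' x) (at x)"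
      "\<And>x y y'. x \<in> S \<Longrightarrow> (\<And>j. j \<noteq> a \<Longrightarrow> y $ j = y' $ j) \<Longrightarrow> P' x y = P' x y'"
    and s: "s = 1 \<or> s = - 1"
    and graph: "\<And>z. \<pi> z \<in> S \<Longrightarrow> s * Re (z $ a) > 0 \<Longrightarrow> z \<in> N \<longleftrightarrow>
      (\<forall>j. j \<noteq> a \<longrightarrow> z $ j = \<kappa> j * of_real (\<pi> z $ j) + of_real (P (\<pi> z) $ j)) \<and>
      Im (z $ a) = 0 \<and> (Re (z $ a))\<^sup>2 = T (\<pi> z)"
    and p: "p \<in> N" "\<pi> p \<in> S" "s * Re (p $ a) > 0"
    and lag: "\<And>z y y'. z \<in> N \<Longrightarrow> \<pi> z \<in> S \<Longrightarrow> s * Re (z $ a) > 0 \<Longrightarrow> cdot z (\<tau> (\<pi> z) y) = 0 \<Longrightarrow> cdot z (\<tau> (\<pi> z) y') = 0 \<Longrightarrow>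
      stenzel_form u z (\<tau> (\<pi> z) y) (\<tau> (\<pi> z) y') = 0"
    and det: "\<And>z y. z \<in> N \<Longrightarrow> \<pi> z \<in> S \<Longrightarrow> s * Re (z $ a) > 0 \<Longrightarrow> (\<And>j. j \<noteq> a \<Longrightarrow> cdot z (\<tau> (\<pi> z) (y j)) = 0) \<Longrightarrow>
      (\<And>j k. j \<noteq> a \<Longrightarrow> k \<noteq> a \<Longrightarrow> y j $ k = (if j = k then 1 else 0)) \<Longrightarrow>
      Im (Determinants.det ((\<chi> j. if j = a then z else \<tau> (\<pi> z) (y j)) :: complex^7^7) / \<epsilon>) = 0"
  shows "\<exists>W \<phi>. admissible_chart u \<epsilon> N W \<phi> \<and> p \<in> \<phi> ` W"
proof -
  \<comment> \<open>Six coordinates remain besides \<open>a\<close>; \<open>e\<close> makes them the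
    coordinates of the chart domain.\<close>
  have "card (- {a}) = card (UNIV :: 6 set)" by (simp add: Compl_eq_Diff_UNIV card_Diff_subset)
  then obtain e :: "7 \<Rightarrow> 6" where e: "bij_betw e (- {a}) UNIV"
    using finite_same_card_bij[of "- {a}" "UNIV :: 6 set"] by auto
  define e' where "e' = inv_into (- {a}) e"
  have e': "e' i \<noteq> a" "e (e' i) = i" for i
    using e inv_into_into[of i e "- {a}"] f_inv_into_f[of i e "- {a}"] by (auto simp: e'_def bij_betw_def)
  have e'': "e' (e j) = j" if "j \<noteq> a" for j
    using e that by (simp add: e'_def bij_betw_def)
  define b where "b w = (\<chi> j. if j = a then 0 else w $ e j)" for w :: "real^6"
  \<comment> \<open>A linear left inverse of \<open>\<phi>\<close>, which will give both the
    continuity of the inverse and the injectivity of the derivative.\<close>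
  define pr where "pr z = (\<chi> i. \<pi> z $ e' i)" for z
  have bl_b: "bounded_linear b"
    by (intro linear_conv_bounded_linear[THEN iffD1] linearI) (auto simp: b_def vec_eq_iff)
  have bl_pi: "bounded_linear \<pi>"
    by (intro linear_conv_bounded_linear[THEN iffD1] linearI) (auto simp: \<pi>_def vec_eq_iff algebra_simps)
  have bl_pr: "bounded_linear pr"
    by (intro linear_conv_bounded_linear[THEN iffD1] linearI)
      (auto simp: pr_def vec_eq_iff linear_add[OF bounded_linear.linear[OF bl_pi]] linear_scale[OF bounded_linear.linear[OF bl_pi]])
  \<comment> \<open>\<open>b w\<close> has the entry 0 at \<open>a\<close>; the second summand fills
    this entry with the root.\<close>
  define X where "X w j = b w $ j + (if j = a then s * sqrt (T (b w)) else 0)" for w j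
  define \<phi> where "\<phi> w = (\<chi> j. \<kappa> j * of_real (X w j) + of_real (P (b w) $ j))" for w
  define W where "W = {w. b w \<in> S \<and> T (b w) > 0}"
  have cb: "continuous_on A b" for A by (rule linear_continuous_on[OF bl_b])
  have "open (S \<inter> T -` {0<..})"
    using S(3)[of 0] by (intro continuous_open_preimage S(1)) auto
  then have oW: "open W"
    using open_vimage[OF _ cb, of "S \<inter> T -` {0<..}"] by (simp add: W_def vimage_def Collect_conj_eq)
  have \<pi>\<phi>: "\<pi> (\<phi> w) = b w" for w
  proof (subst vec_eq_iff, rule allI)
    fix j show "\<pi> (\<phi> w) $ j = b w $ j"
      using \<kappa>(1)[of j] P0[of j "b w"] by (auto simp: \<pi>_def \<phi>_def b_def X_def)
  qed
  have pr\<phi>: "pr (\<phi> w) = w" for w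
    unfolding pr_def \<pi>\<phi> by (simp add: b_def e' vec_eq_iff)
  have bpr: "b (pr z) = \<pi> z" for z
    by (auto simp: b_def pr_def vec_eq_iff e'') (simp add: \<pi>_def)
  have \<phi>a: "Re (\<phi> w $ a) = s * sqrt (T (b w))" "Im (\<phi> w $ a) = 0" for w
    using \<kappa>(2) P0[of a "b w"] by (auto simp: \<phi>_def X_def b_def)
  have ss: "s * s = 1" using s by auto
  have in_N: "\<phi> w \<in> N" "\<pi> (\<phi> w) \<in> S" "s * Re (\<phi> w $ a) > 0" if "w \<in> W" for w
  proof -
    have T: "b w \<in> S" "T (b w) > 0" using that by (auto simp: W_def)
    show 1: "\<pi> (\<phi> w) \<in> S" "s * Re (\<phi> w $ a) > 0"
      using T ss by (auto simp: \<pi>\<phi> \<phi>a mult.assoc[symmetric])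
    show "\<phi> w \<in> N"
      unfolding graph[OF 1] \<pi>\<phi> \<phi>a
    proof (intro conjI allI impI)
      show "\<phi> w $ j = \<kappa> j * of_real (b w $ j) + of_real (P (b w) $ j)" if "j \<noteq> a" for j
        using that by (simp add: \<phi>_def X_def)
      show "(s * sqrt (T (b w)))\<^sup>2 = T (b w)" using s T by (auto simp: power_mult_distrib)
    qed (rule refl)
  qed
  have onto: "z = \<phi> (pr z) \<and> pr z \<in> W" if z: "z \<in> N" "\<pi> z \<in> S" "s * Re (z $ a) > 0" for z
  proof -
    from graph[OF z(2,3)] z(1) have g: "\<And>j. j \<noteq> a \<Longrightarrow> z $ j = \<kappa> j * of_real (\<pi> z $ j) + of_real (P (\<pi> z) $ j)"
      "Im (z $ a) = 0" "(Re (z $ a))\<^sup>2 = T (\<pi> z)" by auto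
    have "Re (z $ a) \<noteq> 0" using z(3) by auto
    then have T: "T (\<pi> z) > 0" using g(3) by (metis zero_less_power2)
    have "sqrt (T (\<pi> z)) = s * Re (z $ a)"
      using g(3) z(3) s by (intro real_sqrt_unique) (auto simp: power_mult_distrib)
    then have "Re (z $ a) = s * sqrt (T (\<pi> z))" using ss by (simp add: mult.assoc[symmetric])
    then have "z $ j = \<phi> (pr z) $ j" for j
      using g(1)[of j] g(2) \<phi>a[of "pr z"] unfolding bpr
      by (cases "j = a") (auto simp: \<phi>_def X_def bpr complex_eq_iff)
    then show ?thesis using T z(2) by (simp add: vec_eq_iff W_def bpr)
  qed
  have im: "\<phi> ` W = N \<inter> (\<pi> -` S \<inter> {z. s * Re (z $ a) > 0})"
  proof (intro equalityI subsetI)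
    fix z assume "z \<in> N \<inter> (\<pi> -` S \<inter> {z. s * Re (z $ a) > 0})"
    then have "z = \<phi> (pr z)" "pr z \<in> W" using onto[of z] by auto
    then show "z \<in> \<phi> ` W" by (rule image_eqI)
  qed (use in_N in auto)
  have oG: "open (\<pi> -` S \<inter> {z. s * Re (z $ a) > 0})"
    using linear_continuous_on[OF bl_pi]
    by (intro open_Int open_vimage S(1) open_Collect_less) (auto intro!: continuous_intros)
  have sum_form: "\<phi> w = (\<Sum>j\<in>UNIV. X w j *\<^sub>R axis j (\<kappa> j) + (P (b w) $ j) *\<^sub>R axis j 1)" for w
    unfolding sum_axis \<phi>_def ..
  have CbS: "Ck_on k W (\<lambda>w. f (b w))" if "Ck_on k S f" for k and f :: "real^7 \<Rightarrow> real"
    by (rule Ck_on_subset[OF Ck_on_compose_linear[OF bl_b that]]) (auto simp: W_def)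
  have CX: "Ck_on k W (\<lambda>w. X w j)" for k j
  proof -
    have "Ck_on k W (\<lambda>w. b w $ j)"
      by (rule Ck_on_linear[OF bounded_linear_compose[OF bounded_linear_vec_nth bl_b]])
    moreover have "Ck_on k W (\<lambda>w. s * sqrt (T (b w)))"
      by (rule Ck_on_mult[OF Ck_on_const Ck_on_sqrt_compose[OF CbS[OF S(3)]]]) (simp add: W_def)
    ultimately show ?thesis
      unfolding X_def by (cases "j = a") (simp_all add: Ck_on_add)
  qed
  have smooth: "smooth_on W \<phi>"
    unfolding smooth_on_def sum_form
    by (intro allI Ck_on_sum Ck_on_add Ck_on_scaleR Ck_on_const CX CbS S(2))
  have der: "(\<phi> has_derivative frechet_derivative \<phi> (at w)) (at w)" if "w \<in> W" for w
    by (rule smooth_on_has_derivative[OF smooth that])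
  have prD: "pr (frechet_derivative \<phi> (at w) v) = v" if "w \<in> W" for w v
  proof -
    have "((\<lambda>w. pr (\<phi> w)) has_derivative (\<lambda>v. pr (frechet_derivative \<phi> (at w) v))) (at w)"
      by (rule bounded_linear.has_derivative[OF bl_pr der[OF that]])
    then have "(\<lambda>v. pr (frechet_derivative \<phi> (at w) v)) = (\<lambda>v. v)"
      unfolding pr\<phi> by (rule has_derivative_unique[OF _ has_derivative_ident])
    from fun_cong[OF this, of v] show ?thesis .
  qed
  have lp: "local_parametrization W \<phi> N"
    unfolding local_parametrization_def
  proof (intro conjI ballI)
    show "inj (frechet_derivative \<phi> (at w))" if "w \<in> W" for w
      using prD[OF that] by (metis injI)
    show "\<exists>G. open G \<and> \<phi> ` W = N \<inter> G" using im oG by blast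
    have "continuous_on W \<phi>" using smooth unfolding smooth_on_def by (metis Ck_on.simps(1))
    then have "homeomorphism W (\<phi> ` W) \<phi> pr"
      unfolding homeomorphism_def using linear_continuous_on[OF bl_pr] by (auto simp: pr\<phi> image_image)
    then show "\<exists>\<psi>. homeomorphism W (\<phi> ` W) \<phi> \<psi>" by blast
  qed (fact oW smooth)+
  \<comment> \<open>Entry \<open>a\<close> of \<open>y\<close> is the derivative of the root, for
    which no formula is computed: \<open>lag\<close> and \<open>det\<close> ask only for tangency to
    the quadric, which determines it.\<close>
  have tang: "\<exists>y. (\<forall>j. j \<noteq> a \<longrightarrow> y $ j = v $ e j) \<and> frechet_derivative \<phi> (at w) v = \<tau> (\<pi> (\<phi> w)) y"
    if w: "w \<in> W" for w v
  proof -
    have wS: "b w \<in> S" using w by (simp add: W_def)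
    have "Ck_on (Suc 0) W (\<lambda>w. X w a)" by (rule CX)
    then obtain D where D: "((\<lambda>w. X w a) has_derivative D) (at w)" using w by auto
    have Dj: "((\<lambda>w. X w j) has_derivative (if j = a then D else (\<lambda>v. v $ e j))) (at w)" for j
    proof (cases "j = a")
      case False
      have "((\<lambda>w::real^6. w $ e j) has_derivative (\<lambda>v. v $ e j)) (at w)"
        by (rule bounded_linear.has_derivative[OF bounded_linear_vec_nth has_derivative_ident])
      then show ?thesis using False by (simp add: X_def b_def)
    qed (use D in simp)
    have DP: "((\<lambda>w. P (b w) $ j) has_derivative (\<lambda>v. P' (b w) (b v) $ j)) (at w)" for j
      by (rule bounded_linear.has_derivative[OF bounded_linear_vec_nth
          has_derivative_compose[OF bounded_linear.has_derivative[OF bl_b has_derivative_ident] P'(1)[OF wS]]])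
    have "(\<phi> has_derivative (\<lambda>v. \<Sum>j\<in>UNIV. (if j = a then D else (\<lambda>v. v $ e j)) v *\<^sub>R axis j (\<kappa> j) +
        (P' (b w) (b v) $ j) *\<^sub>R axis j 1)) (at w)"
      unfolding sum_form[abs_def]
      by (rule has_derivative_sum, rule has_derivative_add, rule has_derivative_scaleR_left[OF Dj],
          rule has_derivative_scaleR_left[OF DP])
    from fun_cong[OF frechet_derivative_at[OF this, symmetric], of v]
    have fd: "frechet_derivative \<phi> (at w) v = (\<Sum>j\<in>UNIV. (if j = a then D else (\<lambda>v. v $ e j)) v *\<^sub>R axis j (\<kappa> j) +
        (P' (b w) (b v) $ j) *\<^sub>R axis j 1)" .
    let ?y = "(\<chi> j. if j = a then D v else v $ e j) :: real^7"
    have "P' (b w) (b v) = P' (b w) ?y"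
      by (rule P'(2)[OF wS]) (simp add: b_def)
    then have "frechet_derivative \<phi> (at w) v = \<tau> (\<pi> (\<phi> w)) ?y"
      unfolding fd \<pi>\<phi> sum_axis \<tau>_def vec_eq_iff by simp
    then show ?thesis by (intro exI[of _ ?y]) simp
  qed
  have "admissible_chart u \<epsilon> N W \<phi>"
    unfolding admissible_chart_def
  proof (intro conjI ballI allI)
    fix w assume w: "w \<in> W"
    note wN = in_N[OF w]
    have tan0: "cdot (\<phi> w) (frechet_derivative \<phi> (at w) v) = 0" for v
      using local_parametrization_tangent[OF lp N w, of v] by (simp add: quadric_tangent_cdot)
    show "stenzel_form u (\<phi> w) (frechet_derivative \<phi> (at w) v) (frechet_derivative \<phi> (at w) v') = 0" for v v'
    proof -
      obtain y y' where y: "frechet_derivative \<phi> (at w) v = \<tau> (\<pi> (\<phi> w)) y" "frechet_derivative \<phi> (at w) v' = \<tau> (\<pi> (\<phi> w)) y'"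
        using tang[OF w] by metis
      show ?thesis
        unfolding y by (rule lag[OF wN]) (use tan0[of v] tan0[of v'] y in simp_all)
    qed
    have "\<forall>j. \<exists>y. (\<forall>k. k \<noteq> a \<longrightarrow> y $ k = axis (e j) 1 $ e k) \<and>
        frechet_derivative \<phi> (at w) (axis (e j) 1) = \<tau> (\<pi> (\<phi> w)) y"
      using tang[OF w] by blast
    then obtain y where y: "\<And>j k. k \<noteq> a \<Longrightarrow> y j $ k = axis (e j) 1 $ e k"
      "\<And>j. frechet_derivative \<phi> (at w) (axis (e j) 1) = \<tau> (\<pi> (\<phi> w)) (y j)"
      unfolding choice_iff by blast
    have yd: "y j $ k = (if j = k then 1 else 0)" if "j \<noteq> a" "k \<noteq> a" for j k
      using y(1)[OF that(2), of j] e'' that by (auto simp: axis_def) metis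
    \<comment> \<open>Row \<open>a\<close> holds the point itself, in slot 0, and the tangent
      vectors follow with their numbers shifted by one, as \<open>case_nat\<close>
      prescribes.\<close>
    let ?g = "\<lambda>r. if r = a then 0 else Suc (index_6 (e r))"
    have i6: "index_6 i < 6" "index_6 i = index_6 j \<longleftrightarrow> i = j" for i j
      using bij_index_6 by (auto simp: bij_betw_def inj_on_def)
    have inj_g: "inj ?g"
      unfolding inj_def using i6(2) e'' by (metis Suc_inject nat.distinct(1))
    have "?g ` UNIV = {..<7}"
    proof (rule card_subset_eq)
      show "?g ` UNIV \<subseteq> {..<7}" using i6(1) by (auto simp: less_Suc_eq_0_disj)
      show "card (?g ` UNIV) = card {..<7::nat}" by (subst card_image[OF inj_g]) simp
    qed simp
    then have "bij_betw ?g UNIV {..<7}" using inj_g by (simp add: bij_betw_def)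
    then obtain r :: real where r: "vol (\<phi> w) (coord_frame \<phi> w) =
        of_real r * Determinants.det ((\<chi> j. case_nat (\<phi> w) (coord_frame \<phi> w) (?g j)) :: complex^7^7)"
      by (rule vol_permute)
    have "case_nat (\<phi> w) (coord_frame \<phi> w) (?g j) = (if j = a then \<phi> w else \<tau> (\<pi> (\<phi> w)) (y j))" for j
      by (simp add: coord_frame_def y(2))
    then have v: "vol (\<phi> w) (coord_frame \<phi> w) =
        of_real r * Determinants.det ((\<chi> j. if j = a then \<phi> w else \<tau> (\<pi> (\<phi> w)) (y j)) :: complex^7^7)"
      using r by simp
    have "Im (Determinants.det ((\<chi> j. if j = a then \<phi> w else \<tau> (\<pi> (\<phi> w)) (y j)) :: complex^7^7) / \<epsilon>) = 0"
      by (rule det[OF wN]) (use tan0 y(2) yd in \<open>simp_all flip: y(2)\<close>)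
    then show "Im (vol (\<phi> w) (coord_frame \<phi> w) / \<epsilon>) = 0"
      unfolding v by (simp add: times_divide_eq_right[symmetric] del: times_divide_eq_right)
  qed (fact lp)
  moreover have "p \<in> \<phi> ` W" using onto[OF p] by blast
  ultimately show ?thesis by blast
qed


section \<open>The totally real pieces\<close>

lemma det_rows_of_real:
  "det ((\<chi> j k. r j * of_real (M j k)) :: complex^'n^'n) = (\<Prod>j\<in>UNIV. r j) * of_real (det (\<chi> j k. M j k))"
  using det_rows_mul[of r "\<lambda>j. (\<chi> k. of_real (M j k)) :: complex^'n"]
  by (simp add: vector_scalar_mult_def det_of_real)

lemma det_columns_of_real:
  "det ((\<chi> j k. c k * of_real (M j k)) :: complex^'n^'n) = (\<Prod>k\<in>UNIV. c k) * of_real (det (\<chi> j k. M j k))"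
proof -
  have "det ((\<chi> j k. c k * of_real (M j k)) :: complex^'n^'n) = det ((\<chi> k j. c k * of_real (M j k)) :: complex^'n^'n)"
    using det_transpose[of "(\<chi> j k. c k * of_real (M j k)) :: complex^'n^'n"] by (simp add: transpose_def)
  also have "\<dots> = (\<Prod>k\<in>UNIV. c k) * of_real (det (\<chi> k j. M j k))"
    by (rule det_rows_of_real)
  also have "det (\<chi> k j. M j k) = det (\<chi> j k. M j k)"
    using det_transpose[of "\<chi> j k. M j k"] by (simp add: transpose_def)
  finally show ?thesis .
qed

definition flat_coeff :: "7 set \<Rightarrow> 7 \<Rightarrow> complex" where
  "flat_coeff A j = (if j \<in> A then 1 else \<i>)"

text \<open>A real form of the quadric: the fixed points of the antiholomorphic involution that
  sends z_j to its conjugate for j in \<open>A\<close> and to minus its conjugate otherwise.\<close>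

definition flat :: "7 set \<Rightarrow> (complex^7) set" where
  "flat A = {z \<in> quadric. \<forall>j. if j \<in> A then Im (z $ j) = 0 else Re (z $ j) = 0}"

text \<open>These are graphs with P = 0. The tangent vectors are real up to the fixed factors 1 or i
  of the coordinates, so \<open>hermitian\<close> is real on them and the determinant is a real
  multiple of the product of these factors. A coordinate to solve for exists because the squares of
  the real parts exceed those of the imaginary parts by 1.\<close>

lemma flat_admissible_chart:
  assumes u: "smooth_from_1 u" and p: "p \<in> flat A"
  shows "\<exists>W \<phi>. admissible_chart u (\<Prod>j\<in>UNIV. flat_coeff A j) (flat A) W \<phi> \<and> p \<in> \<phi> ` W"
proof -
  have "\<exists>a. Re (p $ a) \<noteq> 0"
  proof (rule ccontr)
    assume "\<nexists>a. Re (p $ a) \<noteq> 0"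
    then have "- (\<Sum>i\<in>UNIV. (Im (p $ i))\<^sup>2) = 1" using quadric_Re_Im(1)[of p] p by (simp add: flat_def)
    then show False using sum_nonneg[of UNIV "\<lambda>i. (Im (p $ i))\<^sup>2"] by simp
  qed
  then obtain a where a: "Re (p $ a) \<noteq> 0" by blast
  have aA: "a \<in> A"
  proof (rule ccontr)
    assume "a \<notin> A"
    then have "Re (p $ a) = 0" using p unfolding flat_def by (metis (mono_tags, lifting) mem_Collect_eq)
    then show False using a by simp
  qed
  define s where "s = sgn (Re (p $ a))"
  define T where "T x = 1 + (\<Sum>j\<in>UNIV - {a}. if j \<in> A then - (x $ j)\<^sup>2 else (x $ j)\<^sup>2)" for x :: "real^7"
  let ?\<kappa> = "flat_coeff A"
  have flatD: "z $ j = ?\<kappa> j * of_real (Re (cnj (?\<kappa> j) * z $ j))" if "z \<in> flat A" for z j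
    using that by (auto simp: flat_def flat_coeff_def complex_eq_iff split: if_splits)
  show ?thesis
  proof (rule graph_special_chart[where a = a and s = s and S = UNIV and P = "\<lambda>x. 0" and P' = "\<lambda>x y. 0" and T = T])
    show "flat A \<subseteq> quadric" by (auto simp: flat_def)
    show "?\<kappa> j = 1 \<or> ?\<kappa> j = \<i>" for j by (simp add: flat_coeff_def)
    show "?\<kappa> a = 1" using aA by (simp add: flat_coeff_def)
    show "Ck_on k UNIV (\<lambda>x. (0 :: real^7) $ j)" for k j by (rule Ck_on_const)
    show "Ck_on k UNIV T" for k
    proof -
      have "Ck_on k UNIV (\<lambda>x::real^7. if j \<in> A then - (x $ j)\<^sup>2 else (x $ j)\<^sup>2)" for j
        using Ck_on_mult[OF Ck_on_nth Ck_on_nth, of k UNIV j j] Ck_on_minus[of k UNIV "\<lambda>x. x $ j * x $ j"]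
        by (cases "j \<in> A") (simp_all add: power2_eq_square)
      then show ?thesis
        unfolding T_def[abs_def] by (intro Ck_on_add Ck_on_const Ck_on_sum)
    qed
    show "s = 1 \<or> s = - 1" using a by (auto simp: s_def sgn_if)
    show "s * Re (p $ a) > 0" using a by (auto simp: s_def sgn_if)
    show "p \<in> flat A" by (rule p)
  next
    fix z :: "complex^7"
    let ?\<pi> = "(\<chi> j. if j = a then 0 else Re (cnj (?\<kappa> j) * z $ j)) :: real^7"
    have T: "T ?\<pi> = 1 + (\<Sum>j\<in>UNIV - {a}. if j \<in> A then - (Re (z $ j))\<^sup>2 else (Im (z $ j))\<^sup>2)"
      unfolding T_def by (intro arg_cong2[of _ _ _ _ "(+)"] sum.cong refl) (auto simp: flat_coeff_def)
    have fl: "(\<forall>j. if j \<in> A then Im (z $ j) = 0 else Re (z $ j) = 0) \<longleftrightarrow>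
        (\<forall>j. j \<noteq> a \<longrightarrow> z $ j = ?\<kappa> j * of_real (?\<pi> $ j) + of_real ((0 :: real^7) $ j)) \<and> Im (z $ a) = 0" (is "?l \<longleftrightarrow> ?r")
    proof
      assume ?l then show ?r using aA by (auto simp: flat_coeff_def complex_eq_iff split: if_splits)
    next
      assume r: ?r
      show ?l
      proof
        fix j
        show "if j \<in> A then Im (z $ j) = 0 else Re (z $ j) = 0"
        proof (cases "j = a")
          case True
          then show ?thesis using r aA by simp
        next
          case False
          then have "z $ j = ?\<kappa> j * of_real (Re (cnj (?\<kappa> j) * z $ j))" using r by simp
          then show ?thesis by (auto simp: flat_coeff_def complex_eq_iff)
        qed
      qed
    qed
    have q: "z \<in> quadric \<longleftrightarrow> (Re (z $ a))\<^sup>2 = T ?\<pi>" if l: ?l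
    proof -
      have "(\<Sum>j\<in>UNIV. (z $ j)\<^sup>2) = (z $ a)\<^sup>2 + (\<Sum>j\<in>UNIV - {a}. (z $ j)\<^sup>2)"
        by (rule sum.remove) auto
      also have "(z $ a)\<^sup>2 = of_real ((Re (z $ a))\<^sup>2)"
        using l[rule_format, of a] aA by (simp add: complex_eq_iff power2_eq_square)
      also have "(\<Sum>j\<in>UNIV - {a}. (z $ j)\<^sup>2) =
          of_real (- (\<Sum>j\<in>UNIV - {a}. if j \<in> A then - (Re (z $ j))\<^sup>2 else (Im (z $ j))\<^sup>2))"
        unfolding sum_negf[symmetric] of_real_sum
      proof (intro sum.cong refl)
        fix j
        show "(z $ j)\<^sup>2 = of_real (- (if j \<in> A then - (Re (z $ j))\<^sup>2 else (Im (z $ j))\<^sup>2))"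
          using l[rule_format, of j] by (auto simp: complex_eq_iff power2_eq_square split: if_splits)
      qed
      finally have "(\<Sum>j\<in>UNIV. (z $ j)\<^sup>2) = of_real ((Re (z $ a))\<^sup>2 - (T ?\<pi> - 1))"
        unfolding T by simp
      then have "z \<in> quadric \<longleftrightarrow> complex_of_real ((Re (z $ a))\<^sup>2 - (T ?\<pi> - 1)) = of_real 1"
        by (simp add: quadric_def)
      then show ?thesis unfolding of_real_eq_iff by auto
    qed
    show "z \<in> flat A \<longleftrightarrow> (\<forall>j. j \<noteq> a \<longrightarrow> z $ j = ?\<kappa> j * of_real (?\<pi> $ j) + of_real ((0 :: real^7) $ j)) \<and>
        Im (z $ a) = 0 \<and> (Re (z $ a))\<^sup>2 = T ?\<pi>"
      using fl q unfolding flat_def by blast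
    let ?\<tau> = "\<lambda>y. (\<chi> j. ?\<kappa> j * of_real (y $ j) + of_real ((0 :: real^7) $ j)) :: complex^7"
    assume z: "z \<in> flat A"
    show "stenzel_form u z (?\<tau> y) (?\<tau> y') = 0" for y y' :: "real^7"
    proof -
      have 1: "(\<Sum>j\<in>UNIV. ?\<tau> y $ j * cnj (?\<tau> y' $ j)) = of_real (\<Sum>j\<in>UNIV. y $ j * y' $ j)"
        unfolding of_real_sum by (intro sum.cong refl) (auto simp: flat_coeff_def)
      have 2: "(\<Sum>j\<in>UNIV. cnj (z $ j) * ?\<tau> y $ j) = of_real (\<Sum>j\<in>UNIV. Re (cnj (?\<kappa> j) * z $ j) * y $ j)" for y :: "real^7"
        unfolding of_real_sum
      proof (intro sum.cong refl)
        fix j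
        show "cnj (z $ j) * ?\<tau> y $ j = of_real (Re (cnj (?\<kappa> j) * z $ j) * y $ j)"
          using z by (auto simp: flat_def flat_coeff_def complex_eq_iff split: if_splits)
      qed
      have "z \<in> quadric" using z by (simp add: flat_def)
      moreover have "Im (hermitian u z (?\<tau> y) (?\<tau> y')) = 0"
        unfolding hermitian_def 1 2 by simp
      ultimately show ?thesis by (simp add: stenzel_form_Im[OF u rsq_ge_1])
    qed
    fix y :: "7 \<Rightarrow> real^7"
    let ?M = "\<lambda>j k. if j = a then Re (cnj (?\<kappa> k) * z $ k) else y j $ k"
    have "((\<chi> j. if j = a then z else ?\<tau> (y j)) :: complex^7^7) = (\<chi> j k. ?\<kappa> k * of_real (?M j k))"
      using flatD[OF z] by (auto simp: vec_eq_iff)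
    then have "det ((\<chi> j. if j = a then z else ?\<tau> (y j)) :: complex^7^7) =
        (\<Prod>j\<in>UNIV. ?\<kappa> j) * of_real (det (\<chi> j k. ?M j k))"
      by (simp only: det_columns_of_real)
    moreover have "(\<Prod>j\<in>UNIV. ?\<kappa> j) \<noteq> 0" by (simp add: flat_coeff_def)
    ultimately show "Im (det ((\<chi> j. if j = a then z else ?\<tau> (y j)) :: complex^7^7) / (\<Prod>j\<in>UNIV. ?\<kappa> j)) = 0"
      by simp
  qed (simp_all)
qed

lemma admissible_chart_Int:
  assumes "admissible_chart u \<epsilon> N W \<phi>" "open G"
  shows "admissible_chart u \<epsilon> (N \<inter> G) (W \<inter> \<phi> -` G) \<phi>"
  using assms local_parametrization_Int unfolding admissible_chart_def by blast

lemma special_lagrangian_flat: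
  fixes \<Omega> :: "complex^7 \<Rightarrow> (complex^7) form"
  assumes cy: "stenzel_calabi_yau \<kappa> u \<Omega>" and G: "open G"
  shows "special_lagrangian u \<Omega> (flat A \<inter> G)"
proof (rule special_lagrangianI[OF cy])
  have "stenzel_potential TYPE(7) \<kappa> u" using cy by (simp add: stenzel_calabi_yau_def)
  note sm = stenzel_potential_smooth[OF this]
  show "flat A \<inter> G \<subseteq> quadric" by (auto simp: flat_def)
  show "norm (\<Prod>j\<in>UNIV. flat_coeff A j) = 1"
    by (simp add: prod_norm[symmetric] flat_coeff_def)
  fix p assume "p \<in> flat A \<inter> G"
  then obtain W \<phi> where "admissible_chart u (\<Prod>j\<in>UNIV. flat_coeff A j) (flat A) W \<phi>" "p \<in> \<phi> ` W"
    using flat_admissible_chart[OF sm] by blast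
  then show "\<exists>W \<phi>. admissible_chart u (\<Prod>j\<in>UNIV. flat_coeff A j) (flat A \<inter> G) W \<phi> \<and> p \<in> \<phi> ` W"
    using admissible_chart_Int[OF _ G] \<open>p \<in> flat A \<inter> G\<close> by blast
qed


section \<open>Level sets of the moment map\<close>

definition moment_set :: "(real \<Rightarrow> real) \<Rightarrow> real \<Rightarrow> real \<Rightarrow> (complex^7) set" where
  "moment_set u c1 c2 = {z \<in> quadric.
     Im (z $ 5) = 0 \<and> Im (z $ 6) = 0 \<and> Im (z $ 7) = 0 \<and> (z $ 5 \<noteq> 0 \<or> z $ 6 \<noteq> 0 \<or> z $ 7 \<noteq> 0) \<and>
     (z $ 1 \<noteq> 0 \<or> z $ 2 \<noteq> 0) \<and> (z $ 3 \<noteq> 0 \<or> z $ 4 \<noteq> 0) \<and>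
     Re (z $ 1) * Im (z $ 1) + Re (z $ 2) * Im (z $ 2) = 0 \<and>
     Re (z $ 3) * Im (z $ 3) + Re (z $ 4) * Im (z $ 4) = 0 \<and>
     - 2 * deriv u (rsq z) * Im (cnj (z $ 1) * z $ 2) = c1 \<and>
     - 2 * deriv u (rsq z) * Im (cnj (z $ 3) * z $ 4) = c2}"

section \<open>Algebra in one plane, and phases of determinants\<close>

lemma sum_axis_real: "(\<Sum>j\<in>UNIV. x $ j *\<^sub>R axis j 1) = (x :: real^'n)"
  using basis_expansion[of x] by (simp add: scalar_mult_eq_scaleR)

text \<open>With p the imaginary and r the real part of a plane component, the two conditions fix
  the inner and the cross product of r with p. As p is nonzero, r is F times p turned by a right
  angle.\<close>

lemma imaginary_block_iff:
  fixes p1 p2 r1 r2 c d :: real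
  assumes "d > 0" "p1\<^sup>2 + p2\<^sup>2 > 0" and F: "F = c / 2 * inverse (d * (p1\<^sup>2 + p2\<^sup>2))"
  shows "r1 * p1 + r2 * p2 = 0 \<and> - 2 * d * (r1 * p2 - p1 * r2) = c \<longleftrightarrow> r1 = - F * p2 \<and> r2 = F * p1"
proof
  define w where "w = p1\<^sup>2 + p2\<^sup>2"
  have w: "w > 0" using assms(2) by (simp add: w_def)
  have cF: "c = 2 * d * F * w"
  proof -
    have "d * w \<noteq> 0" using assms(1) w by simp
    then have inv: "inverse (d * w) * (d * w) = 1" by (rule left_inverse)
    have gen: "2 * d * (c / 2 * X) * w = c * (X * (d * w))" for X
      by (simp add: algebra_simps)
    have "2 * d * (c / 2 * inverse (d * w)) * w = c * 1" unfolding gen inv ..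
    then show ?thesis unfolding F w_def[symmetric] by simp
  qed
  {
    assume h: "r1 * p1 + r2 * p2 = 0 \<and> - 2 * d * (r1 * p2 - p1 * r2) = c"
    have o: "r1 * p1 + r2 * p2 = 0" using h by blast
    have m: "- 2 * d * (r1 * p2 - p1 * r2) = 2 * d * F * w" using h unfolding cF[symmetric] by blast
    have m': "p1 * r2 - r1 * p2 = F * w"
    proof -
      have "2 * d * (p1 * r2 - r1 * p2) = 2 * d * (F * w)" using m by (simp add: algebra_simps)
      moreover have "2 * d \<noteq> 0" using assms(1) by simp
      ultimately have "p1 * r2 - r1 * p2 = F * w" unfolding mult_cancel_left by blast
      then show ?thesis .
    qed
    have "r1 * w = (r1 * p1 + r2 * p2) * p1 - p2 * (p1 * r2 - r1 * p2)" by (simp add: w_def power2_eq_square algebra_simps)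
    then have "r1 * w = (- F * p2) * w" unfolding o m' by simp
    moreover have "r2 * w = (r1 * p1 + r2 * p2) * p2 + p1 * (p1 * r2 - r1 * p2)" by (simp add: w_def power2_eq_square algebra_simps)
    then have "r2 * w = (F * p1) * w" unfolding o m' by (simp add: mult_ac)
    moreover have "w \<noteq> 0" using w by simp
    ultimately show "r1 = - F * p2 \<and> r2 = F * p1" unfolding mult_cancel_right by blast
  }
  assume "r1 = - F * p2 \<and> r2 = F * p1"
  then show "r1 * p1 + r2 * p2 = 0 \<and> - 2 * d * (r1 * p2 - p1 * r2) = c"
    unfolding cF w_def by (simp add: power2_eq_square algebra_simps)
qed

text \<open>Covers both types of charts. For \<open>kk\<close> = i it is the preceding lemma. For
  \<open>kk\<close> = 1 the level is 0, so f = 0, and an imaginary part both orthogonal and parallel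
  to a nonzero real part vanishes.\<close>

lemma block_graph_iff:
  fixes kk w1 w2 :: complex and c d f y1 y2 :: real
  assumes d: "d > 0" and kk: "kk = 1 \<or> kk = \<i>" "kk = 1 \<Longrightarrow> c = 0"
    and y: "y1 = Re (cnj kk * w1)" "y2 = Re (cnj kk * w2)" "y1\<^sup>2 + y2\<^sup>2 > 0"
    and f: "f = c / 2 * inverse (d * (y1\<^sup>2 + y2\<^sup>2))"
  shows "(Re w1 * Im w1 + Re w2 * Im w2 = 0 \<and> - 2 * d * Im (cnj w1 * w2) = c) \<longleftrightarrow>
    (w1 = kk * of_real y1 + of_real (- (f * y2)) \<and> w2 = kk * of_real y2 + of_real (f * y1))"
proof (cases "kk = 1")
  case True
  then have c: "c = 0" and f0: "f = 0" using kk(2) f by auto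
  have y12: "y1 = Re w1" "y2 = Re w2" using y True by auto
  have "Re w1 * Im w1 + Re w2 * Im w2 = 0 \<and> Re w1 * Im w2 - Im w1 * Re w2 = 0 \<longleftrightarrow> Im w1 = 0 \<and> Im w2 = 0"
  proof
    assume h: "Re w1 * Im w1 + Re w2 * Im w2 = 0 \<and> Re w1 * Im w2 - Im w1 * Re w2 = 0"
    have "(y1\<^sup>2 + y2\<^sup>2) * Im w1 = y1 * (Re w1 * Im w1 + Re w2 * Im w2) - y2 * (Re w1 * Im w2 - Im w1 * Re w2)"
      "(y1\<^sup>2 + y2\<^sup>2) * Im w2 = y2 * (Re w1 * Im w1 + Re w2 * Im w2) + y1 * (Re w1 * Im w2 - Im w1 * Re w2)"
      unfolding y12 by (simp_all add: power2_eq_square algebra_simps)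
    then have "(y1\<^sup>2 + y2\<^sup>2) * Im w1 = 0" "(y1\<^sup>2 + y2\<^sup>2) * Im w2 = 0" using h by simp_all
    moreover have "y1\<^sup>2 + y2\<^sup>2 \<noteq> 0" using y(3) by (rule less_imp_neq[THEN not_sym])
    ultimately show "Im w1 = 0 \<and> Im w2 = 0" unfolding mult_eq_0_iff by blast
  qed simp
  moreover have "- 2 * d * Im (cnj w1 * w2) = c \<longleftrightarrow> Re w1 * Im w2 - Im w1 * Re w2 = 0"
    using d by (simp add: c)
  ultimately show ?thesis by (simp add: True f0 y12 complex_eq_iff)
next
  case False
  then have kk: "kk = \<i>" using kk(1) by auto
  have y12: "y1 = Im w1" "y2 = Im w2" using y kk by auto
  have "(Re w1 * y1 + Re w2 * y2 = 0 \<and> - 2 * d * (Re w1 * y2 - y1 * Re w2) = c) \<longleftrightarrow>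
      (Re w1 = - f * y2 \<and> Re w2 = f * y1)"
    by (rule imaginary_block_iff[OF d y(3) f])
  then show ?thesis by (simp add: kk y12 complex_eq_iff)
qed

text \<open>The contribution of one plane to Im \<open>hermitian\<close> on two tangent vectors,
  with v = u' and w = u''. Here \<open>dy\<close> and \<open>dz\<close> are the derivatives of F
  along the two vectors and \<open>m\<close>, \<open>n\<close> are half the derivatives of r^2; the
  assumptions differentiate F u'(r^2) |x|^2 = c/2. After multiplication by |x|^2 and substitution
  everything cancels.\<close>

lemma block_lagrangian:
  fixes x1 x2 y1 y2 z1 z2 F dy dz m n v w :: real
  assumes s: "x1\<^sup>2 + x2\<^sup>2 > 0"
    and y: "dy * ((x1\<^sup>2 + x2\<^sup>2) * v) = - F * (2 * v * (x1 * y1 + x2 * y2) + (x1\<^sup>2 + x2\<^sup>2) * w * (2 * m))"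
    and z: "dz * ((x1\<^sup>2 + x2\<^sup>2) * v) = - F * (2 * v * (x1 * z1 + x2 * z2) + (x1\<^sup>2 + x2\<^sup>2) * w * (2 * n))"
  shows "v * (dz * (x1 * y2 - x2 * y1) - dy * (x1 * z2 - x2 * z1) + 2 * F * (y2 * z1 - y1 * z2)) +
    w * (2 * F * ((x1 * y2 - x2 * y1) * n - m * (x1 * z2 - x2 * z1))) = 0" (is "?E = 0")
proof -
  let ?s = "x1\<^sup>2 + x2\<^sup>2"
  have "?s * ?E = dz * (?s * v) * (x1 * y2 - x2 * y1) - dy * (?s * v) * (x1 * z2 - x2 * z1)
      + ?s * v * (2 * F * (y2 * z1 - y1 * z2)) + ?s * w * (2 * F * ((x1 * y2 - x2 * y1) * n - m * (x1 * z2 - x2 * z1)))"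
    by (simp add: algebra_simps)
  also have "\<dots> = 0"
    unfolding y z by (simp add: power2_eq_square algebra_simps)
  finally have "?s * ?E = 0" .
  moreover have "?s \<noteq> 0" using s by (rule less_imp_neq[THEN not_sym])
  ultimately show ?thesis unfolding mult_eq_0_iff by blast
qed

lemma det_real_combination:
  fixes M N :: "7 \<Rightarrow> complex^7"
  assumes "\<And>j. M j = (\<Sum>k\<in>UNIV. of_real (C $ j $ k) *s N k)"
  shows "det ((\<chi> j. M j) :: complex^7^7) = of_real (det (C :: real^7^7)) * det ((\<chi> j. N j) :: complex^7^7)"
proof -
  have "(\<chi> j. M j) = ((\<chi> j k. of_real (C $ j $ k)) :: complex^7^7) ** (\<chi> j. N j)"
    by (simp add: vec_eq_iff matrix_matrix_mult_def assms)
  then show ?thesis by (simp add: det_mul det_of_real)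
qed

text \<open>The matrix factors as diag(r) L diag(q) R with L and R real, so its phase is that of the
  diagonal factors.\<close>

lemma Im_det_eq_0:
  fixes N :: "7 \<Rightarrow> complex^7" and L R :: "real^7^7"
  assumes N: "\<And>j. N j = r j *s (\<Sum>k\<in>UNIV. of_real (L $ j $ k) *s (q k *s cvec (R $ k)))"
    and rq: "Im ((\<Prod>j\<in>UNIV. r j) * (\<Prod>j\<in>UNIV. q j)) = 0"
  shows "Im (det ((\<chi> j. N j) :: complex^7^7)) = 0"
proof -
  have "(\<chi> j. N j) = ((\<chi> j k. r j * of_real (L $ j $ k)) :: complex^7^7) ** (\<chi> k i. q k * of_real (R $ k $ i))"
    by (simp add: vec_eq_iff matrix_matrix_mult_def N cvec_def sum_distrib_left mult_ac)
  then have "det ((\<chi> j. N j) :: complex^7^7) = (\<Prod>j\<in>UNIV. r j) * of_real (det L) * ((\<Prod>j\<in>UNIV. q j) * of_real (det R))"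
    by (simp add: det_mul det_rows_of_real)
  also have "\<dots> = ((\<Prod>j\<in>UNIV. r j) * (\<Prod>j\<in>UNIV. q j)) * of_real (det L * det R)"
    by (simp add: mult_ac)
  finally show ?thesis using rq by simp
qed

text \<open>For each plane the factor 1 or i tells whether real or imaginary parts serve as
  coordinates. The real choice is confined to level 0, where the graph function of that plane
  vanishes.\<close>

locale moment_chart =
  fixes \<kappa> :: real and u :: "real \<Rightarrow> real" and c1 c2 :: real and k1 k2 :: complex
  assumes pot: "stenzel_potential TYPE(7) \<kappa> u"
    and k1: "k1 = 1 \<or> k1 = \<i>" "k1 = 1 \<Longrightarrow> c1 = 0"
    and k2: "k2 = 1 \<or> k2 = \<i>" "k2 = 1 \<Longrightarrow> c2 = 0"
begin

definition k :: "7 \<Rightarrow> complex" where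
  "k j = (if j = 1 \<or> j = 2 then k1 else if j = 3 \<or> j = 4 then k2 else 1)"

lemma k_simps [simp]: "k 1 = k1" "k 2 = k1" "k 3 = k2" "k 4 = k2" "k 5 = 1" "k 6 = 1" "k 7 = 1"
  by (simp_all add: k_def)

text \<open>This is r^2 in chart coordinates: \<open>Im k1\<close> and \<open>Im k2\<close> are 0 or
  1 and select the planes with imaginary coordinates.\<close>

definition \<rho> :: "real^7 \<Rightarrow> real" where
  "\<rho> x = 1 + 2 * (Im k1 * ((x $ 1)\<^sup>2 + (x $ 2)\<^sup>2) + Im k2 * ((x $ 3)\<^sup>2 + (x $ 4)\<^sup>2))"

definition D\<rho> :: "real^7 \<Rightarrow> real^7 \<Rightarrow> real" where
  "D\<rho> x y = 4 * (Im k1 * (x $ 1 * y $ 1 + x $ 2 * y $ 2) + Im k2 * (x $ 3 * y $ 3 + x $ 4 * y $ 4))"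

text \<open>The scalar of \<open>imaginary_block_iff\<close>, with u' taken at \<rho>.\<close>

definition F :: "real \<Rightarrow> 7 \<Rightarrow> 7 \<Rightarrow> real^7 \<Rightarrow> real" where
  "F c i j x = c / 2 * inverse (deriv u (\<rho> x) * ((x $ i)\<^sup>2 + (x $ j)\<^sup>2))"

text \<open>The derivative of \<open>F\<close>, written as a multiple of \<open>F\<close> so that it
  visibly vanishes where the level is 0.\<close>

definition DF :: "real \<Rightarrow> 7 \<Rightarrow> 7 \<Rightarrow> real^7 \<Rightarrow> real^7 \<Rightarrow> real" where
  "DF c i j x y = - F c i j x * inverse (deriv u (\<rho> x) * ((x $ i)\<^sup>2 + (x $ j)\<^sup>2)) *
     (deriv (deriv u) (\<rho> x) * D\<rho> x y * ((x $ i)\<^sup>2 + (x $ j)\<^sup>2) + deriv u (\<rho> x) * (2 * (x $ i * y $ i + x $ j * y $ j)))"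

abbreviation "F1 \<equiv> F c1 1 2"
abbreviation "F2 \<equiv> F c2 3 4"
abbreviation "DF1 \<equiv> DF c1 1 2"
abbreviation "DF2 \<equiv> DF c2 3 4"

definition P :: "real^7 \<Rightarrow> real^7" where
  "P x = vector [- (F1 x * x $ 2), F1 x * x $ 1, - (F2 x * x $ 4), F2 x * x $ 3, 0, 0, 0]"

definition DP :: "real^7 \<Rightarrow> real^7 \<Rightarrow> real^7" where
  "DP x y = vector [- (DF1 x y * x $ 2 + F1 x * y $ 2), DF1 x y * x $ 1 + F1 x * y $ 1,
     - (DF2 x y * x $ 4 + F2 x * y $ 4), DF2 x y * x $ 3 + F2 x * y $ 3, 0, 0, 0]"

definition S :: "(real^7) set" where
  "S = {x. (x $ 1)\<^sup>2 + (x $ 2)\<^sup>2 > 0 \<and> (x $ 3)\<^sup>2 + (x $ 4)\<^sup>2 > 0}"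

lemma Im_k [simp]: "0 \<le> Im k1" "0 \<le> Im k2"
  using k1(1) k2(1) by auto

lemma \<rho>_ge_1: "1 \<le> \<rho> x"
  by (simp add: \<rho>_def)

lemma du_pos: "deriv u (\<rho> x) > 0"
  by (rule stenzel_potential_deriv_pos[OF pot \<rho>_ge_1])

lemma F_eq_0: "k1 = 1 \<Longrightarrow> F1 x = 0" "k2 = 1 \<Longrightarrow> F2 x = 0"
proof -
  show "F1 x = 0" if "k1 = 1" using k1(2)[OF that] unfolding F_def by simp
  show "F2 x = 0" if "k2 = 1" using k2(2)[OF that] unfolding F_def by simp
qed

lemma DF_eq_0: "k1 = 1 \<Longrightarrow> DF1 x y = 0" "k2 = 1 \<Longrightarrow> DF2 x y = 0"
proof -
  show "DF1 x y = 0" if "k1 = 1" unfolding DF_def F_eq_0(1)[OF that] by simp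
  show "DF2 x y = 0" if "k2 = 1" unfolding DF_def F_eq_0(2)[OF that] by simp
qed

text \<open>The derivative of the constant expression F u'(\<rho>) |x|^2, in the shape that
  \<open>block_lagrangian\<close> takes.\<close>

lemma DF_relation:
  assumes "(x $ i)\<^sup>2 + (x $ j)\<^sup>2 > 0"
  shows "DF c i j x y * (((x $ i)\<^sup>2 + (x $ j)\<^sup>2) * deriv u (\<rho> x)) =
    - F c i j x * (2 * deriv u (\<rho> x) * (x $ i * y $ i + x $ j * y $ j) +
      ((x $ i)\<^sup>2 + (x $ j)\<^sup>2) * deriv (deriv u) (\<rho> x) * D\<rho> x y)"
proof -
  define w where "w = (x $ i)\<^sup>2 + (x $ j)\<^sup>2"
  have "w > 0" using assms by (simp add: w_def)
  then have "inverse (deriv u (\<rho> x) * w) * (w * deriv u (\<rho> x)) = 1" using du_pos[of x] by (simp add: field_simps)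
  then have "DF c i j x y * (w * deriv u (\<rho> x)) = - F c i j x * (deriv (deriv u) (\<rho> x) * D\<rho> x y * w +
      deriv u (\<rho> x) * (2 * (x $ i * y $ i + x $ j * y $ j)))"
    unfolding DF_def w_def[symmetric] by (simp add: mult_ac)
  then show ?thesis unfolding w_def[symmetric] by (simp add: algebra_simps)
qed

section \<open>Regularity and derivatives of the graph functions\<close>

lemma du_smooth: "\<exists>A. open A \<and> {1..} \<subseteq> A \<and> (\<forall>k. Ck_on k A (deriv u))"
  using smooth_from_1_deriv(1)[OF stenzel_potential_smooth[OF pot]]
  unfolding smooth_from_1_def smooth_on_def by blast

lemma Ck_on_square: "Ck_on n A (\<lambda>x::real^7. (x $ i)\<^sup>2)"
  unfolding power2_eq_square by (rule Ck_on_mult[OF Ck_on_nth Ck_on_nth])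

lemma Ck_on_\<rho>: "Ck_on n A \<rho>"
  unfolding \<rho>_def[abs_def]
  by (intro Ck_on_add[OF Ck_on_const] Ck_on_mult[OF Ck_on_const]
      Ck_on_add[OF Ck_on_mult[OF Ck_on_const Ck_on_add[OF Ck_on_square Ck_on_square]]
        Ck_on_mult[OF Ck_on_const Ck_on_add[OF Ck_on_square Ck_on_square]]])

lemma Ck_on_du: "Ck_on n A (\<lambda>x. deriv u (\<rho> x))"
proof -
  obtain B where "{1..} \<subseteq> B" "\<forall>k. Ck_on k B (deriv u)" using du_smooth by blast
  then show ?thesis
    by (intro Ck_on_compose_real[of n B "deriv u" A \<rho>] Ck_on_\<rho>) (use \<rho>_ge_1 in auto)
qed

lemma Ck_on_F:
  assumes "\<And>x. x \<in> S \<Longrightarrow> (x $ i)\<^sup>2 + (x $ j)\<^sup>2 > 0"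
  shows "Ck_on n S (F c i j)"
proof -
  have "Ck_on n S (\<lambda>x. inverse (deriv u (\<rho> x) * ((x $ i)\<^sup>2 + (x $ j)\<^sup>2)))"
    by (rule Ck_on_inverse_compose[OF Ck_on_mult[OF Ck_on_du Ck_on_add[OF Ck_on_square Ck_on_square]]])
      (rule less_imp_neq[THEN not_sym], intro mult_pos_pos du_pos assms)
  then show ?thesis unfolding F_def[abs_def] by (rule Ck_on_mult[OF Ck_on_const])
qed

lemma Ck_on_F1: "Ck_on n S F1" and Ck_on_F2: "Ck_on n S F2"
  by (rule Ck_on_F, simp add: S_def)+

lemma has_derivative_F:
  assumes "(x $ i)\<^sup>2 + (x $ j)\<^sup>2 > 0"
  shows "(F c i j has_derivative DF c i j x) (at x)"
proof -
  note nth = bounded_linear.has_derivative[OF bounded_linear_vec_nth has_derivative_ident]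
  have D\<rho>: "(\<rho> has_derivative D\<rho> x) (at x)"
    unfolding \<rho>_def[abs_def] D\<rho>_def[abs_def]
    by (auto intro!: derivative_eq_intros nth simp: fun_eq_iff algebra_simps)
  have "(deriv u has_real_derivative deriv (deriv u) (\<rho> x)) (at (\<rho> x))"
    by (rule smooth_from_1_deriv(2)[OF smooth_from_1_deriv(1)[OF stenzel_potential_smooth[OF pot]] \<rho>_ge_1])
  from has_derivative_compose[OF D\<rho> this[unfolded has_field_derivative_def]]
  have du: "((\<lambda>x. deriv u (\<rho> x)) has_derivative (\<lambda>y. deriv (deriv u) (\<rho> x) * D\<rho> x y)) (at x)" .
  have sq: "((\<lambda>x. (x $ i)\<^sup>2 + (x $ j)\<^sup>2) has_derivative (\<lambda>y. 2 * (x $ i * y $ i + x $ j * y $ j))) (at x)"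
    by (auto intro!: derivative_eq_intros nth simp: fun_eq_iff algebra_simps)
  have nz: "deriv u (\<rho> x) * ((x $ i)\<^sup>2 + (x $ j)\<^sup>2) \<noteq> 0"
    by (rule less_imp_neq[THEN not_sym, OF mult_pos_pos[OF du_pos assms]])
  from has_derivative_mult_right[OF Deriv.has_derivative_inverse[OF nz has_derivative_mult[OF du sq]], of "c / 2"]
  show ?thesis
    unfolding F_def[abs_def] by (rule has_derivative_eq_rhs) (simp add: fun_eq_iff DF_def F_def algebra_simps)
qed

lemma DP_simps: "DP x y $ 1 = - (DF1 x y * x $ 2 + F1 x * y $ 2)" "DP x y $ 2 = DF1 x y * x $ 1 + F1 x * y $ 1"
    "DP x y $ 3 = - (DF2 x y * x $ 4 + F2 x * y $ 4)" "DP x y $ 4 = DF2 x y * x $ 3 + F2 x * y $ 3"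
    "DP x y $ 5 = 0" "DP x y $ 6 = 0" "DP x y $ 7 = 0"
  by (simp_all add: DP_def)

lemma P_simps: "P x $ 1 = - (F1 x * x $ 2)" "P x $ 2 = F1 x * x $ 1"
    "P x $ 3 = - (F2 x * x $ 4)" "P x $ 4 = F2 x * x $ 3" "P x $ 5 = 0" "P x $ 6 = 0" "P x $ 7 = 0"
  by (simp_all add: P_def)

lemma has_derivative_P:
  assumes "x \<in> S"
  shows "(P has_derivative DP x) (at x)"
proof -
  note nth = bounded_linear.has_derivative[OF bounded_linear_vec_nth has_derivative_ident]
  have F: "(F1 has_derivative DF1 x) (at x)" "(F2 has_derivative DF2 x) (at x)"
    using assms by (auto intro!: has_derivative_F simp: S_def)
  have 1: "((\<lambda>x. P x $ j) has_derivative (\<lambda>y. DP x y $ j)) (at x)" for j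
  proof -
    have m: "((\<lambda>x. f x * x $ i) has_derivative (\<lambda>y. f' y * x $ i + f x * y $ i)) (at x)"
      "((\<lambda>x. - (f x * x $ i)) has_derivative (\<lambda>y. - (f' y * x $ i + f x * y $ i))) (at x)"
      if f: "(f has_derivative f') (at x)" for f f' and i :: 7
      using has_derivative_mult[OF f nth[of i]] has_derivative_minus[OF has_derivative_mult[OF f nth[of i]]]
      by (simp_all only: add.commute)
    show ?thesis
      using exhaust_7[of j] by (elim disjE) (simp_all only: P_simps DP_simps m F has_derivative_const)
  qed
  have P: "P = (\<lambda>x. \<Sum>j\<in>UNIV. P x $ j *\<^sub>R axis j 1)" and DP: "DP x = (\<lambda>y. \<Sum>j\<in>UNIV. DP x y $ j *\<^sub>R axis j 1)"
    by (simp_all add: fun_eq_iff sum_axis_real)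
  show ?thesis
    by (subst P, subst DP, rule has_derivative_sum, rule has_derivative_scaleR_left[OF 1])
qed

definition \<tau> :: "real^7 \<Rightarrow> real^7 \<Rightarrow> complex^7" where
  "\<tau> x y = (\<chi> j. k j * of_real (y $ j) + of_real (DP x y $ j))"

lemma \<tau>_simps: "\<tau> x y $ j = k j * of_real (y $ j) + of_real (DP x y $ j)"
  by (simp add: \<tau>_def)

text \<open>The points over \<open>x\<close>, before the coordinate \<open>x\<^sub>a\<close> has been solved for.\<close>

definition over :: "real^7 \<Rightarrow> complex^7 \<Rightarrow> bool" where
  "over x z \<longleftrightarrow> (\<forall>j\<in>{1, 2, 3, 4}. z $ j = k j * of_real (x $ j) + of_real (P x $ j)) \<and>
     (\<forall>j\<in>{5, 6, 7}. Im (z $ j) = 0)"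

lemma over_ReIm:
  assumes "over x z"
  shows "Im (z $ 1) = Im k1 * x $ 1" "Im (z $ 2) = Im k1 * x $ 2" "Im (z $ 3) = Im k2 * x $ 3" "Im (z $ 4) = Im k2 * x $ 4"
    "Im (z $ 5) = 0" "Im (z $ 6) = 0" "Im (z $ 7) = 0"
    "Re (z $ 1) = Re k1 * x $ 1 - F1 x * x $ 2" "Re (z $ 2) = Re k1 * x $ 2 + F1 x * x $ 1"
    "Re (z $ 3) = Re k2 * x $ 3 - F2 x * x $ 4" "Re (z $ 4) = Re k2 * x $ 4 + F2 x * x $ 3"
  using assms by (simp_all add: over_def P_simps)

text \<open>\<open>Im k1\<close> and \<open>Im k2\<close> equal their squares, so the imaginary
  parts over \<open>x\<close> add up to exactly \<rho>. This is what makes the level equations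
  explicit.\<close>

lemma over_rsq:
  assumes "over x z" "z \<in> quadric"
  shows "rsq z = \<rho> x"
proof -
  have sq: "(Im k1)\<^sup>2 = Im k1" "(Im k2)\<^sup>2 = Im k2" using k1(1) k2(1) by auto
  show ?thesis
    unfolding quadric_Re_Im(3)[OF assms(2)] sum_7 over_ReIm[OF assms(1)] \<rho>_def power_mult_distrib sq
    by (simp add: algebra_simps)
qed

text \<open>Coordinates 5, 6, 7 contribute no imaginary parts, and tangency turns the real part of
  the Hermitian product with z into half the derivative of \<rho>. The imaginary part of
  \<open>hermitian\<close> then splits into one \<open>block_lagrangian\<close> expression per
  plane.\<close>

lemma lagrangian_over:
  assumes x: "x \<in> S" and z: "over x z" "z \<in> quadric"
    and y: "cdot z (\<tau> x y) = 0" and y': "cdot z (\<tau> x y') = 0"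
  shows "stenzel_form u z (\<tau> x y) (\<tau> x y') = 0"
proof -
  let ?v = "deriv u (\<rho> x)" and ?w = "deriv (deriv u) (\<rho> x)"
  let ?A = "\<lambda>y. x $ 1 * y $ 2 - x $ 2 * y $ 1" and ?B = "\<lambda>y. x $ 3 * y $ 4 - x $ 4 * y $ 3"
  \<comment> \<open>F and its derivative are nonzero only where the factor is i, so multiplication
    by Im k leaves them unchanged and multiplication by Re k kills them.\<close>
  have Rek: "Re k1 * F1 x = 0" "Re k2 * F2 x = 0" "Re k1 * DF1 x y = 0" "Re k2 * DF2 x y = 0" "Im k1 * F1 x = F1 x" "Im k2 * F2 x = F2 x"
    "Im k1 * DF1 x y = DF1 x y" "Im k2 * DF2 x y = DF2 x y" for y
    using k1(1) k2(1) F_eq_0 DF_eq_0 by auto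
  have Rek0: "Re k1 * Im k1 = 0" "Re k2 * Im k2 = 0" "Im k1 * Im k1 = Im k1" "Im k2 * Im k2 = Im k2"
    using k1(1) k2(1) by auto
  note zs = over_ReIm[OF z(1)]
  have tI: "Im (\<tau> x y $ 1) = Im k1 * y $ 1" "Im (\<tau> x y $ 2) = Im k1 * y $ 2" "Im (\<tau> x y $ 3) = Im k2 * y $ 3"
     "Im (\<tau> x y $ 4) = Im k2 * y $ 4" "Im (\<tau> x y $ 5) = 0" "Im (\<tau> x y $ 6) = 0" "Im (\<tau> x y $ 7) = 0"
    and tR: "Re (\<tau> x y $ 1) = Re k1 * y $ 1 - (DF1 x y * x $ 2 + F1 x * y $ 2)" "Re (\<tau> x y $ 2) = Re k1 * y $ 2 + (DF1 x y * x $ 1 + F1 x * y $ 1)"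
     "Re (\<tau> x y $ 3) = Re k2 * y $ 3 - (DF2 x y * x $ 4 + F2 x * y $ 4)" "Re (\<tau> x y $ 4) = Re k2 * y $ 4 + (DF2 x y * x $ 3 + F2 x * y $ 3)" for y
    by (simp_all add: \<tau>_simps DP_simps)
  \<comment> \<open>For each coordinate the real part of conj(z) t is that of z t plus 2 Im z Im t,
    and the terms z t sum to 0 by tangency.\<close>
  have ReB: "Re (\<Sum>i\<in>UNIV. cnj (z $ i) * \<tau> x y $ i) = D\<rho> x y / 2" if "cdot z (\<tau> x y) = 0" for y
  proof -
    have "Re (\<Sum>i\<in>UNIV. cnj (z $ i) * \<tau> x y $ i) = Re (cdot z (\<tau> x y)) + 2 * (\<Sum>i\<in>UNIV. Im (z $ i) * Im (\<tau> x y $ i))"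
      by (simp add: cdot_def sum_distrib_left sum.distrib[symmetric] add.commute)
    also have "\<dots> = 2 * ((Im k1 * Im k1) * (x $ 1 * y $ 1 + x $ 2 * y $ 2) + (Im k2 * Im k2) * (x $ 3 * y $ 3 + x $ 4 * y $ 4))"
      unfolding that sum_7 zs tI by (simp add: algebra_simps)
    finally show ?thesis unfolding Rek0 D\<rho>_def by simp
  qed
  have ImB: "Im (\<Sum>i\<in>UNIV. cnj (z $ i) * \<tau> x y $ i) = 2 * F1 x * ?A y + 2 * F2 x * ?B y" for y
  proof -
    have "Im (\<Sum>i\<in>UNIV. cnj (z $ i) * \<tau> x y $ i) = (\<Sum>i\<in>UNIV. Re (z $ i) * Im (\<tau> x y $ i) - Im (z $ i) * Re (\<tau> x y $ i))"
      by simp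
    also have "\<dots> = 2 * (Im k1 * F1 x) * ?A y + 2 * (Im k2 * F2 x) * ?B y"
      unfolding sum_7 zs tI tR by (simp add: algebra_simps)
    finally show ?thesis unfolding Rek .
  qed
  have ImT: "Im (\<Sum>i\<in>UNIV. \<tau> x y $ i * cnj (\<tau> x y' $ i)) =
      (DF1 x y' * ?A y - DF1 x y * ?A y' + 2 * F1 x * (y $ 2 * y' $ 1 - y $ 1 * y' $ 2)) +
      (DF2 x y' * ?B y - DF2 x y * ?B y' + 2 * F2 x * (y $ 4 * y' $ 3 - y $ 3 * y' $ 4))"
  proof -
    have "Im (\<Sum>i\<in>UNIV. \<tau> x y $ i * cnj (\<tau> x y' $ i)) = (\<Sum>i\<in>UNIV. Im (\<tau> x y $ i) * Re (\<tau> x y' $ i) - Re (\<tau> x y $ i) * Im (\<tau> x y' $ i))"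
      by simp
    also have "\<dots> = ((Im k1 * DF1 x y') * ?A y - (Im k1 * DF1 x y) * ?A y' + 2 * (Im k1 * F1 x) * (y $ 2 * y' $ 1 - y $ 1 * y' $ 2)) +
      ((Im k2 * DF2 x y') * ?B y - (Im k2 * DF2 x y) * ?B y' + 2 * (Im k2 * F2 x) * (y $ 4 * y' $ 3 - y $ 3 * y' $ 4))"
      unfolding sum_7 tI tR by (simp add: algebra_simps)
    finally show ?thesis unfolding Rek .
  qed
  have gen: "Im (of_real v * T + of_real w * (b * cnj b')) = v * Im T + w * (Im b * Re b' - Re b * Im b')"
    for v w and T b b' :: complex
    by (simp add: algebra_simps)
  have "Im (hermitian u z (\<tau> x y) (\<tau> x y')) = ?v * Im (\<Sum>i\<in>UNIV. \<tau> x y $ i * cnj (\<tau> x y' $ i)) +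
      ?w * (Im (\<Sum>i\<in>UNIV. cnj (z $ i) * \<tau> x y $ i) * Re (\<Sum>i\<in>UNIV. cnj (z $ i) * \<tau> x y' $ i) -
        Re (\<Sum>i\<in>UNIV. cnj (z $ i) * \<tau> x y $ i) * Im (\<Sum>i\<in>UNIV. cnj (z $ i) * \<tau> x y' $ i))"
    unfolding hermitian_def over_rsq[OF z] by (rule gen)
  also have "\<dots> = (?v * (DF1 x y' * ?A y - DF1 x y * ?A y' + 2 * F1 x * (y $ 2 * y' $ 1 - y $ 1 * y' $ 2)) +
      ?w * (2 * F1 x * (?A y * (D\<rho> x y' / 2) - (D\<rho> x y / 2) * ?A y'))) +
      (?v * (DF2 x y' * ?B y - DF2 x y * ?B y' + 2 * F2 x * (y $ 4 * y' $ 3 - y $ 3 * y' $ 4)) +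
      ?w * (2 * F2 x * (?B y * (D\<rho> x y' / 2) - (D\<rho> x y / 2) * ?B y')))"
    unfolding ReB[OF y] ReB[OF y'] ImB ImT by (simp add: algebra_simps)
  also have "\<dots> = 0 + 0"
  proof (rule arg_cong2[of _ _ _ _ "(+)"])
    have s: "(x $ 1)\<^sup>2 + (x $ 2)\<^sup>2 > 0" "(x $ 3)\<^sup>2 + (x $ 4)\<^sup>2 > 0" using x by (auto simp: S_def)
    show "?v * (DF1 x y' * ?A y - DF1 x y * ?A y' + 2 * F1 x * (y $ 2 * y' $ 1 - y $ 1 * y' $ 2)) +
      ?w * (2 * F1 x * (?A y * (D\<rho> x y' / 2) - (D\<rho> x y / 2) * ?A y')) = 0"
      by (rule block_lagrangian[OF s(1)]) (simp_all add: DF_relation[OF s(1)])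
    show "?v * (DF2 x y' * ?B y - DF2 x y * ?B y' + 2 * F2 x * (y $ 4 * y' $ 3 - y $ 3 * y' $ 4)) +
      ?w * (2 * F2 x * (?B y * (D\<rho> x y' / 2) - (D\<rho> x y / 2) * ?B y')) = 0"
      by (rule block_lagrangian[OF s(2)]) (simp_all add: DF_relation[OF s(2)])
  qed
  finally show ?thesis
    using stenzel_form_Im[OF stenzel_potential_smooth[OF pot] rsq_ge_1[OF z(2)]] by simp
qed

text \<open>The derivative sees \<open>y\<close> only through its radial components in the two
  planes, so it vanishes on the rotation fields. \<open>det_over\<close> depends on this.\<close>

lemma DF1_form:
  obtains \<alpha> \<beta> where "\<And>y. DF1 x y = \<alpha> * (x $ 1 * y $ 1 + x $ 2 * y $ 2) + \<beta> * (x $ 3 * y $ 3 + x $ 4 * y $ 4)"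
proof -
  let ?g = "- F1 x * inverse (deriv u (\<rho> x) * ((x $ 1)\<^sup>2 + (x $ 2)\<^sup>2))"
  let ?w = "deriv (deriv u) (\<rho> x) * ((x $ 1)\<^sup>2 + (x $ 2)\<^sup>2) * 4"
  have "DF1 x y = (?g * (?w * Im k1 + 2 * deriv u (\<rho> x))) * (x $ 1 * y $ 1 + x $ 2 * y $ 2) +
      (?g * (?w * Im k2)) * (x $ 3 * y $ 3 + x $ 4 * y $ 4)" for y
    unfolding DF_def D\<rho>_def by algebra
  then show ?thesis by (rule that)
qed

lemma DF2_form:
  obtains \<alpha> \<beta> where "\<And>y. DF2 x y = \<alpha> * (x $ 1 * y $ 1 + x $ 2 * y $ 2) + \<beta> * (x $ 3 * y $ 3 + x $ 4 * y $ 4)"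
proof -
  let ?g = "- F2 x * inverse (deriv u (\<rho> x) * ((x $ 3)\<^sup>2 + (x $ 4)\<^sup>2))"
  let ?w = "deriv (deriv u) (\<rho> x) * ((x $ 3)\<^sup>2 + (x $ 4)\<^sup>2) * 4"
  have "DF2 x y = (?g * (?w * Im k1)) * (x $ 1 * y $ 1 + x $ 2 * y $ 2) +
      (?g * (?w * Im k2 + 2 * deriv u (\<rho> x))) * (x $ 3 * y $ 3 + x $ 4 * y $ 4)" for y
    unfolding DF_def D\<rho>_def by algebra
  then show ?thesis by (rule that)
qed

text \<open>The rotation fields \<open>N 2\<close> and \<open>N 4\<close> are \<open>k\<^sub>1\<close> and \<open>k\<^sub>2\<close> times real vectors in the complex basis formed by
  \<open>J\<sigma>\<close> and \<open>k\<sigma>\<close> on each of the two planes, and all other rows are real in that basis.\<close>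

lemma det_over:
  assumes x: "x \<in> S" and z: "over x z" "z \<in> quadric" and a: "a \<in> {5, 6, 7}" "z $ a \<noteq> 0"
    and tan: "\<And>j. j \<noteq> a \<Longrightarrow> cdot z (\<tau> x (y j)) = 0"
    and yd: "\<And>j k. j \<noteq> a \<Longrightarrow> k \<noteq> a \<Longrightarrow> y j $ k = (if j = k then 1 else 0)"
  shows "Im (det ((\<chi> j. if j = a then z else \<tau> x (y j)) :: complex^7^7)) = 0"
proof -
  obtain \<alpha>1 \<beta>1 where D1: "\<And>y. DF1 x y = \<alpha>1 * (x $ 1 * y $ 1 + x $ 2 * y $ 2) + \<beta>1 * (x $ 3 * y $ 3 + x $ 4 * y $ 4)"
    using DF1_form[of x] by blast
  obtain \<alpha>2 \<beta>2 where D2: "\<And>y. DF2 x y = \<alpha>2 * (x $ 1 * y $ 1 + x $ 2 * y $ 2) + \<beta>2 * (x $ 3 * y $ 3 + x $ 4 * y $ 4)"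
    using DF2_form[of x] by blast
  define s1 s2 where "s1 = (x $ 1)\<^sup>2 + (x $ 2)\<^sup>2" and "s2 = (x $ 3)\<^sup>2 + (x $ 4)\<^sup>2"
  have s: "s1 > 0" "s2 > 0" using x by (auto simp: S_def s1_def s2_def)
  define x1 x2 x3 x4 f1 f2 where xs: "x1 = x $ 1" "x2 = x $ 2" "x3 = x $ 3" "x4 = x $ 4" "f1 = F1 x" "f2 = F2 x"
  \<comment> \<open>F = 0 unless the factor is i, whose square is -1.\<close>
  have kf: "k1 * k1 * of_real f1 = - of_real f1" "k2 * k2 * of_real f2 = - of_real f2"
    using k1(1) k2(1) F_eq_0 by (auto simp: xs)
  define M where "M j = (if j = a then z else \<tau> x (y j))" for j
  \<comment> \<open>In each plane the two coordinate fields are replaced by the radial field and the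
    rotation field, a real change of rows, which is harmless for the phase.\<close>
  define N where "N j = (if j = 1 then of_real x1 *s M 1 + of_real x2 *s M 2 else
    if j = 2 then of_real (- x2) *s M 1 + of_real x1 *s M 2 else
    if j = 3 then of_real x3 *s M 3 + of_real x4 *s M 4 else
    if j = 4 then of_real (- x4) *s M 3 + of_real x3 *s M 4 else M j)" for j
  define p1 q1 p2 q2 where "p1 = x1 / s1" and "q1 = x2 / s1" and "p2 = x3 / s2" and "q2 = x4 / s2"
  \<comment> \<open>The inverse of that change of rows: in each plane a rotation scaled by
    1/|x|.\<close>
  define C :: "real^7^7" where "C = vector
    [vector [p1, - q1, 0, 0, 0, 0, 0], vector [q1, p1, 0, 0, 0, 0, 0],
     vector [0, 0, p2, - q2, 0, 0, 0], vector [0, 0, q2, p2, 0, 0, 0],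
     axis 5 1, axis 6 1, axis 7 1]"
  \<comment> \<open>In each plane the basis Jx, x; the factors \<open>r\<close> below multiply the
    second vector by \<open>k1\<close> or \<open>k2\<close>.\<close>
  define R :: "real^7^7" where "R = vector
    [vector [- x2, x1, 0, 0, 0, 0, 0], vector [x1, x2, 0, 0, 0, 0, 0],
     vector [0, 0, - x4, x3, 0, 0, 0], vector [0, 0, x3, x4, 0, 0, 0],
     axis 5 1, axis 6 1, axis 7 1]"
  define l where "l j = (if j = a then vector [f1, 1, f2, 1, Re (z $ 5), Re (z $ 6), Re (z $ 7)]
    else vector [0, 0, 0, 0, y j $ 5, y j $ 6, y j $ 7] :: real^7)" for j
  define L :: "real^7^7" where "L = vector
    [vector [\<alpha>1 * s1 + f1, 1, \<alpha>2 * s1, 0, x1 * y 1 $ 5 + x2 * y 2 $ 5, x1 * y 1 $ 6 + x2 * y 2 $ 6, x1 * y 1 $ 7 + x2 * y 2 $ 7],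
     vector [1, f1, 0, 0, 0, 0, 0],
     vector [\<beta>1 * s2, 0, \<beta>2 * s2 + f2, 1, x3 * y 3 $ 5 + x4 * y 4 $ 5, x3 * y 3 $ 6 + x4 * y 4 $ 6, x3 * y 3 $ 7 + x4 * y 4 $ 7],
     vector [0, 0, 1, f2, 0, 0, 0],
     l 5, l 6, l 7]"
  define r where "r j = (if j = 2 then k1 else if j = 4 then k2 else 1)" for j :: 7
  have a4: "a \<noteq> 1" "a \<noteq> 2" "a \<noteq> 3" "a \<noteq> 4" "1 \<noteq> a" "2 \<noteq> a" "3 \<noteq> a" "4 \<noteq> a" using a(1) by auto
  have MC: "M j = (\<Sum>k\<in>UNIV. of_real (C $ j $ k) *s N k)" for j
  proof -
    have pq: "p1 * x1 + q1 * x2 = 1" "p2 * x3 + q2 * x4 = 1"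
      using s by (simp_all add: p1_def q1_def p2_def q2_def add_divide_distrib[symmetric])
        (simp_all add: s1_def s2_def xs power2_eq_square)
    have pq': "p1 * x2 = q1 * x1" "p2 * x4 = q2 * x3"
      by (simp_all add: p1_def q1_def p2_def q2_def)
    have rot: "of_real p *s (of_real x *s m + of_real y *s n) + of_real (- q) *s (of_real (- y) *s m + of_real x *s n) = m"
      "of_real q *s (of_real x *s m + of_real y *s n) + of_real p *s (of_real (- y) *s m + of_real x *s n) = n"
      if "p * x + q * y = 1" "p * y = q * x" for p q x y and m n :: "complex^7"
    proof -
      have "of_real p *s (of_real x *s m + of_real y *s n) + of_real (- q) *s (of_real (- y) *s m + of_real x *s n)
          = of_real (p * x + q * y) *s m + of_real (p * y - q * x) *s n"
        "of_real q *s (of_real x *s m + of_real y *s n) + of_real p *s (of_real (- y) *s m + of_real x *s n)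
          = of_real (q * x - p * y) *s m + of_real (p * x + q * y) *s n"
        by (simp_all add: vec_eq_iff algebra_simps)
      then show "of_real p *s (of_real x *s m + of_real y *s n) + of_real (- q) *s (of_real (- y) *s m + of_real x *s n) = m"
        "of_real q *s (of_real x *s m + of_real y *s n) + of_real p *s (of_real (- y) *s m + of_real x *s n) = n"
        unfolding that by simp_all
    qed
    have Ns: "N 1 = of_real x1 *s M 1 + of_real x2 *s M 2" "N 2 = of_real (- x2) *s M 1 + of_real x1 *s M 2"
      "N 3 = of_real x3 *s M 3 + of_real x4 *s M 4" "N 4 = of_real (- x4) *s M 3 + of_real x3 *s M 4"
      by (simp_all add: N_def)
    have sums: "(\<Sum>k\<in>UNIV. of_real (C $ 1 $ k) *s N k) = of_real p1 *s N 1 + of_real (- q1) *s N 2"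
      "(\<Sum>k\<in>UNIV. of_real (C $ 2 $ k) *s N k) = of_real q1 *s N 1 + of_real p1 *s N 2"
      "(\<Sum>k\<in>UNIV. of_real (C $ 3 $ k) *s N k) = of_real p2 *s N 3 + of_real (- q2) *s N 4"
      "(\<Sum>k\<in>UNIV. of_real (C $ 4 $ k) *s N k) = of_real q2 *s N 3 + of_real p2 *s N 4"
      by (simp_all add: sum_7 C_def)
    consider "j = 1" | "j = 2" | "j = 3" | "j = 4" | "j = 5" | "j = 6" | "j = 7" using exhaust_7[of j] by blast
    then show ?thesis
    proof cases
      case 1 show ?thesis unfolding 1 sums Ns rot[OF pq(1) pq'(1)] ..
    next
      case 2 show ?thesis unfolding 2 sums Ns rot[OF pq(1) pq'(1)] ..
    next
      case 3 show ?thesis unfolding 3 sums Ns rot[OF pq(2) pq'(2)] ..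
    next
      case 4 show ?thesis unfolding 4 sums Ns rot[OF pq(2) pq'(2)] ..
    qed (simp_all add: sum_7 C_def N_def axis_def)
  qed
  have y4: "y 1 $ 1 = 1" "y 1 $ 2 = 0" "y 1 $ 3 = 0" "y 1 $ 4 = 0" "y 2 $ 1 = 0" "y 2 $ 2 = 1" "y 2 $ 3 = 0" "y 2 $ 4 = 0"
    "y 3 $ 1 = 0" "y 3 $ 2 = 0" "y 3 $ 3 = 1" "y 3 $ 4 = 0" "y 4 $ 1 = 0" "y 4 $ 2 = 0" "y 4 $ 3 = 0" "y 4 $ 4 = 1"
    using a4 by (simp_all add: yd)
  have y0: "y j $ k = 0" if "j \<in> {1, 2, 3, 4}" "k \<noteq> a" "k \<in> {5, 6, 7}" for j k
    using yd[of j k] that a4 by auto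
  have y5: "y j $ 1 = 0" "y j $ 2 = 0" "y j $ 3 = 0" "y j $ 4 = 0" if "j \<in> {5, 6, 7}" "j \<noteq> a" for j
    using yd[of j] that a4 by auto
  have M4: "M 1 = \<tau> x (y 1)" "M 2 = \<tau> x (y 2)" "M 3 = \<tau> x (y 3)" "M 4 = \<tau> x (y 4)"
    using a4 by (simp_all add: M_def)
  have zs: "z $ 1 = k1 * of_real x1 - of_real (f1 * x2)" "z $ 2 = k1 * of_real x2 + of_real (f1 * x1)"
    "z $ 3 = k2 * of_real x3 - of_real (f2 * x4)" "z $ 4 = k2 * of_real x4 + of_real (f2 * x3)"
    using z(1) by (simp_all add: over_def P_simps xs)
  have N2: "N 2 $ 1 = - k1 * of_real x2 - of_real (f1 * x1)" "N 2 $ 2 = k1 * of_real x1 - of_real (f1 * x2)"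
    "N 2 $ 3 = 0" "N 2 $ 4 = 0"
    "N 2 $ 5 = of_real (x1 * y 2 $ 5 - x2 * y 1 $ 5)" "N 2 $ 6 = of_real (x1 * y 2 $ 6 - x2 * y 1 $ 6)"
    "N 2 $ 7 = of_real (x1 * y 2 $ 7 - x2 * y 1 $ 7)"
    by (simp_all add: N_def M4 \<tau>_simps DP_simps D1 D2 y4 xs[symmetric] algebra_simps)
  have N4: "N 4 $ 1 = 0" "N 4 $ 2 = 0" "N 4 $ 3 = - k2 * of_real x4 - of_real (f2 * x3)" "N 4 $ 4 = k2 * of_real x3 - of_real (f2 * x4)"
    "N 4 $ 5 = of_real (x3 * y 4 $ 5 - x4 * y 3 $ 5)" "N 4 $ 6 = of_real (x3 * y 4 $ 6 - x4 * y 3 $ 6)"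
    "N 4 $ 7 = of_real (x3 * y 4 $ 7 - x4 * y 3 $ 7)"
    by (simp_all add: N_def M4 \<tau>_simps DP_simps D1 D2 y4 xs[symmetric] algebra_simps)
  \<comment> \<open>On the planes the bilinear product of z with a rotation field cancels, so
    tangency leaves z_a times its entry at \<open>a\<close>. As z_a is nonzero, the rotation fields
    have no components in the last three coordinates.\<close>
  have G: "x1 * y 2 $ k = x2 * y 1 $ k" "x3 * y 4 $ k = x4 * y 3 $ k" if k: "k \<in> {5, 6, 7}" for k
  proof -
    have t: "cdot z (N 2) = 0" "cdot z (N 4) = 0"
      using tan a4 by (simp_all add: N_def M4)
    have "cdot z (N 2) = z $ 5 * N 2 $ 5 + z $ 6 * N 2 $ 6 + z $ 7 * N 2 $ 7"
      by (simp add: cdot_def sum_7 zs N2(1-4)) (simp add: algebra_simps)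
    moreover have "cdot z (N 4) = z $ 5 * N 4 $ 5 + z $ 6 * N 4 $ 6 + z $ 7 * N 4 $ 7"
      by (simp add: cdot_def sum_7 zs N4(1-4)) (simp add: algebra_simps)
    moreover have "z $ 5 * of_real (x1 * y 2 $ 5 - x2 * y 1 $ 5) + z $ 6 * of_real (x1 * y 2 $ 6 - x2 * y 1 $ 6) + z $ 7 * of_real (x1 * y 2 $ 7 - x2 * y 1 $ 7)
       = z $ a * of_real (x1 * y 2 $ a - x2 * y 1 $ a)"
      "z $ 5 * of_real (x3 * y 4 $ 5 - x4 * y 3 $ 5) + z $ 6 * of_real (x3 * y 4 $ 6 - x4 * y 3 $ 6) + z $ 7 * of_real (x3 * y 4 $ 7 - x4 * y 3 $ 7)
       = z $ a * of_real (x3 * y 4 $ a - x4 * y 3 $ a)"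
      using a(1) y0[of 1] y0[of 2] y0[of 3] y0[of 4] by auto
    ultimately have "z $ a * of_real (x1 * y 2 $ a - x2 * y 1 $ a) = 0" "z $ a * of_real (x3 * y 4 $ a - x4 * y 3 $ a) = 0"
      using t unfolding N2 N4 by simp_all
    then have "x1 * y 2 $ a = x2 * y 1 $ a" "x3 * y 4 $ a = x4 * y 3 $ a"
      using a(2) unfolding mult_eq_0_iff of_real_eq_0_iff by simp_all
    then show "x1 * y 2 $ k = x2 * y 1 $ k" "x3 * y 4 $ k = x4 * y 3 $ k"
      using k y0[of 1 k] y0[of 2 k] y0[of 3 k] y0[of 4 k] by (cases "k = a"; simp)+
  qed
  have NL: "N j = r j *s (\<Sum>k\<in>UNIV. of_real (L $ j $ k) *s (r k *s cvec (R $ k)))" for j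
  proof -
    have kf': "k1 * (k1 * (of_real f1 * w)) = - (of_real f1 * w)" "k2 * (k2 * (of_real f2 * w)) = - (of_real f2 * w)" for w
      using kf by (metis (no_types, lifting) mult.assoc mult_minus_left)+
    consider "j = 1" | "j = 2" | "j = 3" | "j = 4" | "j \<in> {5, 6, 7}" using exhaust_7[of j] by blast
    then show ?thesis
    proof cases
      case 1
      show ?thesis unfolding 1
        by (simp add: vec_eq_iff forall_7 sum_7 L_def R_def r_def cvec_def axis_def N_def M4 \<tau>_simps DP_simps D1 D2 y4 xs[symmetric])
          (simp add: s1_def xs[symmetric] power2_eq_square algebra_simps)
    next
      case 2
      show ?thesis unfolding 2
        by (simp add: vec_eq_iff forall_7 sum_7 L_def R_def r_def cvec_def axis_def N2 G)
          (simp add: kf' algebra_simps)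
    next
      case 3
      show ?thesis unfolding 3
        by (simp add: vec_eq_iff forall_7 sum_7 L_def R_def r_def cvec_def axis_def N_def M4 \<tau>_simps DP_simps D1 D2 y4 xs[symmetric])
          (simp add: s2_def xs[symmetric] power2_eq_square algebra_simps)
    next
      case 4
      show ?thesis unfolding 4
        by (simp add: vec_eq_iff forall_7 sum_7 L_def R_def r_def cvec_def axis_def N4 G)
          (simp add: kf' algebra_simps)
    next
      case 5
      then have Lj: "L $ j = l j" and rj: "r j = 1" and Nj: "N j = M j" by (auto simp: L_def r_def N_def)
      show ?thesis
      proof (cases "j = a")
        case True
        have "Im (z $ 5) = 0" "Im (z $ 6) = 0" "Im (z $ 7) = 0" using z(1) by (auto simp: over_def)
        then show ?thesis
          unfolding Lj rj Nj unfolding True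
          by (simp add: M_def vec_eq_iff forall_7 sum_7 l_def R_def r_def cvec_def axis_def zs algebra_simps complex_eq_iff)
      next
        case False
        then show ?thesis
          unfolding Lj rj Nj using y5[OF 5 False]
          by (simp add: M_def vec_eq_iff forall_7 sum_7 l_def R_def r_def cvec_def axis_def \<tau>_simps DP_simps D1 D2)
      qed
    qed
  qed
  have "Im (det ((\<chi> j. N j) :: complex^7^7)) = 0"
  proof (rule Im_det_eq_0[OF NL])
    \<comment> \<open>The factors occur once on the rows and once in the basis, so the phase is that
      of (k1 k2)^2, which is 1 or -1.\<close>
    have "(\<Prod>j\<in>UNIV. r j) = k1 * k2" unfolding UNIV_7 by (simp add: r_def)
    then show "Im ((\<Prod>j\<in>UNIV. r j) * (\<Prod>j\<in>UNIV. r j)) = 0" using k1(1) k2(1) by auto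
  qed
  then show ?thesis
    using det_real_combination[OF MC] unfolding M_def by simp
qed

text \<open>The condition \<open>kp\<close> places \<open>p\<close> over the domain
  \<open>S\<close>, away from the poles of F in either plane.\<close>

lemma admissible_chart_moment:
  assumes p: "p \<in> moment_set u c1 c2"
    and kp: "Re (cnj k1 * p $ 1) \<noteq> 0 \<or> Re (cnj k1 * p $ 2) \<noteq> 0" "Re (cnj k2 * p $ 3) \<noteq> 0 \<or> Re (cnj k2 * p $ 4) \<noteq> 0"
  shows "\<exists>W \<phi>. admissible_chart u 1 (moment_set u c1 c2) W \<phi> \<and> p \<in> \<phi> ` W"
proof -
  obtain a where a: "a \<in> {5, 6, 7}" "Re (p $ a) \<noteq> 0"
    using p unfolding moment_set_def by (auto simp: complex_eq_iff)
  define s where "s = sgn (Re (p $ a))"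
  \<comment> \<open>What the equation of the quadric leaves for the square of Re z_a: 1 plus the
    squared imaginary parts minus the squared real parts of the other coordinates.\<close>
  define T where "T x = 1 + (\<Sum>j\<in>{1, 2, 3, 4}. (Im (k j) * x $ j)\<^sup>2 - (Re (k j) * x $ j + P x $ j)\<^sup>2) - (\<Sum>j\<in>{5, 6, 7} - {a}. (x $ j)\<^sup>2)" for x
  let ?\<pi> = "\<lambda>z::complex^7. (\<chi> j. if j = a then 0 else Re (cnj (k j) * z $ j)) :: real^7"
  have a4: "a \<noteq> 1" "a \<noteq> 2" "a \<noteq> 3" "a \<noteq> 4" "1 \<noteq> a" "2 \<noteq> a" "3 \<noteq> a" "4 \<noteq> a" using a(1) by auto
  have k5: "k j = 1" "P x $ j = 0" if "j \<in> {5, 6, 7}" for j x using that by (auto simp: P_simps)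
  have P0: "P x $ j = 0" if kj: "k j = 1" for x j
  proof -
    consider "j \<in> {1, 2}" | "j \<in> {3, 4}" | "j \<in> {5, 6, 7}" using exhaust_7[of j] by blast
    then show ?thesis
    proof cases
      case 1
      then have "k1 = 1" using kj by auto
      from F_eq_0(1)[OF this, of x] show ?thesis using 1 by (elim insertE) (simp_all only: P_simps, auto)
    next
      case 2
      then have "k2 = 1" using kj by auto
      from F_eq_0(2)[OF this, of x] show ?thesis using 2 by (elim insertE) (simp_all only: P_simps, auto)
    qed (rule k5)
  qed
  have kc: "k j = 1 \<or> k j = \<i>" for j using k1(1) k2(1) by (auto simp: k_def)
  have CP: "Ck_on n S (\<lambda>x. P x $ j)" for n j
    using exhaust_7[of j] Ck_on_mult[OF Ck_on_F1 Ck_on_nth, of n] Ck_on_mult[OF Ck_on_F2 Ck_on_nth, of n]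
      Ck_on_minus[OF Ck_on_mult[OF Ck_on_F1 Ck_on_nth, of n]] Ck_on_minus[OF Ck_on_mult[OF Ck_on_F2 Ck_on_nth, of n]]
    by (elim disjE) (simp_all only: P_simps Ck_on_const)
  have over: "over (?\<pi> z) z" if z: "\<And>j. j \<noteq> a \<Longrightarrow> z $ j = k j * of_real (?\<pi> z $ j) + of_real (P (?\<pi> z) $ j)" and za: "Im (z $ a) = 0" for z
  proof -
    have "Im (z $ j) = 0" if j: "j \<in> {5, 6, 7}" for j
    proof (cases "j = a")
      case False
      from arg_cong[OF z[OF this], of Im] show ?thesis unfolding k5[OF j] by simp
    qed (use za in simp)
    moreover have "z $ j = k j * of_real (?\<pi> z $ j) + of_real (P (?\<pi> z) $ j)" if j: "j \<in> {1, 2, 3, 4}" for j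
      by (rule z) (use j a4 in auto)
    ultimately show ?thesis unfolding over_def by blast
  qed
  have graph: "z \<in> moment_set u c1 c2 \<longleftrightarrow>
      (\<forall>j. j \<noteq> a \<longrightarrow> z $ j = k j * of_real (?\<pi> z $ j) + of_real (P (?\<pi> z) $ j)) \<and>
      Im (z $ a) = 0 \<and> (Re (z $ a))\<^sup>2 = T (?\<pi> z)"
    if zS: "?\<pi> z \<in> S" and za: "s * Re (z $ a) > 0" for z
  proof -
    define x where "x = ?\<pi> z"
    have x: "x $ 1 = Re (cnj k1 * z $ 1)" "x $ 2 = Re (cnj k1 * z $ 2)" "x $ 3 = Re (cnj k2 * z $ 3)" "x $ 4 = Re (cnj k2 * z $ 4)"
      using a4 by (simp_all add: x_def)
    have x5: "x $ j = Re (z $ j)" if "j \<in> {5, 6, 7}" "j \<noteq> a" for j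
      using that by (auto simp: x_def)
    have pos: "(x $ 1)\<^sup>2 + (x $ 2)\<^sup>2 > 0" "(x $ 3)\<^sup>2 + (x $ 4)\<^sup>2 > 0" using zS by (auto simp: S_def x_def[symmetric])
    have Rea: "Re (z $ a) \<noteq> 0" using za by auto
    have nz5: "z $ 5 \<noteq> 0 \<or> z $ 6 \<noteq> 0 \<or> z $ 7 \<noteq> 0" using a(1) Rea by auto
    have nz1: "z $ 1 \<noteq> 0 \<or> z $ 2 \<noteq> 0" "z $ 3 \<noteq> 0 \<or> z $ 4 \<noteq> 0" using pos by (auto simp: x)
    \<comment> \<open>Here u' is taken at \<rho> x instead of rsq z. That the two values agree has
      to be shown separately, which is the reason for the case distinction on
      \<open>over x z\<close>.\<close>
    have b1: "(Re (z $ 1) * Im (z $ 1) + Re (z $ 2) * Im (z $ 2) = 0 \<and> - 2 * deriv u (\<rho> x) * Im (cnj (z $ 1) * z $ 2) = c1) \<longleftrightarrow>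
        (z $ 1 = k1 * of_real (x $ 1) + of_real (- (F1 x * x $ 2)) \<and> z $ 2 = k1 * of_real (x $ 2) + of_real (F1 x * x $ 1))"
      by (rule block_graph_iff[OF du_pos k1 x(1,2) pos(1)]) (simp_all add: F_def)
    have b2: "(Re (z $ 3) * Im (z $ 3) + Re (z $ 4) * Im (z $ 4) = 0 \<and> - 2 * deriv u (\<rho> x) * Im (cnj (z $ 3) * z $ 4) = c2) \<longleftrightarrow>
        (z $ 3 = k2 * of_real (x $ 3) + of_real (- (F2 x * x $ 4)) \<and> z $ 4 = k2 * of_real (x $ 4) + of_real (F2 x * x $ 3))"
      by (rule block_graph_iff[OF du_pos k2 x(3,4) pos(2)]) (simp_all add: F_def)
    have rest: "(\<forall>j. j \<noteq> a \<longrightarrow> z $ j = k j * of_real (x $ j) + of_real (P x $ j)) \<and> Im (z $ a) = 0 \<longleftrightarrow>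
        (z $ 1 = k1 * of_real (x $ 1) + of_real (- (F1 x * x $ 2)) \<and> z $ 2 = k1 * of_real (x $ 2) + of_real (F1 x * x $ 1)) \<and>
        (z $ 3 = k2 * of_real (x $ 3) + of_real (- (F2 x * x $ 4)) \<and> z $ 4 = k2 * of_real (x $ 4) + of_real (F2 x * x $ 3)) \<and>
        Im (z $ 5) = 0 \<and> Im (z $ 6) = 0 \<and> Im (z $ 7) = 0"
    proof -
      let ?E = "\<lambda>j. z $ j = k j * of_real (x $ j) + of_real (P x $ j)"
      have r5: "(j \<noteq> a \<longrightarrow> ?E j) \<longleftrightarrow> (j = a \<or> Im (z $ j) = 0)" if "j \<in> {5, 6, 7}" for j
        unfolding k5[OF that] using x5[OF that] by (auto simp: complex_eq_iff)
      have r: "(5 \<noteq> a \<longrightarrow> ?E 5) \<longleftrightarrow> (5 = a \<or> Im (z $ 5) = 0)" "(6 \<noteq> a \<longrightarrow> ?E 6) \<longleftrightarrow> (6 = a \<or> Im (z $ 6) = 0)"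
        "(7 \<noteq> a \<longrightarrow> ?E 7) \<longleftrightarrow> (7 = a \<or> Im (z $ 7) = 0)"
        by (rule r5, blast)+
      have e: "(\<forall>j. j \<noteq> a \<longrightarrow> ?E j) \<longleftrightarrow> (?E 1 \<and> ?E 2) \<and> (?E 3 \<and> ?E 4) \<and>
          (5 = a \<or> Im (z $ 5) = 0) \<and> (6 = a \<or> Im (z $ 6) = 0) \<and> (7 = a \<or> Im (z $ 7) = 0)"
        unfolding forall_7 r using a4 by blast
      have gen: "(A \<and> B \<and> (5 = a \<or> I 5) \<and> (6 = a \<or> I 6) \<and> (7 = a \<or> I 7)) \<and> I a \<longleftrightarrow> A \<and> B \<and> I 5 \<and> I 6 \<and> I 7"
        for A B and I :: "7 \<Rightarrow> bool"
        using a(1) by auto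
      show ?thesis
        unfolding e k_simps P_simps by (rule gen[where I = "\<lambda>j. Im (z $ j) = 0"])
    qed
    show ?thesis
    proof (cases "over x z")
      case True
      note ReIm = over_ReIm[OF True]
      have Q: "z \<in> quadric \<longleftrightarrow> (Re (z $ a))\<^sup>2 = T x"
      proof -
        have "Im (\<Sum>i\<in>UNIV. (z $ i)\<^sup>2) = 2 * (Re (z $ 1) * Im (z $ 1) + Re (z $ 2) * Im (z $ 2)) + 2 * (Re (z $ 3) * Im (z $ 3) + Re (z $ 4) * Im (z $ 4))"
          using ReIm by (simp add: sum_7 power2_eq_square)
        also have "\<dots> = 0"
          using b1 b2 True by (simp add: over_def P_simps)
        finally have im: "Im (\<Sum>i\<in>UNIV. (z $ i)\<^sup>2) = 0" .
        have "Re (\<Sum>i\<in>UNIV. (z $ i)\<^sup>2) = (Re (z $ 1))\<^sup>2 - (Im (z $ 1))\<^sup>2 + ((Re (z $ 2))\<^sup>2 - (Im (z $ 2))\<^sup>2) +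
          ((Re (z $ 3))\<^sup>2 - (Im (z $ 3))\<^sup>2) + ((Re (z $ 4))\<^sup>2 - (Im (z $ 4))\<^sup>2) + ((Re (z $ 5))\<^sup>2 + (Re (z $ 6))\<^sup>2 + (Re (z $ 7))\<^sup>2)"
          using ReIm(5-7) by (simp add: sum_7 power2_eq_square)
        also have "(Re (z $ 5))\<^sup>2 + (Re (z $ 6))\<^sup>2 + (Re (z $ 7))\<^sup>2 = (Re (z $ a))\<^sup>2 + (\<Sum>j\<in>{5, 6, 7} - {a}. (x $ j)\<^sup>2)"
        proof -
          have "(\<Sum>j\<in>{5, 6, 7::7}. (Re (z $ j))\<^sup>2) = (Re (z $ a))\<^sup>2 + (\<Sum>j\<in>{5, 6, 7} - {a}. (Re (z $ j))\<^sup>2)"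
            by (rule sum.remove) (use a(1) in auto)
          also have "(\<Sum>j\<in>{5, 6, 7} - {a}. (Re (z $ j))\<^sup>2) = (\<Sum>j\<in>{5, 6, 7} - {a}. (x $ j)\<^sup>2)"
            by (intro sum.cong refl) (use x5 in auto)
          finally show ?thesis by simp
        qed
        finally have re: "Re (\<Sum>i\<in>UNIV. (z $ i)\<^sup>2) = (Re (z $ a))\<^sup>2 - T x + 1"
          unfolding T_def ReIm by (simp add: P_simps algebra_simps)
        show ?thesis
          unfolding quadric_def mem_Collect_eq complex_eq_iff[of _ 1] im re by auto
      qed
      have b: "Re (z $ 1) * Im (z $ 1) + Re (z $ 2) * Im (z $ 2) = 0" "- 2 * deriv u (\<rho> x) * Im (cnj (z $ 1) * z $ 2) = c1"
        "Re (z $ 3) * Im (z $ 3) + Re (z $ 4) * Im (z $ 4) = 0" "- 2 * deriv u (\<rho> x) * Im (cnj (z $ 3) * z $ 4) = c2"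
        using b1 b2 True by (simp_all add: over_def P_simps)
      have "z \<in> moment_set u c1 c2 \<longleftrightarrow> z \<in> quadric"
        using nz5 nz1 b ReIm(5-7) over_rsq[OF True] unfolding moment_set_def by auto
      moreover have "(\<forall>j. j \<noteq> a \<longrightarrow> z $ j = k j * of_real (x $ j) + of_real (P x $ j)) \<and> Im (z $ a) = 0"
        unfolding rest using True by (simp add: over_def P_simps)
      ultimately show ?thesis
        using Q unfolding x_def by blast
    next
      case False
      have "\<not> ((\<forall>j. j \<noteq> a \<longrightarrow> z $ j = k j * of_real (x $ j) + of_real (P x $ j)) \<and> Im (z $ a) = 0)"
        using over[of z] False unfolding x_def by blast
      moreover have "z \<notin> moment_set u c1 c2"
      proof
        assume m: "z \<in> moment_set u c1 c2"
        \<comment> \<open>The imaginary parts are found without knowledge of r^2: for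
          \<open>kk\<close> = i they are the coordinates by definition, for \<open>kk\<close> = 1
          the level is 0 and the value of u' is immaterial. Then rsq z = \<rho> x, and
          \<open>b1\<close>, \<open>b2\<close> show that z lies over x after all.\<close>
        have k_im: "Im w1 = Im kk * y1 \<and> Im w2 = Im kk * y2"
          if kk: "kk = 1 \<or> kk = \<i>" "kk = 1 \<Longrightarrow> c = 0" and y: "y1 = Re (cnj kk * w1)" "y2 = Re (cnj kk * w2)" "y1\<^sup>2 + y2\<^sup>2 > 0"
            and h: "Re w1 * Im w1 + Re w2 * Im w2 = 0" "- 2 * deriv u (rsq z) * Im (cnj w1 * w2) = c" for w1 w2 kk c y1 y2
        proof (cases "kk = 1")
          case True
          have zQ: "z \<in> quadric" using m by (simp add: moment_set_def)
          have "deriv u (rsq z) > 0" by (rule stenzel_potential_deriv_pos[OF pot rsq_ge_1[OF zQ]])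
          then have "Im (cnj w1 * w2) = 0" using h(2) kk(2)[OF True] by simp
          then have "- 2 * deriv u (\<rho> x) * Im (cnj w1 * w2) = c" using kk(2)[OF True] by simp
          with block_graph_iff[OF du_pos kk y refl] h(1) kk(2)[OF True] True show ?thesis by simp
        qed (use kk y in auto)
        have i: "Im (z $ 1) = Im k1 * x $ 1" "Im (z $ 2) = Im k1 * x $ 2" "Im (z $ 3) = Im k2 * x $ 3" "Im (z $ 4) = Im k2 * x $ 4"
          using k_im[OF k1 x(1,2) pos(1)] k_im[OF k2 x(3,4) pos(2)] m unfolding moment_set_def by auto
        have zQ: "z \<in> quadric" and i5: "Im (z $ 5) = 0" "Im (z $ 6) = 0" "Im (z $ 7) = 0" using m by (auto simp: moment_set_def)
        have sq': "(Im k1)\<^sup>2 = Im k1" "(Im k2)\<^sup>2 = Im k2" using k1(1) k2(1) by auto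
        have "rsq z = \<rho> x"
          unfolding quadric_Re_Im(3)[OF zQ] sum_7 i i5 \<rho>_def power_mult_distrib sq' by (simp add: algebra_simps)
        then have "over x z"
          using m b1 b2 unfolding moment_set_def over_def by (simp add: P_simps)
        then show False using False by blast
      qed
      ultimately show ?thesis unfolding x_def by blast
    qed
  qed
  have in_over: "over (?\<pi> z) z" "z \<in> quadric" "z $ a \<noteq> 0"
    if "z \<in> moment_set u c1 c2" "?\<pi> z \<in> S" "s * Re (z $ a) > 0" for z
    using graph[OF that(2,3)] that over[of z] by (auto simp: moment_set_def)
  show ?thesis
  proof (rule graph_special_chart[where a = a and s = s and S = S and P = P and P' = DP and T = T and \<kappa> = k])
    show "moment_set u c1 c2 \<subseteq> quadric" by (auto simp: moment_set_def)
    show "k j = 1 \<or> k j = \<i>" for j by (rule kc)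
    show "k a = 1" by (rule k5[OF a(1)])
    show "P x $ j = 0" if "k j = 1" for x j by (rule P0[OF that])
    show "open S"
      unfolding S_def by (intro open_Collect_conj open_Collect_less continuous_intros)
    show "Ck_on n S (\<lambda>x. P x $ j)" for n j by (rule CP)
    show "Ck_on n S T" for n
    proof -
      have "Ck_on n S (\<lambda>x. (Im (k j) * x $ j)\<^sup>2 - (Re (k j) * x $ j + P x $ j)\<^sup>2)" for j
        unfolding power2_eq_square
        by (rule Ck_on_diff[OF Ck_on_mult[OF Ck_on_mult[OF Ck_on_const Ck_on_nth] Ck_on_mult[OF Ck_on_const Ck_on_nth]]
            Ck_on_mult[OF Ck_on_add[OF Ck_on_mult[OF Ck_on_const Ck_on_nth] CP] Ck_on_add[OF Ck_on_mult[OF Ck_on_const Ck_on_nth] CP]]])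
      then show ?thesis
        unfolding T_def[abs_def]
        by (intro Ck_on_diff[OF Ck_on_add[OF Ck_on_const Ck_on_sum] Ck_on_sum] Ck_on_square)
    qed
    show "(P has_derivative DP x) (at x)" if "x \<in> S" for x by (rule has_derivative_P[OF that])
    show "DP x y = DP x y'" if "x \<in> S" "\<And>j. j \<noteq> a \<Longrightarrow> y $ j = y' $ j" for x y y'
      using that(2)[OF a4(5)] that(2)[OF a4(6)] that(2)[OF a4(7)] that(2)[OF a4(8)]
      by (simp add: DP_def DF_def D\<rho>_def)
    show "s = 1 \<or> s = - 1" using a by (auto simp: s_def sgn_if)
    show "s * Re (p $ a) > 0" using a by (auto simp: s_def sgn_if)
    show "p \<in> moment_set u c1 c2" by (rule p)
    show "?\<pi> p \<in> S"
      using kp a4 unfolding S_def by (auto simp: sum_power2_gt_zero_iff)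
  next
    fix z y y' assume z: "z \<in> moment_set u c1 c2" "?\<pi> z \<in> S" "s * Re (z $ a) > 0"
    show "stenzel_form u z (\<chi> j. k j * of_real (y $ j) + of_real (DP (?\<pi> z) y $ j)) (\<chi> j. k j * of_real (y' $ j) + of_real (DP (?\<pi> z) y' $ j)) = 0"
      if "cdot z (\<chi> j. k j * of_real (y $ j) + of_real (DP (?\<pi> z) y $ j)) = 0"
        "cdot z (\<chi> j. k j * of_real (y' $ j) + of_real (DP (?\<pi> z) y' $ j)) = 0"
      using lagrangian_over[OF z(2) in_over(1,2)[OF z], of y y'] that unfolding \<tau>_def by blast
  next
    fix z and y :: "7 \<Rightarrow> real^7" assume z: "z \<in> moment_set u c1 c2" "?\<pi> z \<in> S" "s * Re (z $ a) > 0"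
    show "Im (det ((\<chi> j. if j = a then z else (\<chi> i. k i * of_real (y j $ i) + of_real (DP (?\<pi> z) (y j) $ i))) :: complex^7^7) / 1) = 0"
      if "\<And>j. j \<noteq> a \<Longrightarrow> cdot z (\<chi> i. k i * of_real (y j $ i) + of_real (DP (?\<pi> z) (y j) $ i)) = 0"
        "\<And>j i. j \<noteq> a \<Longrightarrow> i \<noteq> a \<Longrightarrow> y j $ i = (if j = i then 1 else 0)"
      using det_over[OF z(2) in_over(1,2)[OF z] a(1) in_over(3)[OF z], of y] that unfolding \<tau>_def by simp
  qed (use graph in simp_all)
qed

end

text \<open>The chart at \<open>p\<close> uses real parts in a plane exactly when that component of
  \<open>p\<close> is real, which forces the level of the plane to be 0. Charts of all types have
  the same phase 1.\<close>

lemma special_lagrangian_moment_set: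
  fixes \<Omega> :: "complex^7 \<Rightarrow> (complex^7) form"
  assumes cy: "stenzel_calabi_yau \<kappa> u \<Omega>"
  shows "special_lagrangian u \<Omega> (moment_set u c1 c2)"
proof (rule special_lagrangianI[OF cy, where \<epsilon> = 1])
  have pot: "stenzel_potential TYPE(7) \<kappa> u" using cy by (simp add: stenzel_calabi_yau_def)
  show "moment_set u c1 c2 \<subseteq> quadric" by (auto simp: moment_set_def)
  fix p assume p: "p \<in> moment_set u c1 c2"
  have nz: "p $ 1 \<noteq> 0 \<or> p $ 2 \<noteq> 0" "p $ 3 \<noteq> 0 \<or> p $ 4 \<noteq> 0" using p by (auto simp: moment_set_def)
  define k1 k2 where "k1 = (if Im (p $ 1) = 0 \<and> Im (p $ 2) = 0 then 1 else \<i>)"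
    and "k2 = (if Im (p $ 3) = 0 \<and> Im (p $ 4) = 0 then 1 else \<i>)"
  interpret moment_chart \<kappa> u c1 c2 k1 k2
  proof
    show "c1 = 0" if "k1 = 1"
      using that p by (auto simp: k1_def moment_set_def split: if_splits)
    show "c2 = 0" if "k2 = 1"
      using that p by (auto simp: k2_def moment_set_def split: if_splits)
  qed (auto simp: pot k1_def k2_def)
  show "\<exists>W \<phi>. admissible_chart u 1 (moment_set u c1 c2) W \<phi> \<and> p \<in> \<phi> ` W"
    by (rule admissible_chart_moment[OF p]) (use nz in \<open>auto simp: k1_def k2_def complex_eq_iff\<close>)
qed simp


section \<open>The cotangent bundle and the quadric\<close>

text \<open>The value at 0 is 0, by the convention for division, and not the limit 1. This is
  harmless because it only multiplies vectors of norm \<open>t\<close>.\<close>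

definition sinhc :: "real \<Rightarrow> real" where
  "sinhc t = sinh t / t"

lemma sinhc_pos: "t > 0 \<Longrightarrow> sinhc t > 0"
  by (simp add: sinhc_def)

lemma Re_Phi: "Re (Phi p $ i) = cosh (norm (snd p)) * fst p $ i"
  and Im_Phi: "Im (Phi p $ i) = sinhc (norm (snd p)) * snd p $ i"
  by (auto simp: Phi_def sinhc_def case_prod_beta)

lemma norm_power2_vec: "(norm (x :: real^'n))\<^sup>2 = (\<Sum>i\<in>UNIV. (x $ i)\<^sup>2)"
  unfolding power2_norm_eq_inner inner_vec_def by (simp add: power2_eq_square)

lemma Phi_in_quadric:
  assumes "p \<in> TS"
  shows "Phi p \<in> quadric"
proof -
  obtain x \<xi> where p: "p = (x, \<xi>)" by force
  have x: "norm x = 1" "x \<bullet> \<xi> = 0" using assms by (auto simp: TS_def p)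
  have "(\<Sum>i\<in>UNIV. (Re (Phi p $ i))\<^sup>2 - (Im (Phi p $ i))\<^sup>2)
      = (cosh (norm \<xi>))\<^sup>2 * (norm x)\<^sup>2 - (sinhc (norm \<xi>))\<^sup>2 * (norm \<xi>)\<^sup>2"
    by (simp add: Re_Phi Im_Phi p power_mult_distrib sum_subtractf sum_distrib_left norm_power2_vec)
  also have "\<dots> = 1"
    using x by (simp add: sinhc_def power_divide cosh_square_eq)
  finally have 1: "(\<Sum>i\<in>UNIV. (Re (Phi p $ i))\<^sup>2 - (Im (Phi p $ i))\<^sup>2) = 1" .
  have "(\<Sum>i\<in>UNIV. 2 * Re (Phi p $ i) * Im (Phi p $ i)) = 2 * cosh (norm \<xi>) * sinhc (norm \<xi>) * (x \<bullet> \<xi>)"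
    by (simp add: Re_Phi Im_Phi p inner_vec_def sum_distrib_left algebra_simps)
  then have 2: "(\<Sum>i\<in>UNIV. 2 * Re (Phi p $ i) * Im (Phi p $ i)) = 0" using x by simp
  show ?thesis
    unfolding quadric_def using 1 2 by (simp add: complex_eq_iff Re_power2 Im_power2)
qed

text \<open>Real and imaginary parts are rescaled by positive factors, so vanishing and
  orthogonality conditions pass between z and (x, \<xi>). The length of \<xi> is arsinh |Im
  z|.\<close>

lemma quadric_imp_Phi:
  fixes z :: "complex^'n"
  assumes z: "z \<in> quadric"
  obtains x \<xi> \<alpha> \<beta> where "(x, \<xi>) \<in> TS" "Phi (x, \<xi>) = z" "\<alpha> > 0" "\<beta> > 0"
    "\<And>i. x $ i = \<alpha> * Re (z $ i)" "\<And>i. \<xi> $ i = \<beta> * Im (z $ i)"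
proof -
  define R I :: "real^'n" where "R = (\<chi> i. Re (z $ i))" and "I = (\<chi> i. Im (z $ i))"
  have "(norm R)\<^sup>2 - (norm I)\<^sup>2 = 1" and RI: "R \<bullet> I = 0"
    using quadric_Re_Im(1,2)[OF z] by (simp_all add: R_def I_def norm_power2_vec inner_vec_def)
  then have R2: "(norm R)\<^sup>2 = (norm I)\<^sup>2 + 1" by simp
  define t where "t = arsinh (norm I)"
  have "(cosh t)\<^sup>2 = (norm R)\<^sup>2" by (simp add: cosh_square_eq t_def R2)
  then have ct: "cosh t = norm R" by (simp add: power2_eq_iff_nonneg)
  have st: "sinh t = norm I" by (simp add: t_def)
  have Rpos: "norm R > 0" using ct cosh_real_pos[of t] by simp
  have tI: "t > 0 \<longleftrightarrow> I \<noteq> 0" "t \<ge> 0" using st by (metis sinh_real_pos_iff zero_less_norm_iff, metis norm_ge_zero sinh_real_nonneg_iff)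
  \<comment> \<open>For \<open>I = 0\<close> every positive \<open>\<beta>\<close> works; the value
    1 avoids a division by 0.\<close>
  define \<alpha> \<beta> where "\<alpha> = 1 / norm R" and "\<beta> = (if I = 0 then 1 else t / norm I)"
  have \<beta>: "\<beta> > 0" "norm (\<beta> *\<^sub>R I) = t" using tI by (auto simp: \<beta>_def)
  show thesis
  proof (rule that[of "\<alpha> *\<^sub>R R" "\<beta> *\<^sub>R I" \<alpha> \<beta>])
    show "(\<alpha> *\<^sub>R R, \<beta> *\<^sub>R I) \<in> TS" using RI Rpos by (simp add: TS_def \<alpha>_def)
    have "sinhc t * (\<beta> * I $ i) = I $ i" for i
      using tI st by (auto simp: sinhc_def \<beta>_def)
    moreover have "cosh t * (\<alpha> * R $ i) = R $ i" for i using ct Rpos by (simp add: \<alpha>_def)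
    ultimately show "Phi (\<alpha> *\<^sub>R R, \<beta> *\<^sub>R I) = z"
      using \<beta>(2) by (simp add: vec_eq_iff complex_eq_iff Re_Phi Im_Phi) (simp add: R_def I_def)
    show "\<alpha> > 0" using Rpos by (simp add: \<alpha>_def)
  qed (use \<beta> in \<open>simp_all add: R_def I_def\<close>)
qed

lemma xi_mult:
  fixes z :: "complex^'n"
  assumes "i \<noteq> j"
  shows "map_matrix of_real (xi i j) *v z = axis j (z $ i) - axis i (z $ j)"
proof -
  have "(\<Sum>l\<in>UNIV. of_real (xi i j $ k $ l) * z $ l) = axis j (z $ i) $ k - axis i (z $ j) $ k" for k
  proof -
    have "(\<Sum>l\<in>UNIV. of_real (xi i j $ k $ l) * z $ l)
        = (\<Sum>l\<in>UNIV. if l = i then (if k = j then z $ l else 0) else 0) - (\<Sum>l\<in>UNIV. if l = j then (if k = i then z $ l else 0) else 0)"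
      unfolding sum_subtractf[symmetric] by (rule sum.cong) (auto simp: xi_def matrix_unit_def)
    then show ?thesis by (auto simp: axis_def)
  qed
  then show ?thesis by (simp add: vec_eq_iff matrix_vector_mult_def map_matrix_def)
qed

lemma mu_eq:
  assumes "i \<noteq> j"
  shows "mu u i j p = - 2 * deriv u (rsq (Phi p)) * Im (cnj (Phi p $ i) * Phi p $ j)"
  unfolding mu_def moment_pairing_def xi_mult[OF assms]
  by (simp add: inner_diff_right inner_axis inner_complex_def algebra_simps)


section \<open>Saturations of subsets of the subbundle\<close>

definition unit_pair :: "real \<Rightarrow> real \<Rightarrow> bool" where
  "unit_pair p q \<longleftrightarrow> p\<^sup>2 + q\<^sup>2 = 1"

definition base :: "real \<Rightarrow> real \<Rightarrow> real \<Rightarrow> real \<Rightarrow> real \<Rightarrow> (real^7) \<times> (real^7)" where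
  "base x1 x3 x5 s2 s4 = (vector [x1, 0, x3, 0, x5, 0, 0], vector [0, s2, 0, s4, 0, 0, 0])"

text \<open>The image of \<open>base\<close> under a group element: (p, q) and (p', q') are the
  first columns of the plane rotations, and \<open>y\<close> is the first column of the third block,
  the only part of that block that these points detect.\<close>

definition orbit_point :: "real \<Rightarrow> real \<Rightarrow> real \<Rightarrow> real \<Rightarrow> real^3 \<Rightarrow> real \<Rightarrow> real \<Rightarrow> real \<Rightarrow> real \<Rightarrow> real \<Rightarrow>
    (real^7) \<times> (real^7)" where
  "orbit_point p q p' q' y x1 x3 x5 s2 s4 =
     (vector [p * x1, q * x1, p' * x3, q' * x3, y $ 1 * x5, y $ 2 * x5, y $ 3 * x5],
      vector [- q * s2, p * s2, - q' * s4, p' * s4, 0, 0, 0])"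

lemma base_eq_orbit_point: "base x1 x3 x5 s2 s4 = orbit_point 1 0 1 0 (axis 1 1) x1 x3 x5 s2 s4"
  by (simp add: base_def orbit_point_def axis_def)

lemma rotation_matrix_2:
  fixes a :: "real^2^2"
  shows "rotation_matrix a \<longleftrightarrow> a $ 2 $ 2 = a $ 1 $ 1 \<and> a $ 1 $ 2 = - a $ 2 $ 1 \<and> unit_pair (a $ 1 $ 1) (a $ 2 $ 1)"
proof
  assume "rotation_matrix a"
  then have o: "transpose a ** a = mat 1" and d: "a $ 1 $ 1 * a $ 2 $ 2 - a $ 1 $ 2 * a $ 2 $ 1 = 1"
    by (auto simp: rotation_matrix_def orthogonal_matrix_def det_2)
  have c: "(a $ 1 $ 1)\<^sup>2 + (a $ 2 $ 1)\<^sup>2 = 1" "(a $ 1 $ 2)\<^sup>2 + (a $ 2 $ 2)\<^sup>2 = 1"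
    using o by (simp_all add: vec_eq_iff matrix_matrix_mult_def transpose_def mat_def sum_2 forall_2 power2_eq_square)
  \<comment> \<open>Expands to the squared lengths of both columns minus twice the determinant, 1 +
    1 - 2.\<close>
  have "(a $ 2 $ 2 - a $ 1 $ 1)\<^sup>2 + (a $ 1 $ 2 + a $ 2 $ 1)\<^sup>2 = 0"
    using c d by (simp add: power2_eq_square algebra_simps)
  then show "a $ 2 $ 2 = a $ 1 $ 1 \<and> a $ 1 $ 2 = - a $ 2 $ 1 \<and> unit_pair (a $ 1 $ 1) (a $ 2 $ 1)"
    using c by (simp add: sum_power2_eq_zero_iff unit_pair_def)
next
  assume "a $ 2 $ 2 = a $ 1 $ 1 \<and> a $ 1 $ 2 = - a $ 2 $ 1 \<and> unit_pair (a $ 1 $ 1) (a $ 2 $ 1)"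
  then show "rotation_matrix a"
    by (simp add: rotation_matrix_def orthogonal_matrix_def det_2 vec_eq_iff matrix_matrix_mult_def
        transpose_def mat_def sum_2 forall_2 power2_eq_square unit_pair_def algebra_simps)
qed

lemma act_base:
  assumes "rotation_matrix a" "rotation_matrix b"
  shows "act (block_diag a b c) (base x1 x3 x5 s2 s4)
    = orbit_point (a $ 1 $ 1) (a $ 2 $ 1) (b $ 1 $ 1) (b $ 2 $ 1) (c *v axis 1 1) x1 x3 x5 s2 s4"
  using assms
  by (simp add: act_def base_def orbit_point_def block_diag_def vec_eq_iff forall_7 matrix_vector_mult_def
      sum_7 rotation_matrix_2 axis_def sum_3)

lemma rotation_matrix_col_norm:
  assumes "rotation_matrix (c :: real^3^3)"
  shows "norm (c *v axis 1 1) = 1"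
proof -
  have "orthogonal_transformation ((*v) c)"
    using assms by (simp add: orthogonal_transformation_matrix rotation_matrix_def)
  then show ?thesis by (simp add: orthogonal_transformation_norm)
qed

lemma unit_pair_obtain_rotation:
  assumes "unit_pair p q"
  obtains a :: "real^2^2" where "rotation_matrix a" "a $ 1 $ 1 = p" "a $ 2 $ 1 = q"
proof
  show "rotation_matrix (vector [vector [p, - q], vector [q, p]] :: real^2^2)"
    using assms by (simp add: rotation_matrix_2)
qed simp_all

lemma L_hat_eq: "L_hat = {base x1 x3 x5 s2 s4 | x1 x3 x5 s2 s4. x1\<^sup>2 + x3\<^sup>2 + x5\<^sup>2 = 1}"
  unfolding L_hat_def base_def by blast

lemma base_eq_iff: "base x1 x3 x5 s2 s4 = base y1 y3 y5 t2 t4 \<longleftrightarrow> x1 = y1 \<and> x3 = y3 \<and> x5 = y5 \<and> s2 = t2 \<and> s4 = t4"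
  by (auto simp: base_def vec_eq_iff forall_7)

lemma base_in_L_hat: "base x1 x3 x5 s2 s4 \<in> L_hat \<longleftrightarrow> x1\<^sup>2 + x3\<^sup>2 + x5\<^sup>2 = 1"
  unfolding L_hat_eq by (auto simp: base_eq_iff)

text \<open>Every unit vector is the first column of some matrix in SO(3), so \<open>y\<close>
  ranges over the whole sphere.\<close>

lemma saturation_eq:
  assumes "A \<subseteq> L_hat"
  shows "saturation A = {orbit_point p q p' q' y x1 x3 x5 s2 s4 | p q p' q' y x1 x3 x5 s2 s4.
    unit_pair p q \<and> unit_pair p' q' \<and> norm y = 1 \<and> base x1 x3 x5 s2 s4 \<in> A}" (is "_ = ?R")
proof (intro set_eqI iffI)
  fix w assume "w \<in> saturation A"
  then obtain h v where "h \<in> H" and v: "v \<in> A" and w: "w = act h v" by (auto simp: saturation_def)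
  then obtain a b c where abc: "rotation_matrix a" "rotation_matrix b" "rotation_matrix c" and h: "h = block_diag a b c"
    by (auto simp: H_def)
  obtain x1 x3 x5 s2 s4 where "v = base x1 x3 x5 s2 s4" using v assms unfolding L_hat_eq by blast
  then show "w \<in> ?R"
    using v abc unfolding w h by (force simp: act_base rotation_matrix_col_norm rotation_matrix_2)
next
  fix w assume "w \<in> ?R"
  then obtain p q p' q' y x1 x3 x5 s2 s4 where w: "w = orbit_point p q p' q' y x1 x3 x5 s2 s4"
    and pq: "unit_pair p q" "unit_pair p' q'" and y: "norm y = 1" and v: "base x1 x3 x5 s2 s4 \<in> A"
    by blast
  obtain a :: "real^2^2" where a: "rotation_matrix a" "a $ 1 $ 1 = p" "a $ 2 $ 1 = q"
    using unit_pair_obtain_rotation[OF pq(1)] .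
  obtain b :: "real^2^2" where b: "rotation_matrix b" "b $ 1 $ 1 = p'" "b $ 2 $ 1 = q'"
    using unit_pair_obtain_rotation[OF pq(2)] .
  obtain c :: "real^3^3" where c: "rotation_matrix c" "c *v axis 1 1 = y"
    using rotation_matrix_exists_basis[OF _ y, of 1] by auto
  have "w = act (block_diag a b c) (base x1 x3 x5 s2 s4)"
    using a b c by (simp add: act_base w)
  then show "w \<in> saturation A"
    using a b c v unfolding saturation_def H_def by blast
qed

lemma orbit_point_eq_base_iff:
  "orbit_point p q p' q' y x1 x3 x5 s2 s4 = base x1 x3 x5 s2 s4 \<longleftrightarrow>
     p * x1 = x1 \<and> q * x1 = 0 \<and> p * s2 = s2 \<and> q * s2 = 0 \<and>
     p' * x3 = x3 \<and> q' * x3 = 0 \<and> p' * s4 = s4 \<and> q' * s4 = 0 \<and>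
     y $ 1 * x5 = x5 \<and> y $ 2 * x5 = 0 \<and> y $ 3 * x5 = 0"
  by (auto simp: orbit_point_def base_def vec_eq_iff forall_7)

text \<open>A vanishing block is fixed by group elements that move other points of
  \<open>L_hat\<close>. If no block vanishes, an element fixing the point has trivial plane
  rotations and fixes the first axis of the last block, hence fixes all of
  \<open>L_hat\<close>.\<close>

lemma base_in_L_hat_pr:
  "base x1 x3 x5 s2 s4 \<in> L_hat_pr \<longleftrightarrow> x1\<^sup>2 + x3\<^sup>2 + x5\<^sup>2 = 1 \<and>
     (x1 \<noteq> 0 \<or> s2 \<noteq> 0) \<and> (x3 \<noteq> 0 \<or> s4 \<noteq> 0) \<and> x5 \<noteq> 0" (is "?v \<in> _ \<longleftrightarrow> ?R")
proof
  assume v: "?v \<in> L_hat_pr"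
  have sphere: "x1\<^sup>2 + x3\<^sup>2 + x5\<^sup>2 = 1" using v by (simp add: L_hat_pr_def base_in_L_hat)
  have fixes_all: "orbit_point p q p' q' y y1 y3 y5 t2 t4 = base y1 y3 y5 t2 t4"
    if fixed: "orbit_point p q p' q' y x1 x3 x5 s2 s4 = ?v" and y: "y1\<^sup>2 + y3\<^sup>2 + y5\<^sup>2 = 1"
      and pq: "unit_pair p q" "unit_pair p' q'" "norm y = 1" for p q p' q' y y1 y3 y5 t2 t4
  proof -
    obtain a :: "real^2^2" where a: "rotation_matrix a" "a $ 1 $ 1 = p" "a $ 2 $ 1 = q"
      using unit_pair_obtain_rotation[OF pq(1)] .
    obtain b :: "real^2^2" where b: "rotation_matrix b" "b $ 1 $ 1 = p'" "b $ 2 $ 1 = q'"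
      using unit_pair_obtain_rotation[OF pq(2)] .
    obtain c :: "real^3^3" where c: "rotation_matrix c" "c *v axis 1 1 = y"
      using rotation_matrix_exists_basis[OF _ pq(3), of 1] by auto
    have "block_diag a b c \<in> isotropy ?v"
      using a b c fixed by (auto simp: isotropy_def H_def act_base)
    then have "block_diag a b c \<in> isotropy (base y1 y3 y5 t2 t4)"
      using v y base_in_L_hat unfolding L_hat_pr_def by blast
    then show ?thesis using a b c by (simp add: isotropy_def act_base)
  qed
  have ax: "(axis 1 1 :: real^3) $ 1 = 1" "(axis 1 1 :: real^3) $ 2 = 0" "(axis 1 1 :: real^3) $ 3 = 0"
    by (simp_all add: axis_def)
  \<comment> \<open>The test elements are the half turns of the two planes and an element reversing
    the first axis of the last block, each applied to a unit vector in its block.\<close>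
  have "x1 \<noteq> 0 \<or> s2 \<noteq> 0"
    using fixes_all[of "-1" 0 1 0 "axis 1 1" 1 0 0 0 0] sphere ax
    by (auto simp: orbit_point_eq_base_iff unit_pair_def)
  moreover have "x3 \<noteq> 0 \<or> s4 \<noteq> 0"
    using fixes_all[of 1 0 "-1" 0 "axis 1 1" 0 1 0 0 0] sphere ax
    by (auto simp: orbit_point_eq_base_iff unit_pair_def)
  moreover have "x5 \<noteq> 0"
    using fixes_all[of 1 0 1 0 "- axis 1 1" 0 0 1 0 0] sphere ax
    by (auto simp: orbit_point_eq_base_iff unit_pair_def)
  ultimately show ?R using sphere by blast
next
  assume R: ?R
  have "isotropy ?v \<subseteq> isotropy q" if q: "q \<in> L_hat" for q
  proof
    fix h assume "h \<in> isotropy ?v"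
    then obtain a b c where abc: "rotation_matrix a" "rotation_matrix b" "rotation_matrix c" and h: "h = block_diag a b c"
      and fixed: "act h ?v = ?v"
      by (auto simp: isotropy_def H_def)
    obtain y1 y3 y5 t2 t4 where q: "q = base y1 y3 y5 t2 t4" using q unfolding L_hat_eq by blast
    have "a $ 1 $ 1 = 1 \<and> a $ 2 $ 1 = 0 \<and> b $ 1 $ 1 = 1 \<and> b $ 2 $ 1 = 0 \<and>
        (c *v axis 1 1) $ 1 = 1 \<and> (c *v axis 1 1) $ 2 = 0 \<and> (c *v axis 1 1) $ 3 = 0"
      using R fixed abc unfolding h act_base[OF abc(1,2)] orbit_point_eq_base_iff by auto
    then have "act h q = q"
      using abc unfolding h q act_base[OF abc(1,2)] orbit_point_eq_base_iff by simp
    then show "h \<in> isotropy q" using abc h by (auto simp: isotropy_def H_def)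
  qed
  then show "?v \<in> L_hat_pr" using R by (simp add: L_hat_pr_def base_in_L_hat)
qed

section \<open>Invariants along the orbits\<close>

lemma unit_pair_sum: "unit_pair p q \<Longrightarrow> (p * r)\<^sup>2 + (q * r)\<^sup>2 = r\<^sup>2"
  unfolding unit_pair_def power_mult_distrib by (metis distrib_right mult_1)

lemma
  assumes "unit_pair p q" "unit_pair p' q'" "norm y = 1"
  shows norm_orbit_point_fst: "(norm (fst (orbit_point p q p' q' y x1 x3 x5 s2 s4)))\<^sup>2 = x1\<^sup>2 + x3\<^sup>2 + x5\<^sup>2"
    and norm_orbit_point_snd: "norm (snd (orbit_point p q p' q' y x1 x3 x5 s2 s4)) = sqrt (s2\<^sup>2 + s4\<^sup>2)"
    and inner_orbit_point: "fst (orbit_point p q p' q' y x1 x3 x5 s2 s4) \<bullet> snd (orbit_point p q p' q' y x1 x3 x5 s2 s4) = 0"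
proof -
  have "(y $ 1)\<^sup>2 + (y $ 2)\<^sup>2 + (y $ 3)\<^sup>2 = 1"
    using norm_power2_vec[of y] assms(3) by (simp add: sum_3)
  then have y: "(y $ 1 * x5)\<^sup>2 + (y $ 2 * x5)\<^sup>2 + (y $ 3 * x5)\<^sup>2 = x5\<^sup>2"
    unfolding power_mult_distrib by (metis distrib_right mult_1)
  show "(norm (fst (orbit_point p q p' q' y x1 x3 x5 s2 s4)))\<^sup>2 = x1\<^sup>2 + x3\<^sup>2 + x5\<^sup>2"
    using y unit_pair_sum[OF assms(1), of x1] unit_pair_sum[OF assms(2), of x3]
    by (simp add: norm_power2_vec sum_7 orbit_point_def)
  have "(norm (snd (orbit_point p q p' q' y x1 x3 x5 s2 s4)))\<^sup>2 = s2\<^sup>2 + s4\<^sup>2"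
    using unit_pair_sum[OF assms(1), of s2] unit_pair_sum[OF assms(2), of s4]
    by (simp add: norm_power2_vec sum_7 orbit_point_def)
  then show "norm (snd (orbit_point p q p' q' y x1 x3 x5 s2 s4)) = sqrt (s2\<^sup>2 + s4\<^sup>2)"
    by (metis norm_ge_zero real_sqrt_unique)
  show "fst (orbit_point p q p' q' y x1 x3 x5 s2 s4) \<bullet> snd (orbit_point p q p' q' y x1 x3 x5 s2 s4) = 0"
    by (simp add: inner_vec_def sum_7 orbit_point_def)
qed

lemma orbit_point_in_TS:
  assumes "unit_pair p q" "unit_pair p' q'" "norm y = 1"
  shows "orbit_point p q p' q' y x1 x3 x5 s2 s4 \<in> TS \<longleftrightarrow> x1\<^sup>2 + x3\<^sup>2 + x5\<^sup>2 = 1"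
proof -
  have "norm (fst (orbit_point p q p' q' y x1 x3 x5 s2 s4)) = 1 \<longleftrightarrow> x1\<^sup>2 + x3\<^sup>2 + x5\<^sup>2 = 1"
    using norm_orbit_point_fst[OF assms, of x1 x3 x5 s2 s4] by (metis norm_ge_zero one_power2 power2_eq_iff_nonneg zero_le_one)
  then show ?thesis
    using inner_orbit_point[OF assms] by (auto simp: TS_def split_beta)
qed

lemma unit_pair_axis: "unit_pair 1 0" "norm (axis 1 1 :: real^3) = 1"
  by (simp_all add: unit_pair_def)

lemma Im_block:
  assumes "unit_pair p q"
  shows "Im (cnj (Complex (C * (p * r)) (S * (- q * s))) * Complex (C * (q * r)) (S * (p * s))) = C * S * r * s"
proof -
  have "Im (cnj (Complex (C * (p * r)) (S * (- q * s))) * Complex (C * (q * r)) (S * (p * s)))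
      = (p\<^sup>2 + q\<^sup>2) * (C * S * r * s)"
    by (simp add: algebra_simps power2_eq_square)
  then show ?thesis using assms by (simp add: unit_pair_def)
qed

lemma
  fixes p q p' q' y x1 x3 x5 s2 s4
  defines "w \<equiv> orbit_point p q p' q' y x1 x3 x5 s2 s4" and "N \<equiv> sqrt (s2\<^sup>2 + s4\<^sup>2)"
  assumes pq: "unit_pair p q" "unit_pair p' q'" "norm y = 1"
  shows Im_Phi_12: "Im (cnj (Phi w $ 1) * Phi w $ 2) = cosh N * sinhc N * x1 * s2"
    and Im_Phi_34: "Im (cnj (Phi w $ 3) * Phi w $ 4) = cosh N * sinhc N * x3 * s4"
    and Im_Phi_567: "Im (Phi w $ 5) = 0" "Im (Phi w $ 6) = 0" "Im (Phi w $ 7) = 0"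
proof -
  have N: "norm (snd w) = N" using norm_orbit_point_snd[OF pq] by (simp add: w_def N_def)
  have "Phi w $ i = Complex (cosh N * fst w $ i) (sinhc N * snd w $ i)" for i
    by (simp add: complex_eq_iff Re_Phi Im_Phi N)
  then have "Phi w $ 1 = Complex (cosh N * (p * x1)) (sinhc N * (- q * s2))"
    "Phi w $ 2 = Complex (cosh N * (q * x1)) (sinhc N * (p * s2))"
    "Phi w $ 3 = Complex (cosh N * (p' * x3)) (sinhc N * (- q' * s4))"
    "Phi w $ 4 = Complex (cosh N * (q' * x3)) (sinhc N * (p' * s4))"
    by (simp_all add: w_def orbit_point_def)
  then show "Im (cnj (Phi w $ 1) * Phi w $ 2) = cosh N * sinhc N * x1 * s2"
    "Im (cnj (Phi w $ 3) * Phi w $ 4) = cosh N * sinhc N * x3 * s4"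
    using Im_block[OF pq(1)] Im_block[OF pq(2)] by (simp_all only:)
  show "Im (Phi w $ 5) = 0" "Im (Phi w $ 6) = 0" "Im (Phi w $ 7) = 0"
    by (simp_all add: Im_Phi w_def orbit_point_def)
qed

lemma rsq_Phi:
  assumes "p \<in> TS"
  shows "rsq (Phi p) = 1 + 2 * (sinhc (norm (snd p)) * norm (snd p))\<^sup>2"
  using quadric_Re_Im(3)[OF Phi_in_quadric[OF assms]]
  by (simp add: Im_Phi power_mult_distrib norm_power2_vec sum_distrib_left)

lemma rsq_Phi_orbit_point:
  assumes "unit_pair p q" "unit_pair p' q'" "norm y = 1" "x1\<^sup>2 + x3\<^sup>2 + x5\<^sup>2 = 1"
  shows "rsq (Phi (orbit_point p q p' q' y x1 x3 x5 s2 s4)) = rsq (Phi (base x1 x3 x5 s2 s4))"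
  using assms unit_pair_axis
  by (simp add: rsq_Phi orbit_point_in_TS norm_orbit_point_snd base_eq_orbit_point)

text \<open>The level may be read off at any point of the orbit: the imaginary parts of conj(z_1)
  z_2 and conj(z_3) z_4 and the value r^2 are invariant, and the other three components vanish as
  z_5, z_6, z_7 are real.\<close>

lemma base_in_moment_level:
  fixes p q p' q' y x1 x3 x5 s2 s4
  assumes "x1\<^sup>2 + x3\<^sup>2 + x5\<^sup>2 = 1" "unit_pair p q" "unit_pair p' q'" "norm y = 1"
  defines "z \<equiv> Phi (orbit_point p q p' q' y x1 x3 x5 s2 s4)"
  shows "base x1 x3 x5 s2 s4 \<in> moment_level u c1 c2 \<longleftrightarrow>
    - 2 * deriv u (rsq z) * Im (cnj (z $ 1) * z $ 2) = c1 \<and>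
    - 2 * deriv u (rsq z) * Im (cnj (z $ 3) * z $ 4) = c2"
proof -
  have "base x1 x3 x5 s2 s4 \<in> TS"
    using assms(1) unit_pair_axis by (simp add: base_eq_orbit_point orbit_point_in_TS)
  moreover have "Im (Phi (base x1 x3 x5 s2 s4) $ 5) = 0" "Im (Phi (base x1 x3 x5 s2 s4) $ 6) = 0" "Im (Phi (base x1 x3 x5 s2 s4) $ 7) = 0"
    by (simp_all add: Im_Phi base_def)
  moreover have "Im (cnj (Phi (base x1 x3 x5 s2 s4) $ 1) * Phi (base x1 x3 x5 s2 s4) $ 2) = Im (cnj (z $ 1) * z $ 2)"
    unfolding z_def Im_Phi_12[OF assms(2-4)]
    unfolding base_eq_orbit_point Im_Phi_12[OF unit_pair_axis(1,1,2)] ..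
  moreover have "Im (cnj (Phi (base x1 x3 x5 s2 s4) $ 3) * Phi (base x1 x3 x5 s2 s4) $ 4) = Im (cnj (z $ 3) * z $ 4)"
    unfolding z_def Im_Phi_34[OF assms(2-4)]
    unfolding base_eq_orbit_point Im_Phi_34[OF unit_pair_axis(1,1,2)] ..
  moreover have "rsq (Phi (base x1 x3 x5 s2 s4)) = rsq z"
    unfolding z_def using assms by (simp add: rsq_Phi_orbit_point)
  ultimately show ?thesis
    unfolding moment_level_def by (simp add: mu_eq)
qed

text \<open>Orthogonal vectors of the plane are multiples of a unit vector and of its right-angle
  turn. The unit vector comes from R if R is nonzero, otherwise from I, and is arbitrary if both
  vanish.\<close>

lemma Re_Im_orthogonal_block:
  fixes R1 R2 I1 I2 :: real
  assumes "R1 * I1 + R2 * I2 = 0"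
  obtains p q r s where "unit_pair p q" "R1 = p * r" "R2 = q * r" "I1 = - q * s" "I2 = p * s"
proof (cases "R1 = 0 \<and> R2 = 0")
  case False
  define r where "r = sqrt (R1\<^sup>2 + R2\<^sup>2)"
  have r: "r\<^sup>2 = R1\<^sup>2 + R2\<^sup>2" "r \<noteq> 0" using False by (auto simp: r_def)
  have "R1 * (R1 * I2 - R2 * I1) = r\<^sup>2 * I2" "R2 * (R1 * I2 - R2 * I1) = - (r\<^sup>2 * I1)"
    unfolding r using assms by algebra+
  then show thesis
    using r False by (intro that[of "R1 / r" "R2 / r" r "(R1 * I2 - R2 * I1) / r"])
      (auto simp: unit_pair_def power_divide add_divide_distrib[symmetric] field_simps power2_eq_square)
next
  case True
  show thesis
  proof (cases "I1 = 0 \<and> I2 = 0")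
    case False
    define r where "r = sqrt (I1\<^sup>2 + I2\<^sup>2)"
    have r: "r\<^sup>2 = I1\<^sup>2 + I2\<^sup>2" "r \<noteq> 0" using False by (auto simp: r_def)
    then show thesis
      using True by (intro that[of "I2 / r" "- I1 / r" 0 r])
        (auto simp: unit_pair_def power_divide add_divide_distrib[symmetric] add.commute)
  qed (use True that[of 1 0 0 0] in \<open>simp add: unit_pair_def\<close>)
qed

lemma real3_polar:
  fixes a b c :: real
  obtains y :: "real^3" and m where "norm y = 1" "a = y $ 1 * m" "b = y $ 2 * m" "c = y $ 3 * m"
proof -
  define v :: "real^3" where "v = vector [a, b, c]"
  define y where "y = (if v = 0 then axis 1 1 else v /\<^sub>R norm v)"
  have y: "norm y = 1" "norm v *\<^sub>R y = v" by (auto simp: y_def)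
  have "v $ i = y $ i * norm v" for i
    using y(2) by (metis mult.commute real_scaleR_def vector_scaleR_component)
  from this[of 1] this[of 2] this[of 3] show thesis
    using y(1) by (intro that[of y "norm v"]) (simp_all add: v_def)
qed

lemma quadric_orbit_point:
  fixes z :: "complex^7"
  assumes z: "z \<in> quadric" "Im (z $ 5) = 0" "Im (z $ 6) = 0" "Im (z $ 7) = 0"
    "Re (z $ 1) * Im (z $ 1) + Re (z $ 2) * Im (z $ 2) = 0"
    "Re (z $ 3) * Im (z $ 3) + Re (z $ 4) * Im (z $ 4) = 0"
  obtains p q p' q' y x1 x3 x5 s2 s4 where
    "unit_pair p q" "unit_pair p' q'" "norm y = 1" "x1\<^sup>2 + x3\<^sup>2 + x5\<^sup>2 = 1"
    "z = Phi (orbit_point p q p' q' y x1 x3 x5 s2 s4)"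
proof -
  obtain x \<xi> \<alpha> \<beta> where TS: "(x, \<xi>) \<in> TS" and Phi: "Phi (x, \<xi>) = z"
    and x: "\<And>i. x $ i = \<alpha> * Re (z $ i)" and \<xi>: "\<And>i. \<xi> $ i = \<beta> * Im (z $ i)"
    using quadric_imp_Phi[OF z(1)] by metis
  obtain p q r s where 1: "unit_pair p q" "Re (z $ 1) = p * r" "Re (z $ 2) = q * r"
    "Im (z $ 1) = - q * s" "Im (z $ 2) = p * s"
    using Re_Im_orthogonal_block[OF z(5)] .
  obtain p' q' r' s' where 2: "unit_pair p' q'" "Re (z $ 3) = p' * r'" "Re (z $ 4) = q' * r'"
    "Im (z $ 3) = - q' * s'" "Im (z $ 4) = p' * s'"
    using Re_Im_orthogonal_block[OF z(6)] .
  obtain y :: "real^3" and m where y: "norm y = 1" "Re (z $ 5) = y $ 1 * m" "Re (z $ 6) = y $ 2 * m" "Re (z $ 7) = y $ 3 * m"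
    using real3_polar[of "Re (z $ 5)" "Re (z $ 6)" "Re (z $ 7)"] .
  have "(x, \<xi>) = orbit_point p q p' q' y (\<alpha> * r) (\<alpha> * r') (\<alpha> * m) (\<beta> * s) (\<beta> * s')"
    using 1 2 z y by (simp add: orbit_point_def vec_eq_iff forall_7 x \<xi>)
  then show thesis
    using 1(1) 2(1) y(1) TS orbit_point_in_TS[OF 1(1) 2(1) y(1)]
    by (intro that[of p q p' q' y "\<alpha> * r" "\<alpha> * r'" "\<alpha> * m" "\<beta> * s" "\<beta> * s'"]) (auto simp: Phi[symmetric])
qed

lemma orbit_point_block_nonzero:
  fixes p q p' q' y x1 x3 x5 s2 s4
  assumes pq: "unit_pair p q" "unit_pair p' q'" "norm y = 1"
  defines "w \<equiv> orbit_point p q p' q' y x1 x3 x5 s2 s4"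
  shows "Phi w $ 1 \<noteq> 0 \<or> Phi w $ 2 \<noteq> 0 \<longleftrightarrow> x1 \<noteq> 0 \<or> s2 \<noteq> 0"
    and "Phi w $ 3 \<noteq> 0 \<or> Phi w $ 4 \<noteq> 0 \<longleftrightarrow> x3 \<noteq> 0 \<or> s4 \<noteq> 0"
    and "Phi w $ 5 \<noteq> 0 \<or> Phi w $ 6 \<noteq> 0 \<or> Phi w $ 7 \<noteq> 0 \<longleftrightarrow> x5 \<noteq> 0"
proof -
  define N where "N = norm (snd w)"
  have N: "N = sqrt (s2\<^sup>2 + s4\<^sup>2)" using norm_orbit_point_snd[OF pq] by (simp add: w_def N_def)
  have Phi0: "Phi w $ i = 0 \<longleftrightarrow> fst w $ i = 0 \<and> sinhc N * snd w $ i = 0" for i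
    using cosh_real_pos[of N] by (auto simp: complex_eq_iff Re_Phi Im_Phi N_def)
  have "sinhc N \<noteq> 0" if "s2 \<noteq> 0 \<or> s4 \<noteq> 0"
    using that sinhc_pos[of N] by (auto simp: N sum_power2_gt_zero_iff)
  then have s: "sinhc N * (a * s2) = 0 \<longleftrightarrow> a = 0 \<or> s2 = 0" "sinhc N * (a * s4) = 0 \<longleftrightarrow> a = 0 \<or> s4 = 0" for a
    by auto
  have w: "fst w $ 1 = p * x1" "fst w $ 2 = q * x1" "fst w $ 3 = p' * x3" "fst w $ 4 = q' * x3"
    "fst w $ 5 = y $ 1 * x5" "fst w $ 6 = y $ 2 * x5" "fst w $ 7 = y $ 3 * x5"
    "snd w $ 1 = - q * s2" "snd w $ 2 = p * s2" "snd w $ 3 = - q' * s4" "snd w $ 4 = p' * s4"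
    "snd w $ 5 = 0" "snd w $ 6 = 0" "snd w $ 7 = 0"
    by (simp_all add: w_def orbit_point_def)
  have pq0: "p \<noteq> 0 \<or> q \<noteq> 0" "p' \<noteq> 0 \<or> q' \<noteq> 0" using pq by (auto simp: unit_pair_def)
  have y0: "y $ 1 \<noteq> 0 \<or> y $ 2 \<noteq> 0 \<or> y $ 3 \<noteq> 0"
  proof -
    have "y \<noteq> 0" using pq(3) by auto
    then show ?thesis by (simp add: vec_eq_iff forall_3)
  qed
  show "Phi w $ 1 \<noteq> 0 \<or> Phi w $ 2 \<noteq> 0 \<longleftrightarrow> x1 \<noteq> 0 \<or> s2 \<noteq> 0"
    "Phi w $ 3 \<noteq> 0 \<or> Phi w $ 4 \<noteq> 0 \<longleftrightarrow> x3 \<noteq> 0 \<or> s4 \<noteq> 0"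
    unfolding Phi0 w s using pq0 by auto
  show "Phi w $ 5 \<noteq> 0 \<or> Phi w $ 6 \<noteq> 0 \<or> Phi w $ 7 \<noteq> 0 \<longleftrightarrow> x5 \<noteq> 0"
    unfolding Phi0 w using y0 by auto
qed

lemma orbit_point_block_orthogonal:
  fixes p q p' q' y x1 x3 x5 s2 s4
  defines "w \<equiv> orbit_point p q p' q' y x1 x3 x5 s2 s4"
  shows "Re (Phi w $ 1) * Im (Phi w $ 1) + Re (Phi w $ 2) * Im (Phi w $ 2) = 0"
    and "Re (Phi w $ 3) * Im (Phi w $ 3) + Re (Phi w $ 4) * Im (Phi w $ 4) = 0"
  by (simp_all add: Re_Phi Im_Phi w_def orbit_point_def)

lemma Phi_orbit_point_in_moment_set:
  assumes pq: "unit_pair p q" "unit_pair p' q'" "norm y = 1" and x: "x1\<^sup>2 + x3\<^sup>2 + x5\<^sup>2 = 1"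
  shows "Phi (orbit_point p q p' q' y x1 x3 x5 s2 s4) \<in> moment_set u c1 c2 \<longleftrightarrow> base x1 x3 x5 s2 s4 \<in> V u c1 c2"
    (is "Phi ?w \<in> _ \<longleftrightarrow> _")
proof -
  have "Phi ?w \<in> quadric" using Phi_in_quadric orbit_point_in_TS[OF pq] x by blast
  then show ?thesis
    unfolding V_def moment_set_def Int_iff mem_Collect_eq base_in_moment_level[OF x pq] base_in_L_hat_pr
      orbit_point_block_nonzero[OF pq] Im_Phi_567[OF pq] orbit_point_block_orthogonal
    using x by blast
qed

lemma saturation_subset_TS:
  assumes "A \<subseteq> L_hat"
  shows "saturation A \<subseteq> TS"
  unfolding saturation_eq[OF assms] using assms base_in_L_hat orbit_point_in_TS by blast

lemma Phi_saturation_V: "Phi ` saturation (V u c1 c2) = moment_set u c1 c2"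
proof -
  have V: "V u c1 c2 \<subseteq> L_hat" by (auto simp: V_def L_hat_pr_def)
  show ?thesis
  proof (intro subset_antisym subsetI)
    fix z assume "z \<in> Phi ` saturation (V u c1 c2)"
    then obtain p q p' q' y x1 x3 x5 s2 s4 where z: "z = Phi (orbit_point p q p' q' y x1 x3 x5 s2 s4)"
      and pq: "unit_pair p q" "unit_pair p' q'" "norm y = 1" and v: "base x1 x3 x5 s2 s4 \<in> V u c1 c2"
      unfolding saturation_eq[OF V] by blast
    have "x1\<^sup>2 + x3\<^sup>2 + x5\<^sup>2 = 1" using v V base_in_L_hat by blast
    then show "z \<in> moment_set u c1 c2" using v z by (simp add: Phi_orbit_point_in_moment_set[OF pq])
  next
    fix z assume z: "z \<in> moment_set u c1 c2"
    then obtain p q p' q' y x1 x3 x5 s2 s4 where pq: "unit_pair p q" "unit_pair p' q'" "norm y = 1"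
      and x: "x1\<^sup>2 + x3\<^sup>2 + x5\<^sup>2 = 1" and zw: "z = Phi (orbit_point p q p' q' y x1 x3 x5 s2 s4)"
      by (auto simp: moment_set_def elim!: quadric_orbit_point)
    then have "base x1 x3 x5 s2 s4 \<in> V u c1 c2"
      using z Phi_orbit_point_in_moment_set[OF pq x] by simp
    then show "z \<in> Phi ` saturation (V u c1 c2)"
      using pq zw unfolding saturation_eq[OF V] by blast
  qed
qed


section \<open>The fibre over zero\<close>

definition flat_TS :: "7 set \<Rightarrow> ((real^7) \<times> (real^7)) set" where
  "flat_TS A = {(x, \<xi>) \<in> TS. \<forall>j. if j \<in> A then \<xi> $ j = 0 else x $ j = 0}"

lemma flat_TS_subset_TS: "flat_TS A \<subseteq> TS"
  by (auto simp: flat_TS_def)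

lemma Phi_flat_TS: "Phi ` flat_TS A = flat A"
proof (intro subset_antisym subsetI)
  fix z assume "z \<in> Phi ` flat_TS A"
  then show "z \<in> flat A"
    by (auto simp: flat_TS_def flat_def Phi_in_quadric Re_Phi Im_Phi) 
next
  fix z assume z: "z \<in> flat A"
  then obtain x \<xi> \<alpha> \<beta> where TS: "(x, \<xi>) \<in> TS" and Phi: "Phi (x, \<xi>) = z"
    and x: "\<And>i. x $ i = \<alpha> * Re (z $ i)" and \<xi>: "\<And>i. \<xi> $ i = \<beta> * Im (z $ i)"
    using quadric_imp_Phi[of z] by (auto simp: flat_def) metis
  have "(x, \<xi>) \<in> flat_TS A" using z TS by (auto simp: flat_TS_def flat_def x \<xi>) 
  then show "z \<in> Phi ` flat_TS A" using Phi by force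
qed

text \<open>The second independent vector makes the punctured subspace connected, and radial
  projection carries it onto the sphere.\<close>

lemma connected_unit_sphere_subspace:
  fixes U :: "('a::euclidean_space) set"
  assumes "subspace U" "a \<in> U" "b \<in> U" "a \<noteq> 0" and b: "\<And>c. b \<noteq> c *\<^sub>R a"
  shows "connected {x \<in> U. norm x = 1}"
proof -
  have "\<not> collinear U"
  proof
    assume "collinear U"
    then have "collinear {0, a, b}"
      by (rule collinear_subset) (use assms in \<open>auto simp: subspace_0\<close>)
    then show False
      using assms(4) b b[of 0] by (auto simp: collinear_lemma)
  qed
  then have "connected (U - {0})"
    by (intro connected_punctured_convex) (auto simp: subspace_imp_convex assms collinear_aff_dim)
  then have "connected ((\<lambda>x. x /\<^sub>R norm x) ` (U - {0}))"
    by (intro connected_continuous_image continuous_intros) auto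
  also have "(\<lambda>x. x /\<^sub>R norm x) ` (U - {0}) = {x \<in> U. norm x = 1}"
  proof -
    have "x \<in> (\<lambda>x. x /\<^sub>R norm x) ` (U - {0})" if "x \<in> U" "norm x = 1" for x
      using that by (intro image_eqI[of _ _ x]) auto
    then show ?thesis using assms(1) by (auto simp: subspace_scale)
  qed
  finally show ?thesis .
qed

text \<open>The set is the product of a unit sphere in the coordinates in \<open>A\<close> with the
  vector space of the others; with 5 and 6 in \<open>A\<close> the sphere has positive
  dimension.\<close>

lemma connected_flat_TS:
  assumes "5 \<in> A" "6 \<in> A"
  shows "connected (flat_TS A)"
proof -
  let ?U = "{x :: real^7. \<forall>j. j \<notin> A \<longrightarrow> x $ j = 0}" and ?W = "{x :: real^7. \<forall>j. j \<in> A \<longrightarrow> x $ j = 0}"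
  have sub: "subspace ?U" "subspace ?W" by (auto simp: subspace_def)
  have inner: "x \<bullet> y = 0" if "x \<in> ?U" "y \<in> ?W" for x y
  proof -
    have "x $ j * y $ j = 0" for j using that by (cases "j \<in> A") auto
    then show ?thesis unfolding inner_vec_def by (intro sum.neutral) auto
  qed
  have "axis 6 1 \<noteq> c *\<^sub>R (axis 5 1 :: real^7)" for c
    by (rule notI, drule arg_cong[where f = "\<lambda>x. x $ 6"]) (simp add: axis_def)
  then have "connected {x \<in> ?U. norm x = 1}"
    using sub(1) assms
    by (intro connected_unit_sphere_subspace[of _ "axis 5 1" "axis 6 1"]) (auto simp: axis_eq_0_iff, auto simp: axis_def)
  moreover have "connected ?W" using sub by (simp add: convex_connected subspace_imp_convex)
  ultimately have "connected ({x \<in> ?U. norm x = 1} \<times> ?W)" by (rule connected_Times)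
  also have "{x \<in> ?U. norm x = 1} \<times> ?W = flat_TS A"
    using inner by (auto simp: flat_TS_def TS_def)
  finally show ?thesis .
qed

lemma connected_open_half_sphere: "connected {(x :: real^'n, 0 :: real^'n) | x. norm x = 1 \<and> x $ k > 0}"
proof -
  let ?U = "{x :: real^'n. x $ k > 0}"
  have "convex ?U" using convex_halfspace_gt[of 0 "axis k 1 :: real^'n"] by (simp add: inner_axis')
  then have "connected ?U" by (rule convex_connected)
  moreover have "x \<noteq> 0" if "x \<in> ?U" for x using that by auto
  ultimately have "connected ((\<lambda>x. (x /\<^sub>R norm x, 0 :: real^'n)) ` ?U)"
    by (intro connected_continuous_image continuous_intros) auto
  also have "(\<lambda>x. (x /\<^sub>R norm x, 0 :: real^'n)) ` ?U = {(x, 0) | x. norm x = 1 \<and> x $ k > 0}"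
  proof (intro subset_antisym subsetI)
    fix v assume "v \<in> (\<lambda>x. (x /\<^sub>R norm x, 0 :: real^'n)) ` ?U"
    then obtain x where x: "v = (x /\<^sub>R norm x, 0)" "x $ k > 0" by blast
    then have "x \<noteq> 0" by auto
    then show "v \<in> {(x, 0) | x. norm x = 1 \<and> x $ k > 0}" using x by simp
  next
    fix v :: "(real^'n) \<times> (real^'n)"
    assume "v \<in> {(x, 0) | x. norm x = 1 \<and> x $ k > 0}"
    then obtain x where "v = (x, 0)" "norm x = 1" "x $ k > 0" by blast
    then show "v \<in> (\<lambda>x. (x /\<^sub>R norm x, 0 :: real^'n)) ` ?U" by (intro image_eqI[of _ _ x]) auto
  qed
  finally show ?thesis .
qed

lemma saturation_V_hat_subset:
  assumes pot: "stenzel_potential TYPE(7) \<kappa> u" and w: "w \<in> saturation (V_hat u 0 0)"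
  shows "w \<in> flat_TS UNIV \<union> flat_TS (- {1, 2}) \<union> flat_TS (- {3, 4}) \<union> flat_TS (- {1, 2, 3, 4})"
proof -
  have sub: "V_hat u 0 0 \<subseteq> L_hat" by (simp add: V_hat_def)
  obtain p q p' q' y x1 x3 x5 s2 s4 where w_eq: "w = orbit_point p q p' q' y x1 x3 x5 s2 s4"
    and pq: "unit_pair p q" "unit_pair p' q'" "norm y = 1" and v: "base x1 x3 x5 s2 s4 \<in> V_hat u 0 0"
    using w unfolding saturation_eq[OF sub] by blast
  have x: "x1\<^sup>2 + x3\<^sup>2 + x5\<^sup>2 = 1" using v sub base_in_L_hat by blast
  have TS: "w \<in> TS" using orbit_point_in_TS[OF pq] x w_eq by blast
  have "deriv u (rsq (Phi w)) > 0"
    using stenzel_potential_deriv_pos[OF pot rsq_ge_1[OF Phi_in_quadric[OF TS]]] .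
  moreover have "- 2 * deriv u (rsq (Phi w)) * Im (cnj (Phi w $ 1) * Phi w $ 2) = 0"
    "- 2 * deriv u (rsq (Phi w)) * Im (cnj (Phi w $ 3) * Phi w $ 4) = 0"
    using v unfolding V_hat_def Int_iff base_in_moment_level[OF x pq] w_eq by blast+
  ultimately have "Im (cnj (Phi w $ 1) * Phi w $ 2) = 0" "Im (cnj (Phi w $ 3) * Phi w $ 4) = 0"
    by (simp_all del: times_complex.sel)
  then have "cosh (sqrt (s2\<^sup>2 + s4\<^sup>2)) * sinhc (sqrt (s2\<^sup>2 + s4\<^sup>2)) * x1 * s2 = 0"
    "cosh (sqrt (s2\<^sup>2 + s4\<^sup>2)) * sinhc (sqrt (s2\<^sup>2 + s4\<^sup>2)) * x3 * s4 = 0"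
    unfolding w_eq Im_Phi_12[OF pq] Im_Phi_34[OF pq] .
  \<comment> \<open>If s2 and s4 are not both 0, \<open>sinhc\<close> is positive and cancels;
    otherwise the claim is immediate. The four combinations of alternatives are the four
    sets.\<close>
  then have "x1 = 0 \<or> s2 = 0" "x3 = 0 \<or> s4 = 0"
    using sinhc_pos[of "sqrt (s2\<^sup>2 + s4\<^sup>2)"] cosh_real_pos[of "sqrt (s2\<^sup>2 + s4\<^sup>2)"]
    by (auto simp: sum_power2_gt_zero_iff)
  then show ?thesis
    using TS unfolding w_eq by (auto simp: flat_TS_def orbit_point_def forall_7)
qed

text \<open>In each plane x or \<xi> vanishes, so the two are orthogonal, which makes the point an
  orbit point, and the level is 0.\<close>

lemma flat_TS_subset_saturation_V_hat:
  assumes "{5, 6, 7} \<subseteq> A" "1 \<in> A \<longleftrightarrow> 2 \<in> A" "3 \<in> A \<longleftrightarrow> 4 \<in> A"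
  shows "flat_TS A \<subseteq> saturation (V_hat u 0 0)"
proof
  fix w assume w: "w \<in> flat_TS A"
  obtain x \<xi> where x\<xi>: "w = (x, \<xi>)" by force
  have TS: "w \<in> TS" and j: "j \<in> A \<Longrightarrow> \<xi> $ j = 0" "j \<notin> A \<Longrightarrow> x $ j = 0" for j
    using w x\<xi> by (auto simp: flat_TS_def split: if_splits)
  have b: "x $ 1 = 0 \<and> x $ 2 = 0 \<or> \<xi> $ 1 = 0 \<and> \<xi> $ 2 = 0" "x $ 3 = 0 \<and> x $ 4 = 0 \<or> \<xi> $ 3 = 0 \<and> \<xi> $ 4 = 0"
    and \<xi>: "\<xi> $ 5 = 0" "\<xi> $ 6 = 0" "\<xi> $ 7 = 0"
    using assms j by auto
  have b': "Re (Phi w $ 1) * Im (Phi w $ 1) + Re (Phi w $ 2) * Im (Phi w $ 2) = 0"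
    "Re (Phi w $ 3) * Im (Phi w $ 3) + Re (Phi w $ 4) * Im (Phi w $ 4) = 0"
    "Im (cnj (Phi w $ 1) * Phi w $ 2) = 0" "Im (cnj (Phi w $ 3) * Phi w $ 4) = 0"
    using b by (auto simp: Re_Phi Im_Phi x\<xi>)
  obtain p r q s where 1: "unit_pair p q" "x $ 1 = p * r" "x $ 2 = q * r" "\<xi> $ 1 = - q * s" "\<xi> $ 2 = p * s"
    by (rule Re_Im_orthogonal_block[of "x $ 1" "\<xi> $ 1" "x $ 2" "\<xi> $ 2"]) (use b in auto)
  obtain p' r' q' s' where 2: "unit_pair p' q'" "x $ 3 = p' * r'" "x $ 4 = q' * r'" "\<xi> $ 3 = - q' * s'" "\<xi> $ 4 = p' * s'"
    by (rule Re_Im_orthogonal_block[of "x $ 3" "\<xi> $ 3" "x $ 4" "\<xi> $ 4"]) (use b in auto)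
  obtain y :: "real^3" and m where y: "norm y = 1" "x $ 5 = y $ 1 * m" "x $ 6 = y $ 2 * m" "x $ 7 = y $ 3 * m"
    using real3_polar[of "x $ 5" "x $ 6" "x $ 7"] .
  have w_eq: "w = orbit_point p q p' q' y r r' m s s'"
    using 1 2 y \<xi> by (simp add: x\<xi> orbit_point_def vec_eq_iff forall_7)
  have unit: "r\<^sup>2 + r'\<^sup>2 + m\<^sup>2 = 1"
    using TS orbit_point_in_TS[OF 1(1) 2(1) y(1)] unfolding w_eq by blast
  have "base r r' m s s' \<in> V_hat u 0 0"
    unfolding V_hat_def Int_iff base_in_moment_level[OF unit 1(1) 2(1) y(1)] w_eq[symmetric]
    using unit b' by (simp add: base_in_L_hat del: times_complex.sel)
  moreover have "V_hat u 0 0 \<subseteq> L_hat" by (simp add: V_hat_def)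
  ultimately show "w \<in> saturation (V_hat u 0 0)"
    unfolding w_eq saturation_eq[OF \<open>V_hat u 0 0 \<subseteq> L_hat\<close>] using 1(1) 2(1) y(1) by blast
qed

definition hemisphere :: "((real^7) \<times> (real^7)) set" where
  "hemisphere = {(x, 0) | x. norm x = 1 \<and> x $ 7 > 0}"

lemma connected_hemisphere: "connected hemisphere"
  unfolding hemisphere_def by (rule connected_open_half_sphere)

lemma hemisphere_iff: "(x, \<xi>) \<in> hemisphere \<longleftrightarrow> (x, \<xi>) \<in> flat_TS UNIV \<and> x $ 7 > 0"
proof -
  have "\<xi> = 0 \<longleftrightarrow> (\<forall>j. \<xi> $ j = 0)" by (simp add: vec_eq_iff)
  then show ?thesis by (auto simp: hemisphere_def flat_TS_def TS_def)
qed

text \<open>The image is relatively open in \<open>flat UNIV\<close>, so the charts of the latter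
  restrict to it.\<close>

lemma Phi_hemisphere: "Phi ` hemisphere = flat UNIV \<inter> {z. Re (z $ 7) > 0}"
proof -
  have "Re (Phi w $ 7) > 0 \<longleftrightarrow> fst w $ 7 > 0" for w :: "(real^7) \<times> (real^7)"
    using cosh_real_pos[of "norm (snd w)"] unfolding Re_Phi by (metis mult_pos_pos zero_less_mult_pos)
  then have eq: "hemisphere = flat_TS UNIV \<inter> {w. Re (Phi w $ 7) > 0}"
    by (simp add: set_eq_iff hemisphere_iff)
  show ?thesis unfolding eq Phi_flat_TS[symmetric] by auto
qed

lemma special_lagrangian_TS_flat_TS:
  assumes "stenzel_calabi_yau \<kappa> u \<Omega>"
  shows "special_lagrangian_TS u \<Omega> (flat_TS A)"
  using special_lagrangian_flat[OF assms, of UNIV A]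
  by (simp add: special_lagrangian_TS_def Phi_flat_TS flat_TS_subset_TS)

lemma special_lagrangian_TS_hemisphere:
  assumes "stenzel_calabi_yau \<kappa> u \<Omega>"
  shows "special_lagrangian_TS u \<Omega> hemisphere"
proof -
  have "open {z :: complex^7. Re (z $ 7) > 0}"
    by (intro open_Collect_less continuous_intros)
  then show ?thesis
    using special_lagrangian_flat[OF assms, of _ UNIV]
    by (auto simp: special_lagrangian_TS_def Phi_hemisphere hemisphere_iff intro: subsetD[OF flat_TS_subset_TS])
qed

lemma axis_in_flat_TS: "(axis j 1, 0) \<in> flat_TS A \<longleftrightarrow> j \<in> A"
proof -
  have "(axis j 1 :: real^7, 0 :: real^7) \<in> TS" by (simp add: TS_def)
  then show ?thesis by (auto simp: flat_TS_def axis_def)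
qed

definition piece_indices :: "7 set set" where
  "piece_indices = {UNIV, - {1, 2}, - {3, 4}, - {1, 2, 3, 4}}"

lemma piece_indicesD:
  assumes "A \<in> piece_indices"
  shows "{5, 6, 7} \<subseteq> A" "1 \<in> A \<longleftrightarrow> 2 \<in> A" "3 \<in> A \<longleftrightarrow> 4 \<in> A"
  using assms unfolding piece_indices_def by (elim insertE emptyE; simp)+

text \<open>The point \<open>(axis 5 1, 0)\<close> lies in each of the four sets but not in the
  hemisphere; the sets \<open>flat_TS A\<close> are told apart by the unit axes of the zero section
  that they contain.\<close>

lemma card_pieces: "card (insert hemisphere (flat_TS ` piece_indices)) = 5"
proof -
  have "(axis 5 1 :: real^7) $ 7 = 0" by (simp add: axis_def)
  then have "(axis 5 1, 0) \<notin> hemisphere" by (simp add: hemisphere_iff)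
  moreover have "(axis 5 1, 0) \<in> flat_TS A" if "A \<in> piece_indices" for A
    using piece_indicesD(1)[OF that] by (simp add: axis_in_flat_TS)
  ultimately have "hemisphere \<notin> flat_TS ` piece_indices" by blast
  moreover have "inj flat_TS"
  proof
    fix A B assume "flat_TS A = flat_TS B"
    then have "j \<in> A \<longleftrightarrow> j \<in> B" for j
      using axis_in_flat_TS[of j A] axis_in_flat_TS[of j B] by simp
    then show "A = B" by blast
  qed
  then have "card (flat_TS ` piece_indices) = card piece_indices" by (rule card_image[OF inj_on_subset]) simp
  moreover have "card piece_indices = 4"
  proof -
    have "(UNIV :: 7 set) \<noteq> - {1, 2}" "(UNIV :: 7 set) \<noteq> - {3, 4}" "(UNIV :: 7 set) \<noteq> - {1, 2, 3, 4}"
      "- {1, 2 :: 7} \<noteq> - {3, 4}" "- {1, 2 :: 7} \<noteq> - {1, 2, 3, 4}" "- {3, 4 :: 7} \<noteq> - {1, 2, 3, 4}"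
      by (simp_all add: set_eq_iff forall_7 del: Compl_eq_Compl_iff)
    then show ?thesis unfolding piece_indices_def by (simp del: Compl_eq_Compl_iff)
  qed
  moreover have "finite (flat_TS ` piece_indices)" by (simp add: piece_indices_def)
  ultimately show ?thesis by simp
qed

lemma saturation_V_hat_eq:
  assumes "stenzel_potential TYPE(7) \<kappa> u"
  shows "saturation (V_hat u 0 0) = \<Union> (insert hemisphere (flat_TS ` piece_indices))"
proof (intro subset_antisym subsetI)
  fix w assume "w \<in> saturation (V_hat u 0 0)"
  then have "\<exists>A \<in> piece_indices. w \<in> flat_TS A"
    using saturation_V_hat_subset[OF assms] unfolding piece_indices_def by simp
  then show "w \<in> \<Union> (insert hemisphere (flat_TS ` piece_indices))" by blast
next
  fix w assume "w \<in> \<Union> (insert hemisphere (flat_TS ` piece_indices))"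
  moreover have "hemisphere \<subseteq> flat_TS UNIV" by (auto simp: hemisphere_iff)
  moreover have "UNIV \<in> piece_indices" by (simp add: piece_indices_def)
  ultimately obtain A where A: "A \<in> piece_indices" "w \<in> flat_TS A" by blast
  then show "w \<in> saturation (V_hat u 0 0)"
    using flat_TS_subset_saturation_V_hat[OF piece_indicesD[OF A(1)]] by blast
qed

theorem proposition5p2:
  fixes \<kappa> :: real and u :: "real \<Rightarrow> real" and \<Omega> :: "complex^7 \<Rightarrow> (nat \<Rightarrow> complex^7) \<Rightarrow> complex"
  assumes "stenzel_calabi_yau \<kappa> u \<Omega>"
  shows "(\<forall>c1 c2. (c1, c2) \<noteq> (0, 0) \<and> V u c1 c2 \<noteq> {} \<longrightarrow>
            special_lagrangian_TS u \<Omega> (saturation (V u c1 c2))) \<and>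
         (\<exists>\<N>. card \<N> = 5 \<and>
            (\<forall>N\<in>\<N>. N \<noteq> {} \<and> connected N \<and> special_lagrangian_TS u \<Omega> N) \<and>
            saturation (V_hat u 0 0) = \<Union>\<N>)"
proof (intro conjI allI impI)
  fix c1 c2
  have "V u c1 c2 \<subseteq> L_hat" by (auto simp: V_def L_hat_pr_def)
  then show "special_lagrangian_TS u \<Omega> (saturation (V u c1 c2))"
    using special_lagrangian_moment_set[OF assms] saturation_subset_TS
    by (simp add: special_lagrangian_TS_def Phi_saturation_V)
next
  have pot: "stenzel_potential TYPE(7) \<kappa> u" using assms by (simp add: stenzel_calabi_yau_def)
  have flat: "flat_TS A \<noteq> {} \<and> connected (flat_TS A) \<and> special_lagrangian_TS u \<Omega> (flat_TS A)"
    if "A \<in> piece_indices" for A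
  proof -
    have "5 \<in> A" "6 \<in> A" using piece_indicesD(1)[OF that] by auto
    then have "(axis 5 1, 0) \<in> flat_TS A" "connected (flat_TS A)"
      by (simp_all add: axis_in_flat_TS connected_flat_TS)
    then show ?thesis using special_lagrangian_TS_flat_TS[OF assms] by blast
  qed
  have "(axis 7 1, 0) \<in> hemisphere" by (simp add: hemisphere_iff axis_in_flat_TS)
  then have "hemisphere \<noteq> {} \<and> connected hemisphere \<and> special_lagrangian_TS u \<Omega> hemisphere"
    using connected_hemisphere special_lagrangian_TS_hemisphere[OF assms] by auto
  then show "\<exists>\<N>. card \<N> = 5 \<and>
      (\<forall>N\<in>\<N>. N \<noteq> {} \<and> connected N \<and> special_lagrangian_TS u \<Omega> N) \<and> saturation (V_hat u 0 0) = \<Union>\<N>"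
    using flat
    by (intro exI[of _ "insert hemisphere (flat_TS ` piece_indices)"] conjI card_pieces saturation_V_hat_eq[OF pot] ballI)
      (elim insertE imageE; simp)+
qed

end
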